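(* For every $\varepsilon<\varepsilon_c$ (with $\varepsilon\ge 0$) the following relation holds: $$\lim_{L\to\infty}\liminf_{N\to\infty}\mathbb{P}_{\varepsilon,N}\big(\tau\cap[L,N-L]=\varnothing\big)=1.$$
   Context: Potential. $V:\mathbb{R}\to\mathbb{R}\cup\{+\infty\}$ is a function such that: $V(x)=V(-x)$ for all $x$; there is $\gamma>0$ such that $x\mapsto V(x)-\gamma x^2/2$ is convex; $V$ is finite and continuous on a maximal interval $(-a,a)$ with $0<a\le+\infty$, and $V(x)\to+\infty$ as $x\to\pm a$, so that $x\mapsto e^{-V(x)}$ is continuous on $\mathbb{R}$; and $\int_{\mathbb{R}}e^{-V(x)}\,dx=1$. Model. For $b-a\ge2$ and $\varphi:\{a,\dots,b\}\to\mathbb{R}$ let $\mathcal{H}_{[a,b]}(\varphi):=\sum_{n=a+1}^{b-1}V(\Delta\varphi_n)$, where $\Delta\varphi_n:=\varphi_{n+1}+\varphi_{n-1}-2\varphi_n$. For $N\in\mathbb{N}$ and $\varepsilon\ge0$, $\mathbb{P}_{\varepsilon,N}$ is the probability measure on $\mathbb{R}^{N-1}$ $$\mathbb{P}_{\varepsilon,N}(d\varphi_1\cdots d\varphi_{N-1})=\frac{\exp(-\mathcal{H}_{[-1,N+1]}(\varphi))}{\mathcal{Z}_{\varepsilon,N}}\prod_{i=1}^{N-1}(\varepsilon\,\delta_0(d\varphi_i)+d\varphi_i),$$ where $d\varphi_i$ is Lebesgue measure, $\delta_0$ is the Dirac mass at $0$, $\mathcal{Z}_{\varepsilon,N}$ is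 the normalization constant, and $\varphi_{-1}=\varphi_0=\varphi_N=\varphi_{N+1}=0$. Critical point. Let $\ell_N:=\#\{i\in\{1,\dots,N\}:\varphi_i=0\}$. It is known that there is $\varepsilon_c\in(0,\infty)$ (determined by the following dichotomy) such that: if $\varepsilon\le\varepsilon_c$, then for every $\delta>0$ there is $c_1>0$ with $\mathbb{P}_{\varepsilon,N}(\ell_N/N>\delta)\le e^{-c_1N}$ for all $N$; if $\varepsilon>\varepsilon_c$, there is $D(\varepsilon)>0$ such that for every $\delta>0$ there is $c_2>0$ with $\mathbb{P}_{\varepsilon,N}(|\ell_N/N-D(\varepsilon)|>\delta)\le e^{-c_2N}$ for all $N$. Contact set. $\tau:=\{i\in\mathbb{Z}^+:\varphi_i=0\}$, where $\mathbb{Z}^+=\{0,1,2,\dots\}$ (under $\mathbb{P}_{\varepsilon,N}$ only indices $i\le N$ are considered). *)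

theory Defs
  imports "HOL-Probability.Probability"
begin

section \<open>The potential\<close>

text \<open>
  Potentials take values in \<open>\<real> \<union> {+\<infinity>}\<close>; they are modelled as functions into \<^typ>\<open>ereal\<close> that
  avoid \<open>-\<infinity>\<close>. Convexity of such functions is the usual inequality in the extended reals.
\<close>

definition ereal_convex :: "(real \<Rightarrow> ereal) \<Rightarrow> bool" where
  "ereal_convex f \<longleftrightarrow>
     (\<forall>x y t. 0 < t \<and> t < 1 \<longrightarrow>
        f ((1 - t) * x + t * y) \<le> ereal (1 - t) * f x + ereal t * f y)"

definition finite_continuous_on :: "ereal \<Rightarrow> (real \<Rightarrow> ereal) \<Rightarrow> bool" where
  "finite_continuous_on a V \<longleftrightarrow>
     (\<forall>x. ereal \<bar>x\<bar> < a \<longrightarrow> \<bar>V x\<bar> \<noteq> \<infinity>) \<and> continuous_on {x. ereal \<bar>x\<bar> < a} V"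

definition exp_neg :: "ereal \<Rightarrow> real" where
  "exp_neg h = (if h = \<infinity> then 0 else exp (- real_of_ereal h))"

text \<open>
  The endpoint \<open>a\<close> may be \<open>\<infinity>\<close>; the one-sided limits at \<open>\<plusminus>a\<close> are therefore taken in the extended
  reals, so that for \<open>a = \<infinity>\<close> they are limits as \<open>x \<rightarrow> \<plusminus>\<infinity>\<close>. By convexity they force \<open>V = +\<infinity>\<close>
  outside \<open>(-a, a)\<close>, so continuity of \<open>exp (-V)\<close> on the real line is a consequence and not an
  additional condition.
\<close>

definition admissible_potential :: "(real \<Rightarrow> ereal) \<Rightarrow> bool" where
  "admissible_potential V \<longleftrightarrow>
     (\<forall>x. V x \<noteq> -\<infinity>) \<and>
     (\<forall>x. V (- x) = V x) \<and>
     (\<exists>\<gamma>>0. ereal_convex (\<lambda>x. V x - ereal (\<gamma> * x\<^sup>2 / 2))) \<and>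
     (\<exists>a>0. finite_continuous_on a V \<and> (\<forall>b>a. \<not> finite_continuous_on b V) \<and>
        ((V \<circ> real_of_ereal) \<longlongrightarrow> \<infinity>) (at_left a) \<and>
        ((V \<circ> real_of_ereal) \<longlongrightarrow> \<infinity>) (at_right (- a))) \<and>
     has_bochner_integral lborel (\<lambda>x. exp_neg (V x)) 1"

section \<open>The pinning model with Laplacian interaction\<close>

definition laplacian :: "(int \<Rightarrow> real) \<Rightarrow> int \<Rightarrow> real" where
  "laplacian \<phi> n = \<phi> (n + 1) + \<phi> (n - 1) - 2 * \<phi> n"

definition hamiltonian :: "(real \<Rightarrow> ereal) \<Rightarrow> int \<Rightarrow> int \<Rightarrow> (int \<Rightarrow> real) \<Rightarrow> ereal" where
  "hamiltonian V a b \<phi> = (\<Sum>n\<in>{a + 1..b - 1}. V (laplacian \<phi> n))"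

text \<open>
  \<open>\<real>\<^sup>N\<^sup>-\<^sup>1\<close> is the product space over the index set \<open>{1..N - 1}\<close>, whose points are \<^const>\<open>undefined\<close>
  outside this set. \<open>zero_boundary N\<close> replaces these values by \<open>0\<close>, which gives in particular the
  boundary conditions at \<open>-1, 0, N, N + 1\<close>.
\<close>

definition zero_boundary :: "nat \<Rightarrow> (int \<Rightarrow> real) \<Rightarrow> int \<Rightarrow> real" where
  "zero_boundary N \<phi> n = (if n \<in> {1..int N - 1} then \<phi> n else 0)"

definition site_measure :: "real \<Rightarrow> real measure" where
  "site_measure \<epsilon> =
     measure_of UNIV (sets borel) (\<lambda>A. ennreal \<epsilon> * emeasure (return borel 0) A + emeasure lborel A)"

lemma space_site_measure [simp]: "space (site_measure \<epsilon>) = UNIV"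
  by (simp add: site_measure_def space_measure_of_conv)

lemma sets_site_measure [simp, measurable_cong]: "sets (site_measure \<epsilon>) = sets borel"
  using sets.sigma_sets_eq[of "borel :: real measure"]
  by (simp add: site_measure_def sets_measure_of_conv)

lemma emeasure_site_measure:
  assumes "A \<in> sets borel"
  shows "emeasure (site_measure \<epsilon>) A =
    ennreal \<epsilon> * emeasure (return borel 0) A + emeasure lborel A"
proof (rule emeasure_measure_of[OF site_measure_def])
  show "countably_additive (sets (site_measure \<epsilon>))
    (\<lambda>A. ennreal \<epsilon> * emeasure (return borel 0) A + emeasure lborel A)"
  proof (rule countably_additiveI)
    fix B :: "nat \<Rightarrow> real set"
    assume "range B \<subseteq> sets (site_measure \<epsilon>)" and d: "disjoint_family B"
    then have B: "range B \<subseteq> sets borel" by simp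
    have "(\<Sum>i. ennreal \<epsilon> * emeasure (return borel 0) (B i) + emeasure lborel (B i)) =
        ennreal \<epsilon> * (\<Sum>i. emeasure (return borel 0) (B i)) + (\<Sum>i. emeasure lborel (B i))"
      by (simp add: suminf_add[symmetric] summableI)
    also have "\<dots> = ennreal \<epsilon> * emeasure (return borel 0) (\<Union>i. B i) + emeasure lborel (\<Union>i. B i)"
      by (subst (1 2) suminf_emeasure) (use B d in simp_all)
    finally show "(\<Sum>i. ennreal \<epsilon> * emeasure (return borel 0) (B i) + emeasure lborel (B i)) =
      ennreal \<epsilon> * emeasure (return borel 0) (\<Union>i. B i) + emeasure lborel (\<Union>i. B i)" .
  qed
qed (use assms in \<open>auto simp: positive_def\<close>)

definition reference_measure :: "real \<Rightarrow> nat \<Rightarrow> (int \<Rightarrow> real) measure" where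
  "reference_measure \<epsilon> N = Pi\<^sub>M {1..int N - 1} (\<lambda>_. site_measure \<epsilon>)"

definition boltzmann_weight :: "(real \<Rightarrow> ereal) \<Rightarrow> nat \<Rightarrow> (int \<Rightarrow> real) \<Rightarrow> ennreal" where
  "boltzmann_weight V N \<phi> =
     ennreal (exp_neg (hamiltonian V (- 1) (int N + 1) (zero_boundary N \<phi>)))"

definition partition_function :: "(real \<Rightarrow> ereal) \<Rightarrow> real \<Rightarrow> nat \<Rightarrow> ennreal" where
  "partition_function V \<epsilon> N = (\<integral>\<^sup>+ \<phi>. boltzmann_weight V N \<phi> \<partial>reference_measure \<epsilon> N)"

definition pinning_measure :: "(real \<Rightarrow> ereal) \<Rightarrow> real \<Rightarrow> nat \<Rightarrow> (int \<Rightarrow> real) measure" where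
  "pinning_measure V \<epsilon> N =
     density (reference_measure \<epsilon> N) (\<lambda>\<phi>. boltzmann_weight V N \<phi> / partition_function V \<epsilon> N)"

definition contact_set :: "nat \<Rightarrow> (int \<Rightarrow> real) \<Rightarrow> int set" where
  "contact_set N \<phi> = {i \<in> {0..int N}. zero_boundary N \<phi> i = 0}"

definition contact_number :: "nat \<Rightarrow> (int \<Rightarrow> real) \<Rightarrow> nat" where
  "contact_number N \<phi> = card {i \<in> {1..int N}. zero_boundary N \<phi> i = 0}"

section \<open>The critical point\<close>

text \<open>
  The exponential bounds are required for all large \<open>N\<close>, with a threshold that may depend on
  \<open>\<epsilon>\<close> and \<open>\<delta>\<close>. They cannot hold for literally every \<open>N\<close>: since \<open>\<phi>\<^sub>N = 0\<close>, the contact number is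
  at least \<open>1\<close>, so for \<open>\<delta> < 1 / N\<close> the first event has probability \<open>1\<close>.
\<close>

definition critical_point :: "(real \<Rightarrow> ereal) \<Rightarrow> real \<Rightarrow> bool" where
  "critical_point V \<epsilon>\<^sub>c \<longleftrightarrow>
     0 < \<epsilon>\<^sub>c \<and>
     (\<forall>\<epsilon>. 0 \<le> \<epsilon> \<and> \<epsilon> \<le> \<epsilon>\<^sub>c \<longrightarrow>
        (\<forall>\<delta>>0. \<exists>c>0. \<forall>\<^sub>F N in sequentially.
           \<P>(\<phi> in pinning_measure V \<epsilon> N. real (contact_number N \<phi>) / real N > \<delta>)
             \<le> exp (- c * real N))) \<and>
     (\<forall>\<epsilon>>\<epsilon>\<^sub>c. \<exists>D>0. \<forall>\<delta>>0. \<exists>c>0. \<forall>\<^sub>F N in sequentially.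
        \<P>(\<phi> in pinning_measure V \<epsilon> N. \<bar>real (contact_number N \<phi>) / real N - D\<bar> > \<delta>)
          \<le> exp (- c * real N))"

end

theory Submission
  imports Defs
begin

text \<open>
  Write \<open>g = exp (-V)\<close>, an even log-concave probability density. The Boltzmann weight is the product
  of the factors \<open>g (\<phi>\<^sub>i\<^sub>+\<^sub>1 + \<phi>\<^sub>i\<^sub>-\<^sub>1 - 2 * \<phi>\<^sub>i)\<close>, so all partition functions arise by iterating an operator
  \<open>step\<close> that acts on functions of two consecutive heights. With \<open>k = N - 1\<close>, the normalization is
  \<open>return_weight \<epsilon> k\<close>, and a contact at site \<open>i + 1\<close> has probability \<open>\<epsilon> * T\<^sub>i / return_weight \<epsilon> k\<close>, where
  \<open>T\<^sub>i = contact_split_weight \<epsilon> k i\<close> integrates, over the height just before the contact, the weight of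
  the path to the left times the weight of the path to the right. By a union bound the theorem
  says that the sum of the \<open>T\<^sub>i\<close> over all \<open>i\<close> at distance at least \<open>P\<close> from both ends is, uniformly in
  \<open>k\<close>, an arbitrarily small multiple of \<open>return_weight \<epsilon> k\<close> when \<open>P\<close> is large.

  The idea that makes this elementary is log-concavity. As functions of two heights, the weights
  are sums, over the possible contact sets, of even log-concave functions, because marginals of
  log-concave functions are log-concave (\<open>log_concave_marginal\<close>). Hence they are largest at \<open>(0, 0)\<close>,
  and \<open>T\<^sub>i\<close> is at most \<open>return_weight \<epsilon> (k - 1 - i) * contact_mass \<epsilon> i\<close>, where \<open>contact_mass \<epsilon> i\<close> is the
  weight of the left part with a free slope at the contact; by time reversal there is a mirror
  image of this bound. Use the first bound in the left half and the second one in the right half.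
  If the return weights are of exact order \<open>1 / k\<^sup>2\<close> and the contact masses are summable, then the
  sum of the \<open>T\<^sub>i\<close> is at most a constant times \<open>1 / k\<^sup>2\<close> times a tail of a convergent series
  (\<open>sum_contact_split_weight_le\<close>), which is what is needed.

  Without pinning, the last two heights after \<open>n\<close> steps have an even log-concave density. Its
  height and slope have standard deviations of order \<open>n\<^sup>3\<^sup>/\<^sup>2\<close> and \<open>n\<^sup>1\<^sup>/\<^sup>2\<close>, and for even log-concave
  densities the value at the origin is comparable to the inverse of the product of these numbers
  (\<open>free_weight_bounds\<close>). In the same way the density of the height at \<open>0\<close> is of order \<open>n\<^sup>-\<^sup>3\<^sup>/\<^sup>2\<close>, which
  is summable (\<open>hitting_density_le\<close>).

  With pinning, three steps lead to the bounds on return weights and contact masses.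
  First, the return weights are summable for \<open>\<epsilon> < \<epsilon>\<^sub>c\<close> (\<open>suminf_return_weight_finite\<close>). At \<open>\<epsilon>\<^sub>c\<close> typical
  configurations have \<open>o(N)\<close> contacts, so the normalization at \<open>\<epsilon>\<^sub>c\<close> exceeds the one at a very small
  pinning strength by a subexponential factor only. On the other hand, split the weight \<open>\<epsilon>\<^sub>c\<close> of a
  contact into \<open>\<epsilon>\<close> and \<open>\<epsilon>\<^sub>c - \<epsilon>\<close>. Two adjacent zeros cut a path into independent pieces, and this
  renewal structure would make the normalization at \<open>\<epsilon>\<^sub>c\<close> grow exponentially if the return weights
  at \<open>\<epsilon>\<close> had a large sum.
  Second, the contact masses are summable (\<open>suminf_contact_mass_finite\<close>). Decompose at the last
  contact: if the slope there is large, the next contact is unlikely, so such terms can be absorbed;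
  if the slope stays in a bounded window, the return weights bound the term.
  Third, the return weights decay like \<open>1 / k\<^sup>2\<close> (\<open>return_weight_bound\<close>). A path either has no contact
  in the bulk, which costs \<open>1 / k\<^sup>2\<close> as for the field without pinning, or it has one, and the bound on
  the sum of the \<open>T\<^sub>i\<close>, now used with induction on \<open>k\<close>, gives a small multiple of \<open>1 / k\<^sup>2\<close>.
\<close>

section \<open>Log-concave functions and the Prekopa-Leindler inequality\<close>

text \<open>
  The inequality is written with powers instead of logarithms so that \<open>f\<close> may vanish: \<open>0 powr t = 0\<close>
  makes it trivial when one of the two points lies outside the support.
\<close>

definition log_concave :: "('a::real_vector \<Rightarrow> real) \<Rightarrow> bool" where
  "log_concave f \<longleftrightarrow> (\<forall>p. 0 \<le> f p) \<and>
     (\<forall>p q t. 0 < t \<and> t < 1 \<longrightarrow>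
        f p powr (1 - t) * f q powr t \<le> f ((1 - t) *\<^sub>R p + t *\<^sub>R q))"

lemma log_concave_nonneg: "log_concave f \<Longrightarrow> 0 \<le> f p"
  by (simp add: log_concave_def)

lemma log_concaveD:
  "log_concave f \<Longrightarrow> 0 < t \<Longrightarrow> t < 1 \<Longrightarrow>
    f p powr (1 - t) * f q powr t \<le> f ((1 - t) *\<^sub>R p + t *\<^sub>R q)"
  by (simp add: log_concave_def)

lemma log_concave_mult:
  assumes "log_concave f" "log_concave h"
  shows "log_concave (\<lambda>p. f p * h p)"
  unfolding log_concave_def
proof (intro conjI allI impI)
  fix p show "0 \<le> f p * h p" using assms by (simp add: log_concave_nonneg)
next
  fix p q and t :: real assume t: "0 < t \<and> t < 1"
  have "(f p * h p) powr (1 - t) * (f q * h q) powr t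
      = (f p powr (1 - t) * f q powr t) * (h p powr (1 - t) * h q powr t)"
    using assms by (simp add: powr_mult log_concave_nonneg)
  also have "\<dots> \<le> f ((1 - t) *\<^sub>R p + t *\<^sub>R q) * h ((1 - t) *\<^sub>R p + t *\<^sub>R q)"
    using assms t by (intro mult_mono log_concaveD) (auto simp: log_concave_nonneg)
  finally show "(f p * h p) powr (1 - t) * (f q * h q) powr t
      \<le> f ((1 - t) *\<^sub>R p + t *\<^sub>R q) * h ((1 - t) *\<^sub>R p + t *\<^sub>R q)" .
qed

lemma log_concave_linear:
  assumes "log_concave f" "linear A"
  shows "log_concave (\<lambda>p. f (A p))"
  using assms by (auto simp: log_concave_def linear_add linear_cmul)

lemma log_concave_cmult: "log_concave f \<Longrightarrow> 0 \<le> c \<Longrightarrow> log_concave (\<lambda>p. c * f p)"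
proof -
  assume "log_concave f" "0 \<le> c"
  moreover have "log_concave (\<lambda>p::'a. c)"
    using \<open>0 \<le> c\<close> by (auto simp: log_concave_def simp flip: powr_add)
  ultimately show ?thesis by (intro log_concave_mult)
qed

lemma log_concave_convex_superlevel:
  assumes "log_concave f" and "0 \<le> c"
  shows "convex {p. c < f p}"
proof (rule convexI)
  fix p q and u v :: real
  assume pq: "p \<in> {p. c < f p}" "q \<in> {p. c < f p}" and uv: "0 \<le> u" "0 \<le> v" "u + v = 1"
  show "u *\<^sub>R p + v *\<^sub>R q \<in> {p. c < f p}"
  proof (cases "0 < v \<and> v < 1")
    case True
    then have "c powr (1 - v) * c powr v < f p powr (1 - v) * f q powr v"
      using pq assms(2) by (intro mult_strict_mono') (auto intro: powr_less_mono2)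
    also have "c powr (1 - v) * c powr v = c"
      using assms(2) by (simp flip: powr_add)
    also have "f p powr (1 - v) * f q powr v \<le> f ((1 - v) *\<^sub>R p + v *\<^sub>R q)"
      using True assms(1) by (intro log_concaveD) auto
    also have "1 - v = u" using uv by simp
    finally show ?thesis by simp
  next
    case False
    then have "u = 0 \<and> v = 1 \<or> u = 1 \<and> v = 0" using uv by linarith
    then show ?thesis using pq by auto
  qed
qed

lemma weighted_arith_geo_mean:
  fixes x y t :: real
  assumes "0 \<le> x" "0 \<le> y" "0 < t" "t < 1"
  shows "x powr (1 - t) * y powr t \<le> (1 - t) * x + t * y"
  using Youngs_inequality_0[of "1 - t" t x y] assms by (cases "x = 0 \<or> y = 0") auto

lemma emeasure_lborel_le_diameter:
  fixes A :: "real set"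
  assumes "A \<noteq> {}" and "\<And>x y. x \<in> A \<Longrightarrow> y \<in> A \<Longrightarrow> y - x \<le> d"
  shows "emeasure lborel A \<le> ennreal d"
proof -
  obtain a where a: "a \<in> A" using assms by auto
  have bdd: "bdd_below A" using assms(2)[OF _ a] by (intro bdd_belowI[of _ "a - d"]) (simp add: algebra_simps)
  have "A \<subseteq> {Inf A..Inf A + d}"
  proof
    fix y assume y: "y \<in> A"
    have "y - d \<le> Inf A" using assms y by (intro cInf_greatest) (auto simp: algebra_simps)
    then show "y \<in> {Inf A..Inf A + d}" using cInf_lower[OF y bdd] by auto
  qed
  moreover have "0 \<le> d" using assms(2)[OF a a] by simp
  ultimately show ?thesis
    using emeasure_mono[of A "{Inf A..Inf A + d}" lborel] by simp
qed

text \<open>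
  Two pairs of points, one from \<open>A\<close> and one from \<open>B\<close>, span a segment inside the convex set \<open>H\<close>, whose
  length is therefore at most the measure of \<open>H\<close>. Optimizing the first pair and then the second one
  gives the inequality, since the measure of a set is at most its diameter.
\<close>

lemma brunn_minkowski_interval:
  fixes A B H :: "real set"
  assumes "A \<noteq> {}" "B \<noteq> {}" "convex H" "H \<in> sets borel" and t: "0 < t" "t < 1"
    and sum: "\<And>x y. x \<in> A \<Longrightarrow> y \<in> B \<Longrightarrow> (1 - t) * x + t * y \<in> H"
  shows "ennreal (1 - t) * emeasure lborel A + ennreal t * emeasure lborel B \<le> emeasure lborel H"
proof (cases "emeasure lborel H = \<infinity>")
  case False
  then obtain h where h: "0 \<le> h" "emeasure lborel H = ennreal h"
    by (cases "emeasure lborel H") auto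
  have key: "(1 - t) * (y - x) + t * (y' - x') \<le> h"
    if "x \<in> A" "y \<in> A" "x' \<in> B" "y' \<in> B" for x y x' y'
  proof -
    let ?l = "(1 - t) * x + t * x'" and ?r = "(1 - t) * y + t * y'"
    show ?thesis
    proof (cases "?l \<le> ?r")
      case True
      have "closed_segment ?l ?r \<subseteq> H"
        using assms(3) sum that by (intro closed_segment_subset) auto
      then have "{?l..?r} \<subseteq> H" using True by (simp add: closed_segment_eq_real_ivl)
      then have "emeasure lborel {?l..?r} \<le> emeasure lborel H"
        using assms(4) by (intro emeasure_mono) auto
      then have "?r - ?l \<le> h" using h True by simp
      then show ?thesis by (simp add: algebra_simps)
    next
      case False
      then show ?thesis using h(1) by (simp add: algebra_simps)
    qed
  qed
  define \<alpha> where "\<alpha> = enn2real (emeasure lborel A)"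
  have A_le: "emeasure lborel A \<le> ennreal ((h - t * (y' - x')) / (1 - t))" if "x' \<in> B" "y' \<in> B" for x' y'
    using assms(1) t key[OF _ _ that]
    by (intro emeasure_lborel_le_diameter) (auto simp: field_simps)
  obtain b where b: "b \<in> B" using assms(2) by auto
  have "emeasure lborel A \<noteq> \<infinity>" using A_le[OF b b] by (auto simp: top_unique)
  then have \<alpha>: "emeasure lborel A = ennreal \<alpha>" "0 \<le> \<alpha>" by (simp_all add: \<alpha>_def less_top)
  have "y' - x' \<le> (h - (1 - t) * \<alpha>) / t" if "x' \<in> B" "y' \<in> B" for x' y'
  proof -
    obtain a where "a \<in> A" using assms(1) by auto
    from key[OF this this that] have "0 \<le> (h - t * (y' - x')) / (1 - t)" using t by simp
    then have "\<alpha> \<le> (h - t * (y' - x')) / (1 - t)" using A_le[OF that] \<alpha> by simp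
    then show ?thesis using t by (simp add: field_simps)
  qed
  then have B_le: "emeasure lborel B \<le> ennreal ((h - (1 - t) * \<alpha>) / t)"
    using assms(2) by (intro emeasure_lborel_le_diameter) auto
  moreover have B_nn: "0 \<le> (h - (1 - t) * \<alpha>) / t"
    using \<open>\<And>x' y'. \<lbrakk>x' \<in> B; y' \<in> B\<rbrakk> \<Longrightarrow> y' - x' \<le> (h - (1 - t) * \<alpha>) / t\<close>[OF b b] by simp
  ultimately have "ennreal (1 - t) * emeasure lborel A + ennreal t * emeasure lborel B
      \<le> ennreal (1 - t) * ennreal \<alpha> + ennreal t * ennreal ((h - (1 - t) * \<alpha>) / t)"
    unfolding \<alpha> by (intro add_mono mult_left_mono) auto
  also have "\<dots> = ennreal h"
  proof -
    have "ennreal t * ennreal ((h - (1 - t) * \<alpha>) / t) = ennreal (h - (1 - t) * \<alpha>)"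
      using t B_nn by (simp flip: ennreal_mult)
    moreover have "0 \<le> h - (1 - t) * \<alpha>" using B_nn t by (simp add: zero_le_divide_iff)
    ultimately show ?thesis using t \<alpha>(2) by (simp flip: ennreal_mult ennreal_plus)
  qed
  finally show ?thesis using h by simp
qed simp

text \<open>
  Levels are counted in multiples of \<open>c\<close>, which allows functions with different suprema to be
  compared level by level.
\<close>

lemma nn_integral_layer_cake:
  fixes f :: "real \<Rightarrow> real"
  assumes [measurable]: "f \<in> borel_measurable borel" and "\<And>u. 0 \<le> f u" and "0 < c"
  shows "(\<integral>\<^sup>+u. ennreal (f u) \<partial>lborel) =
    ennreal c * (\<integral>\<^sup>+s. indicator {0<..} s * emeasure lborel {u. s * c < f u} \<partial>lborel)"
proof -
  have len: "(\<integral>\<^sup>+s. indicator {0<..<f u / c} s \<partial>lborel) = ennreal (f u / c)" for u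
    using assms by simp
  have "(\<integral>\<^sup>+u. ennreal (f u) \<partial>lborel) = (\<integral>\<^sup>+u. ennreal c * ennreal (f u / c) \<partial>lborel)"
    using assms by (intro nn_integral_cong) (simp flip: ennreal_mult)
  also have "\<dots> = ennreal c * (\<integral>\<^sup>+u. (\<integral>\<^sup>+s. indicator {0<..<f u / c} s \<partial>lborel) \<partial>lborel)"
    unfolding len by (rule nn_integral_cmult) simp
  also have "(\<integral>\<^sup>+u. (\<integral>\<^sup>+s. indicator {0<..<f u / c} s \<partial>lborel) \<partial>lborel)
     = (\<integral>\<^sup>+u. (\<integral>\<^sup>+s. indicator {0<..} s * indicator {u. s * c < f u} u \<partial>lborel) \<partial>lborel)"
    using \<open>0 < c\<close> by (intro nn_integral_cong) (auto simp: indicator_def field_simps)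
  also have "\<dots> = (\<integral>\<^sup>+s. (\<integral>\<^sup>+u. indicator {0<..} s * indicator {u. s * c < f u} u \<partial>lborel) \<partial>lborel)"
    by (rule lborel_pair.Fubini') measurable
  also have "\<dots> = (\<integral>\<^sup>+s. indicator {0<..} s * emeasure lborel {u. s * c < f u} \<partial>lborel)"
    by (intro nn_integral_cong) (simp add: nn_integral_cmult)
  finally show ?thesis .
qed

text \<open>
  Measure the levels of \<open>f\<close> and \<open>h\<close> relative to their suprema \<open>a\<close> and \<open>b\<close>. For every relative level
  \<open>s < 1\<close> both superlevel sets are nonempty, and their convex combination lies in the superlevel set
  of \<open>k\<close> at level \<open>s * a powr (1 - t) * b powr t\<close>. The Brunn-Minkowski inequality, integrated over \<open>s\<close>,
  gives a weighted arithmetic mean, and this dominates the geometric mean. Working with relative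
  levels is essential: at absolute levels one of the two sets could be empty.
\<close>

lemma prekopa_leindler_real:
  fixes f h k :: "real \<Rightarrow> real"
  assumes f: "log_concave f" "f \<in> borel_measurable borel" "\<And>u. f u \<le> K"
    and h: "log_concave h" "h \<in> borel_measurable borel" "\<And>u. h u \<le> K"
    and k: "log_concave k" "k \<in> borel_measurable borel"
    and t: "0 < t" "t < 1"
    and le: "\<And>u v. f u powr (1 - t) * h v powr t \<le> k ((1 - t) * u + t * v)"
    and fI: "(\<integral>\<^sup>+u. ennreal (f u) \<partial>lborel) = ennreal I" "0 \<le> I"
    and hI: "(\<integral>\<^sup>+u. ennreal (h u) \<partial>lborel) = ennreal J" "0 \<le> J"
    and kI: "(\<integral>\<^sup>+u. ennreal (k u) \<partial>lborel) = ennreal L" "0 \<le> L"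
  shows "I powr (1 - t) * J powr t \<le> L"
proof (cases "I = 0 \<or> J = 0")
  case True
  then show ?thesis using kI by auto
next
  case False
  note [measurable] = f(2) h(2) k(2)
  have nn: "0 \<le> f u" "0 \<le> h u" "0 \<le> k u" for u using f h k by (auto simp: log_concave_nonneg)
  have bdd: "bdd_above (range f)" "bdd_above (range h)" using f(3) h(3) by (auto simp: bdd_above_def)
  define a b where "a = Sup (range f)" and "b = Sup (range h)"
  have le_ab: "f u \<le> a" "h u \<le> b" for u unfolding a_def b_def by (auto intro: cSup_upper bdd)
  have "0 < a"
  proof (rule ccontr)
    assume "\<not> 0 < a"
    then have "f u = 0" for u using le_ab(1)[of u] nn(1)[of u] by linarith
    then show False using fI False by (auto simp: zero_ennreal_def[symmetric])
  qed
  have "0 < b"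
  proof (rule ccontr)
    assume "\<not> 0 < b"
    then have "h u = 0" for u using le_ab(2)[of u] nn(2)[of u] by linarith
    then show False using hI False by (auto simp: zero_ennreal_def[symmetric])
  qed
  define c where "c = a powr (1 - t) * b powr t"
  have c: "0 < c" using \<open>0 < a\<close> \<open>0 < b\<close> by (simp add: c_def)
  let ?m = "\<lambda>f c s. indicator {0<..} s * emeasure lborel {u. s * c < f u} :: ennreal"
  have level: "ennreal (1 - t) * ?m f a s + ennreal t * ?m h b s \<le> ?m k c s" for s :: real
  proof (cases "0 < s")
    case False
    then show ?thesis by simp
  next
    case s: True
    show ?thesis
    proof (cases "s < 1")
      case True
      have ex: "\<exists>u. s * a < f u"
      proof -
        have "s * a < Sup (range f)" using True \<open>0 < a\<close> by (simp flip: a_def)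
        then show ?thesis using less_cSup_iff[of "range f" "s * a"] bdd by auto
      qed
      have ex': "\<exists>u. s * b < h u"
      proof -
        have "s * b < Sup (range h)" using True \<open>0 < b\<close> by (simp flip: b_def)
        then show ?thesis using less_cSup_iff[of "range h" "s * b"] bdd by auto
      qed
      have "ennreal (1 - t) * emeasure lborel {u. s * a < f u} + ennreal t * emeasure lborel {u. s * b < h u}
        \<le> emeasure lborel {u. s * c < k u}"
      proof (rule brunn_minkowski_interval[OF _ _ _ _ t])
        show "convex {u. s * c < k u}" using k(1) s c by (intro log_concave_convex_superlevel) auto
        fix x y assume "x \<in> {u. s * a < f u}" "y \<in> {u. s * b < h u}"
        then have "(s * a) powr (1 - t) * (s * b) powr t < f x powr (1 - t) * h y powr t"
          using s \<open>0 < a\<close> \<open>0 < b\<close> t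
          by (intro mult_strict_mono') (auto intro!: powr_less_mono2)
        also have "\<dots> \<le> k ((1 - t) * x + t * y)" by (rule le)
        also have "(s * a) powr (1 - t) * (s * b) powr t = s powr (1 - t + t) * c"
          using s \<open>0 < a\<close> \<open>0 < b\<close> by (simp only: powr_add) (simp add: powr_mult c_def)
        also have "\<dots> = s * c" using s by simp
        finally show "(1 - t) * x + t * y \<in> {u. s * c < k u}" by simp
      qed (use ex ex' in \<open>auto\<close>)
      then show ?thesis using s by simp
    next
      case False
      have "a \<le> s * a" "b \<le> s * b"
        using False \<open>0 < a\<close> \<open>0 < b\<close> mult_right_mono[of 1 s a] mult_right_mono[of 1 s b] by auto
      then have "f u \<le> s * a" "h u \<le> s * b" for u using le_ab[of u] by linarith+
      then have "{u. s * a < f u} = {}" "{u. s * b < h u} = {}" by (simp_all add: not_less)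
      then show ?thesis by simp
    qed
  qed
  have meas: "?m f' c' \<in> borel_measurable lborel" if [measurable]: "f' \<in> borel_measurable borel" for f' :: "real \<Rightarrow> real" and c'
    by measurable
  define \<alpha> where "\<alpha> = (\<integral>\<^sup>+s. ?m f a s \<partial>lborel)"
  define \<beta> where "\<beta> = (\<integral>\<^sup>+s. ?m h b s \<partial>lborel)"
  define \<kappa> where "\<kappa> = (\<integral>\<^sup>+s. ?m k c s \<partial>lborel)"
  have "ennreal (1 - t) * \<alpha> + ennreal t * \<beta> = (\<integral>\<^sup>+s. ennreal (1 - t) * ?m f a s + ennreal t * ?m h b s \<partial>lborel)"
    unfolding \<alpha>_def \<beta>_def using f(2) h(2) by (subst nn_integral_add) (auto simp: nn_integral_cmult meas)
  also have "\<dots> \<le> \<kappa>" unfolding \<kappa>_def by (intro nn_integral_mono level)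
  finally have ineq: "ennreal (1 - t) * \<alpha> + ennreal t * \<beta> \<le> \<kappa>" .
  have eqs: "ennreal I = ennreal a * \<alpha>" "ennreal J = ennreal b * \<beta>" "ennreal L = ennreal c * \<kappa>"
    unfolding fI(1)[symmetric] hI(1)[symmetric] kI(1)[symmetric] \<alpha>_def \<beta>_def \<kappa>_def
    by (intro nn_integral_layer_cake nn f h k \<open>0 < a\<close> \<open>0 < b\<close> c)+
  have conv: "X = ennreal (R / s)" if "ennreal R = ennreal s * X" "0 < s" "0 \<le> R" for X R and s :: real
  proof -
    have "X \<noteq> \<infinity>" using that by (auto simp: ennreal_mult_top)
    then obtain x where "X = ennreal x" "0 \<le> x" by (cases X) auto
    then show ?thesis using that by (simp flip: ennreal_mult)
  qed
  have "\<alpha> = ennreal (I / a)" "\<beta> = ennreal (J / b)" "\<kappa> = ennreal (L / c)"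
    using conv eqs \<open>0 < a\<close> \<open>0 < b\<close> c fI hI kI by auto
  with ineq have "(1 - t) * (I / a) + t * (J / b) \<le> L / c"
    using fI hI kI t c \<open>0 < a\<close> \<open>0 < b\<close> by (simp flip: ennreal_mult ennreal_plus)
  moreover have "(I / a) powr (1 - t) * (J / b) powr t \<le> (1 - t) * (I / a) + t * (J / b)"
    using fI hI t \<open>0 < a\<close> \<open>0 < b\<close> by (intro weighted_arith_geo_mean) auto
  ultimately have "(I / a) powr (1 - t) * (J / b) powr t \<le> L / c" by linarith
  also have "(I / a) powr (1 - t) * (J / b) powr t = I powr (1 - t) * J powr t / c"
    using fI hI \<open>0 < a\<close> \<open>0 < b\<close> by (simp add: powr_divide c_def)
  finally show ?thesis using c by (simp add: divide_le_cancel)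
qed

text \<open>
  Log-concavity survives the integration over one height of the field.
\<close>

lemma log_concave_marginal:
  fixes f :: "'a::real_vector \<times> real \<Rightarrow> real"
  assumes f: "log_concave f" and meas: "\<And>p. (\<lambda>u. f (p, u)) \<in> borel_measurable borel"
    and le: "\<And>z. f z \<le> K" and fin: "\<And>p. (\<integral>\<^sup>+u. ennreal (f (p, u)) \<partial>lborel) < \<infinity>"
  shows "log_concave (\<lambda>p. enn2real (\<integral>\<^sup>+u. ennreal (f (p, u)) \<partial>lborel))"
  unfolding log_concave_def
proof (intro conjI allI impI)
  fix p q and t :: real assume t: "0 < t \<and> t < 1"
  have line: "log_concave (\<lambda>u. f (r, u))" for r
    unfolding log_concave_def
  proof (intro conjI allI impI)
    fix u v s :: real assume "0 < s \<and> s < 1"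
    then have "f (r, u) powr (1 - s) * f (r, v) powr s \<le> f ((1 - s) *\<^sub>R (r, u) + s *\<^sub>R (r, v))"
      by (intro log_concaveD f) auto
    also have "(1 - s) *\<^sub>R (r, u) + s *\<^sub>R (r, v) = (r, (1 - s) *\<^sub>R u + s *\<^sub>R v)"
      by (simp flip: scaleR_add_left)
    finally show "f (r, u) powr (1 - s) * f (r, v) powr s \<le> f (r, (1 - s) *\<^sub>R u + s *\<^sub>R v)" .
  qed (simp add: log_concave_nonneg f)
  show "enn2real (\<integral>\<^sup>+u. ennreal (f (p, u)) \<partial>lborel) powr (1 - t) *
      enn2real (\<integral>\<^sup>+u. ennreal (f (q, u)) \<partial>lborel) powr t
     \<le> enn2real (\<integral>\<^sup>+u. ennreal (f ((1 - t) *\<^sub>R p + t *\<^sub>R q, u)) \<partial>lborel)"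
  proof (rule prekopa_leindler_real[of "\<lambda>u. f (p, u)" K "\<lambda>u. f (q, u)"
        "\<lambda>u. f ((1 - t) *\<^sub>R p + t *\<^sub>R q, u)" t])
    fix u v
    show "f (p, u) powr (1 - t) * f (q, v) powr t \<le> f ((1 - t) *\<^sub>R p + t *\<^sub>R q, (1 - t) * u + t * v)"
      using log_concaveD[OF f, of t "(p, u)" "(q, v)"] t by simp
  qed (use t fin in \<open>auto simp: line meas le\<close>)
qed simp

section \<open>Even log-concave densities\<close>

lemma log_concave_even_le_0:
  assumes f: "log_concave f" and even: "\<And>p. f (- p) = f p"
  shows "f p \<le> f 0"
proof -
  have "f p = f p powr (1 - 1/2) * f (- p) powr (1/2)"
    using f by (simp add: even log_concave_nonneg flip: powr_add)
  also have "\<dots> \<le> f ((1 - 1/2) *\<^sub>R p + (1/2) *\<^sub>R (- p))"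
    by (rule log_concaveD[OF f]) auto
  also have "(1 - 1/2) *\<^sub>R p + (1/2) *\<^sub>R (- p) = 0" by simp
  finally show ?thesis .
qed

lemma log_concave_even_antimono_ray:
  assumes f: "log_concave f" and even: "\<And>p. f (- p) = f p" and "0 \<le> s" "s \<le> 1"
  shows "f p \<le> f (s *\<^sub>R p)"
proof (cases "0 < s \<and> s < 1")
  case True
  have "f p = f p powr (1 - s) * f p powr s"
    using f by (simp add: log_concave_nonneg flip: powr_add)
  also have "\<dots> \<le> f 0 powr (1 - s) * f p powr s"
    using True log_concave_even_le_0[OF f even] log_concave_nonneg[OF f]
    by (intro mult_right_mono powr_mono2) auto
  also have "\<dots> \<le> f (s *\<^sub>R p)" using log_concaveD[OF f, of s 0 p] True by simp
  finally show ?thesis .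
next
  case False
  then have "s = 0 \<or> s = 1" using assms by linarith
  then show ?thesis using log_concave_even_le_0[OF f even] by auto
qed

text \<open>
  Let \<open>f z = f 0 * exp (-l)\<close>. If \<open>l \<ge> 1\<close>, then log-concavity on the segment from \<open>0\<close> to \<open>z\<close> puts \<open>z / l\<close> into
  the core \<open>{f \<ge> f 0 / e}\<close>, so \<open>\<bar>T z\<bar> \<le> r * l\<close>. The point \<open>z / 2\<close> has \<open>f (z / 2) \<ge> f 0 * exp (-l / 2)\<close>, and the
  gain \<open>exp (l / 2)\<close> over \<open>f z\<close> absorbs \<open>l\<^sup>2\<close>. After integration in \<open>z\<close>, the width of the core in the
  direction \<open>T\<close> bounds the second moment of \<open>T\<close>.
\<close>

lemma log_concave_even_tail:
  fixes f :: "'a::real_vector \<Rightarrow> real" and T :: "'a \<Rightarrow> real"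
  assumes f: "log_concave f" and even: "\<And>p. f (- p) = f p" and T: "linear T" and "0 \<le> r"
    and core: "\<And>z. f 0 / exp 1 \<le> f z \<Longrightarrow> \<bar>T z\<bar> \<le> r"
  shows "(T z)\<^sup>2 * f z \<le> 16 * r\<^sup>2 * f ((1/2) *\<^sub>R z)"
proof (cases "f z = 0")
  case True
  then show ?thesis using log_concave_nonneg[OF f] by simp
next
  case False
  define M where "M = f 0"
  have fz: "0 < f z" "f z \<le> M" using False log_concave_nonneg[OF f, of z] log_concave_even_le_0[OF f even]
    by (auto simp: M_def)
  then have M: "0 < M" by simp
  define l where "l = ln (M / f z)"
  have l: "0 \<le> l" "f z = M * exp (- l)" using fz M by (auto simp: l_def exp_minus)
  have half: "M * exp (- l / 2) \<le> f ((1/2) *\<^sub>R z)"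
  proof -
    have "M powr (1 - 1/2) * f z powr (1/2) \<le> f ((1/2) *\<^sub>R z)"
      using log_concaveD[OF f, of "1/2" 0 z] by (simp add: M_def)
    also have "M powr (1 - 1/2) * f z powr (1/2) = M powr (1 - 1/2 + 1/2) * exp (- l / 2)"
      using M by (simp only: l(2) powr_add) (simp add: powr_mult powr_def[of "exp _"])
    finally show ?thesis using M by simp
  qed
  have T_le: "\<bar>T z\<bar> \<le> r * max 1 l"
  proof (cases "l \<le> 1")
    case True
    then have "M * exp (- 1) \<le> M * exp (- l)" using M by simp
    then have "f 0 / exp 1 \<le> f z" unfolding l(2) M_def[symmetric] by (simp add: exp_minus field_simps)
    from core[OF this] True show ?thesis by simp
  next
    case False
    define s where "s = 1 / l"
    have s: "0 < s" "s < 1" "s * l = 1" using False by (auto simp: s_def)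
    have "M powr (1 - s) * f z powr s \<le> f (s *\<^sub>R z)"
      using log_concaveD[OF f, of s 0 z] s by (simp add: M_def)
    also have "M powr (1 - s) * f z powr s = M powr (1 - s + s) * exp (- (s * l))"
      using M by (simp only: l(2) powr_add) (simp add: powr_mult powr_def[of "exp _"])
    also have "\<dots> = f 0 / exp 1" using M s by (simp add: M_def exp_minus field_simps)
    finally have "\<bar>T (s *\<^sub>R z)\<bar> \<le> r" by (rule core)
    then have "s * \<bar>T z\<bar> \<le> r" using s by (simp add: linear_cmul[OF T] abs_mult)
    then have "l * (s * \<bar>T z\<bar>) \<le> l * r" using False by (intro mult_left_mono) auto
    then have "\<bar>T z\<bar> \<le> l * r" using s by (simp add: mult.assoc[symmetric] mult.commute[of l s])
    then show ?thesis using False by (simp add: mult.commute)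
  qed
  have max_le: "(max 1 l)\<^sup>2 \<le> 16 * exp (l / 2)"
  proof -
    have "max 1 l \<le> 4 * exp (l / 4)" using exp_ge_add_one_self[of "l / 4"] l(1)
      by (intro max.boundedI) linarith+
    then have "(max 1 l)\<^sup>2 \<le> (4 * exp (l / 4))\<^sup>2" by (intro power_mono) auto
    also have "\<dots> = 16 * exp (l / 2)"
      by (simp add: power_mult_distrib power2_eq_square flip: exp_add)
    finally show ?thesis .
  qed
  have "(T z)\<^sup>2 \<le> (r * max 1 l)\<^sup>2" using T_le by (metis abs_ge_zero power2_abs power_mono)
  also have "\<dots> = r\<^sup>2 * (max 1 l)\<^sup>2" by (simp add: power_mult_distrib)
  also have "\<dots> \<le> r\<^sup>2 * (16 * exp (l / 2))" by (intro mult_left_mono max_le) auto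
  finally have "(T z)\<^sup>2 * f z \<le> r\<^sup>2 * (16 * exp (l / 2)) * f z"
    using fz by (intro mult_right_mono) auto
  also have "\<dots> = 16 * r\<^sup>2 * (M * (exp (l / 2) * exp (- l)))" by (simp add: l(2))
  also have "exp (l / 2) * exp (- l) = exp (- l / 2)" by (simp flip: exp_add)
  also have "16 * r\<^sup>2 * (M * exp (- l / 2)) \<le> 16 * r\<^sup>2 * f ((1/2) *\<^sub>R z)"
    by (intro mult_left_mono half) auto
  finally show ?thesis .
qed

lemma nn_integral_half:
  fixes F :: "real \<Rightarrow> ennreal"
  assumes [measurable]: "F \<in> borel_measurable borel"
  shows "(\<integral>\<^sup>+x. F (x / 2) \<partial>lborel) = 2 * (\<integral>\<^sup>+x. F x \<partial>lborel)"
  using nn_integral_real_affine[of "\<lambda>x. F (x / 2)" 2 0] by simp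

text \<open>
  Between \<open>-z\<close> and \<open>z\<close> the function is at least \<open>c\<close>, and its integral bounds the length of this
  interval.
\<close>

lemma log_concave_even_core_le:
  fixes f :: "real \<Rightarrow> real"
  assumes f: "log_concave f" and even: "\<And>p. f (- p) = f p" and [measurable]: "f \<in> borel_measurable borel"
    and int: "(\<integral>\<^sup>+x. ennreal (f x) \<partial>lborel) \<le> ennreal A" and "0 \<le> A" and "0 < c" and z: "c \<le> f z"
  shows "\<bar>z\<bar> \<le> A / (2 * c)"
proof -
  have ge: "c \<le> f x" if "x \<in> {-\<bar>z\<bar>..\<bar>z\<bar>}" for x
  proof (cases "z = 0")
    case True then show ?thesis using that z by auto
  next
    case False
    have "f z \<le> f ((\<bar>x\<bar> / \<bar>z\<bar>) *\<^sub>R z)"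
      using that False by (intro log_concave_even_antimono_ray f even) (auto simp: field_simps)
    moreover have "(\<bar>x\<bar> / \<bar>z\<bar>) *\<^sub>R z = x \<or> (\<bar>x\<bar> / \<bar>z\<bar>) *\<^sub>R z = - x" using False
      by (cases "0 \<le> x"; cases "0 \<le> z") (auto simp: field_simps)
    ultimately show ?thesis using z even[of x] by auto
  qed
  have "ennreal (c * (2 * \<bar>z\<bar>)) = (\<integral>\<^sup>+x. ennreal c * indicator {-\<bar>z\<bar>..\<bar>z\<bar>} x \<partial>lborel)"
    using \<open>0 < c\<close> by (simp add: nn_integral_cmult_indicator ennreal_mult)
  also have "\<dots> \<le> (\<integral>\<^sup>+x. ennreal (f x) \<partial>lborel)"
    using ge by (intro nn_integral_mono) (auto simp: indicator_def intro!: ennreal_leI)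
  also note int
  finally have "c * (2 * \<bar>z\<bar>) \<le> A" using \<open>0 \<le> A\<close> by simp
  then show ?thesis using \<open>0 < c\<close> by (simp add: field_simps)
qed

text \<open>
  A high peak makes the core \<open>{f \<ge> f 0 / e}\<close> narrow, namely of half-width at most \<open>e / (2 * f 0)\<close>, and
  hence the variance small. Read in the other direction, a lower bound for the variance bounds the
  density at its maximum.
\<close>

lemma log_concave_even_peak_1d:
  fixes f :: "real \<Rightarrow> real"
  assumes f: "log_concave f" and even: "\<And>p. f (- p) = f p" and [measurable]: "f \<in> borel_measurable borel"
    and int: "(\<integral>\<^sup>+x. ennreal (f x) \<partial>lborel) = 1"
  shows "0 < f 0" and "(\<integral>\<^sup>+x. ennreal (x\<^sup>2) * ennreal (f x) \<partial>lborel) \<le> ennreal (72 / (f 0)\<^sup>2)"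
proof -
  show pos: "0 < f 0"
  proof (rule ccontr)
    assume "\<not> 0 < f 0"
    then have "f x = 0" for x using log_concave_even_le_0[OF f even, of x] log_concave_nonneg[OF f, of x] by simp
    then show False using int by simp
  qed
  define r where "r = 3 / (2 * f 0)"
  have core: "\<bar>z\<bar> \<le> r" if "f 0 / exp 1 \<le> f z" for z
  proof -
    have "\<bar>z\<bar> \<le> 1 / (2 * (f 0 / exp 1))"
      using that pos int by (intro log_concave_even_core_le[OF f even]) auto
    also have "\<dots> \<le> r" using pos exp_le by (simp add: r_def field_simps)
    finally show ?thesis .
  qed
  have tail: "z\<^sup>2 * f z \<le> 16 * r\<^sup>2 * f (z / 2)" for z
    using log_concave_even_tail[OF f even, of "\<lambda>z. z" r z] core pos by (auto simp: r_def linear_id[unfolded id_def])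
  have "(\<integral>\<^sup>+x. ennreal (x\<^sup>2) * ennreal (f x) \<partial>lborel) \<le> (\<integral>\<^sup>+x. ennreal (16 * r\<^sup>2) * ennreal (f (x / 2)) \<partial>lborel)"
    using tail log_concave_nonneg[OF f] by (intro nn_integral_mono) (auto simp flip: ennreal_mult intro!: ennreal_leI)
  also have "\<dots> = ennreal (16 * r\<^sup>2) * (2 * 1)"
    unfolding int[symmetric] by (subst nn_integral_half[symmetric]) (auto simp: nn_integral_cmult)
  also have "\<dots> = ennreal (72 / (f 0)\<^sup>2)"
    using pos by (simp add: r_def power_divide power_mult_distrib flip: ennreal_mult ennreal_numeral)
  finally show "(\<integral>\<^sup>+x. ennreal (x\<^sup>2) * ennreal (f x) \<partial>lborel) \<le> ennreal (72 / (f 0)\<^sup>2)" .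
qed

text \<open>
  The mass \<open>A\<close> of the slice bounds the points where the core \<open>{f \<ge> f 0 / e}\<close> meets the first axis by
  some \<open>\<rho>\<close> of order \<open>A / f 0\<close>. A line through \<open>(\<rho>, 0)\<close> that supports the core yields a functional
  \<open>x + \<beta> * y\<close> which is at most \<open>\<rho>\<close> on the core, and so its second moment is of order \<open>\<rho>\<^sup>2\<close>. The slope
  \<open>\<beta>\<close> of this line is unknown, which is why the variance has to be bounded below for all \<open>\<beta>\<close>.
\<close>

lemma log_concave_even_peak_2d:
  fixes f :: "real \<times> real \<Rightarrow> real"
  assumes f: "log_concave f" and even: "\<And>p. f (- p) = f p"
    and [measurable]: "f \<in> borel_measurable (borel \<Otimes>\<^sub>M borel)"
    and int: "(\<integral>\<^sup>+x. \<integral>\<^sup>+y. ennreal (f (x, y)) \<partial>lborel \<partial>lborel) = 1"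
    and slice: "(\<integral>\<^sup>+x. ennreal (f (x, 0)) \<partial>lborel) \<le> ennreal A" "0 < A"
    and var: "\<And>\<beta>. ennreal v \<le> (\<integral>\<^sup>+x. \<integral>\<^sup>+y. ennreal ((x + \<beta> * y)\<^sup>2) * ennreal (f (x, y)) \<partial>lborel \<partial>lborel)"
    and "0 \<le> v"
  shows "(f 0)\<^sup>2 * v \<le> 144 * A\<^sup>2"
proof (cases "f 0 = 0")
  case False
  then have pos: "0 < f 0" using log_concave_nonneg[OF f, of 0] by simp
  define \<rho> where "\<rho> = 3 * A / (2 * f 0)"
  have \<rho>: "0 < \<rho>" using pos slice by (simp add: \<rho>_def)
  define K where "K = {z. f 0 / exp 1 \<le> f z}"
  have K_sym: "- z \<in> K \<longleftrightarrow> z \<in> K" for z by (simp add: K_def even)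
  have K0: "0 \<in> K" using pos by (simp add: K_def field_simps)
  have "convex K"
  proof -
    have "K = (\<Inter>c\<in>{0..<f 0 / exp 1}. {z. c < f z})"
    proof (intro set_eqI iffI)
      fix z assume z: "z \<in> (\<Inter>c\<in>{0..<f 0 / exp 1}. {z. c < f z})"
      show "z \<in> K"
      proof (rule ccontr)
        assume "z \<notin> K"
        then have "f z \<in> {0..<f 0 / exp 1}" using log_concave_nonneg[OF f] by (auto simp: K_def)
        with z show False by auto
      qed
    qed (auto simp: K_def)
    then show ?thesis using f by (auto intro!: convex_INT log_concave_convex_superlevel)
  qed
  have core_x: "\<bar>x\<bar> < \<rho>" if "(x, 0) \<in> K" for x
  proof -
    have lc: "log_concave (\<lambda>x. f (x, 0))"
      by (rule log_concave_linear[OF f]) (auto intro!: linearI)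
    have "\<bar>x\<bar> \<le> A / (2 * (f 0 / exp 1))"
      using that pos slice even[of "(_, 0)"] by (intro log_concave_even_core_le[OF lc]) (auto simp: K_def)
    also have "\<dots> < \<rho>"
    proof -
      have "exp (1::real) < 3" using exp_less_cancel_iff e_less_272 by linarith
      then show ?thesis using pos slice by (simp add: \<rho>_def field_simps)
    qed
    finally show ?thesis .
  qed
  then have "(\<rho>, 0) \<notin> K" using \<rho> by force
  then have "\<exists>a b. a \<noteq> 0 \<and> (\<forall>z\<in>K. inner a z \<le> b) \<and> (\<forall>z\<in>{(\<rho>, 0)}. b \<le> inner a z)"
    using K0 by (intro separating_hyperplane_sets \<open>convex K\<close>) auto
  then obtain a b where a: "a \<noteq> 0" "\<And>z. z \<in> K \<Longrightarrow> inner a z \<le> b" "b \<le> inner a (\<rho>, 0)"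
    by blast
  have "0 \<le> b" using a(2)[OF K0] by simp
  have lin: "linear (\<lambda>z::real \<times> real. fst z + \<beta> * snd z)" for \<beta>
    by (auto intro!: linearI simp: algebra_simps)
  \<comment> \<open>If the supporting line were the first axis, the core would be contained in this axis, and the tail
    estimate with core width 0 would make f vanish off the axis.\<close>
  have "fst a > 0"
  proof (rule ccontr)
    assume "\<not> 0 < fst a"
    moreover have "0 \<le> fst a" using order_trans[OF \<open>0 \<le> b\<close> a(3)] \<rho> by (simp add: inner_prod_def zero_le_mult_iff)
    ultimately have a1: "fst a = 0" by simp
    then have a2: "snd a \<noteq> 0" using a(1) by (auto simp: prod_eq_iff)
    have snd0: "snd z = 0" if "z \<in> K" for z
    proof -
      have "inner a z \<le> 0" "inner a (- z) \<le> 0" using a that K_sym[of z] a1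
        by (fastforce simp: inner_prod_def)+
      then show ?thesis using a1 a2 by (simp add: inner_prod_def)
    qed
    have zero: "f (x, y) = 0" if "y \<noteq> 0" for x y
    proof -
      have "y\<^sup>2 * f (x, y) \<le> 16 * 0\<^sup>2 * f ((1/2) *\<^sub>R (x, y))"
        using log_concave_even_tail[OF f even, of snd 0 "(x, y)"] snd0 linear_snd by (auto simp: K_def)
      then have "y\<^sup>2 * f (x, y) \<le> 0" by simp
      then show ?thesis using that log_concave_nonneg[OF f, of "(x, y)"]
        by (simp add: mult_le_0_iff)
    qed
    have "(\<integral>\<^sup>+y. ennreal (f (x, y)) \<partial>lborel) = (\<integral>\<^sup>+(y::real). 0 \<partial>lborel)" for x
    proof (rule nn_integral_cong_AE)
      show "AE y in lborel. ennreal (f (x, y)) = 0"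
        using AE_lborel_singleton[of 0] by eventually_elim (simp add: zero)
    qed
    then show False using int by simp
  qed
  define \<beta> where "\<beta> = snd a / fst a"
  have half: "fst z + \<beta> * snd z \<le> \<rho>" if "z \<in> K" for z
  proof -
    have "inner a z \<le> fst a * \<rho>" using a(2)[OF that] a(3) by (simp add: inner_prod_def)
    moreover have "(fst z + \<beta> * snd z) * fst a = inner a z"
    proof -
      have "\<beta> * fst a = snd a" using \<open>fst a > 0\<close> by (simp add: \<beta>_def)
      then have "fst a * fst z + (\<beta> * fst a) * snd z = inner a z" by (simp add: inner_prod_def)
      then show ?thesis by (simp add: algebra_simps)
    qed
    ultimately have "(fst z + \<beta> * snd z) * fst a \<le> \<rho> * fst a"
      by (simp add: mult.commute)
    then show ?thesis using \<open>fst a > 0\<close> by simp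
  qed
  have "\<bar>fst z + \<beta> * snd z\<bar> \<le> \<rho>" if "z \<in> K" for z
    using half[OF that] half[of "- z"] that by (simp add: K_sym abs_le_iff)
  then have tail: "(x + \<beta> * y)\<^sup>2 * f (x, y) \<le> 16 * \<rho>\<^sup>2 * f (x / 2, y / 2)" for x y
    using log_concave_even_tail[OF f even lin, of \<rho> \<beta> "(x, y)"] \<rho> by (auto simp: K_def)
  have "ennreal v \<le> (\<integral>\<^sup>+x. \<integral>\<^sup>+y. ennreal ((x + \<beta> * y)\<^sup>2) * ennreal (f (x, y)) \<partial>lborel \<partial>lborel)"
    by (rule var)
  also have "\<dots> \<le> (\<integral>\<^sup>+x. \<integral>\<^sup>+y. ennreal (16 * \<rho>\<^sup>2) * ennreal (f (x / 2, y / 2)) \<partial>lborel \<partial>lborel)"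
    using tail log_concave_nonneg[OF f] by (intro nn_integral_mono) (auto simp flip: ennreal_mult intro!: ennreal_leI)
  also have "\<dots> = (\<integral>\<^sup>+x. ennreal (16 * \<rho>\<^sup>2) * (2 * (\<integral>\<^sup>+y. ennreal (f (x / 2, y)) \<partial>lborel)) \<partial>lborel)"
    by (intro nn_integral_cong, subst nn_integral_half[symmetric]) (auto simp: nn_integral_cmult)
  also have "\<dots> = ennreal (16 * \<rho>\<^sup>2) * (2 * (2 * 1))"
    unfolding int[symmetric] by (subst nn_integral_half[symmetric]) (auto simp: nn_integral_cmult)
  also have "\<dots> = ennreal (64 * \<rho>\<^sup>2)"
    by (simp flip: ennreal_mult ennreal_numeral)
  finally have "v \<le> 64 * \<rho>\<^sup>2" by simp
  also have "\<dots> = 144 * A\<^sup>2 / (f 0)\<^sup>2" by (simp add: \<rho>_def power_divide power_mult_distrib)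
  finally show ?thesis using pos by (simp add: field_simps)
qed simp

section \<open>Transfer operators of the pinned field\<close>

lemma nn_integral_site_measure:
  assumes f: "f \<in> borel_measurable borel"
  shows "(\<integral>\<^sup>+x. f x \<partial>site_measure \<epsilon>) = (\<integral>\<^sup>+x. f x \<partial>lborel) + ennreal \<epsilon> * f 0"
  using f
proof (induction rule: borel_measurable_induct)
  case (set A)
  then show ?case by (simp add: emeasure_site_measure add.commute)
next
  case (seq U)
  have mono: "incseq (\<lambda>i. ennreal \<epsilon> * U i 0)"
    using seq by (intro monoI mult_left_mono) (auto simp: mono_def le_fun_def)
  have mono': "incseq (\<lambda>i. \<integral>\<^sup>+x. U i x \<partial>lborel)"
    using seq by (intro monoI nn_integral_mono) (auto simp: mono_def le_fun_def)
  have "(\<integral>\<^sup>+x. (\<Squnion>i. U i x) \<partial>site_measure \<epsilon>) = (\<Squnion>i. \<integral>\<^sup>+x. U i x \<partial>site_measure \<epsilon>)"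
    using seq by (intro nn_integral_monotone_convergence_SUP) (auto cong: measurable_cong_sets)
  also have "\<dots> = (\<Squnion>i. \<integral>\<^sup>+x. U i x \<partial>lborel) + (\<Squnion>i. ennreal \<epsilon> * U i 0)"
    using seq by (simp add: ennreal_SUP_add mono mono')
  also have "\<dots> = (\<integral>\<^sup>+x. (\<Squnion>i. U i x) \<partial>lborel) + ennreal \<epsilon> * (\<Squnion>i. U i 0)"
    using seq by (simp add: nn_integral_monotone_convergence_SUP SUP_mult_left_ennreal)
  finally show ?case by (simp add: image_comp)
next
  case (add u v)
  then show ?case by (simp add: nn_integral_add algebra_simps cong: measurable_cong_sets)
next
  case (mult u c)
  then show ?case by (simp add: nn_integral_cmult algebra_simps cong: measurable_cong_sets)
qed (auto cong: nn_integral_cong)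

lemma sigma_finite_site_measure: "sigma_finite_measure (site_measure \<epsilon>)"
proof
  let ?A = "range (\<lambda>n::nat. {- real n..real n})"
  have "\<Union>?A = UNIV"
  proof -
    have "\<exists>n::nat. x \<in> {- real n..real n}" for x :: real
      using real_arch_simple[of "\<bar>x\<bar>"] by (auto simp: abs_le_iff minus_le_iff)
    then show ?thesis by blast
  qed
  then show "\<exists>A. countable A \<and> A \<subseteq> sets (site_measure \<epsilon>) \<and> \<Union>A = space (site_measure \<epsilon>) \<and>
      (\<forall>a\<in>A. emeasure (site_measure \<epsilon>) a \<noteq> \<infinity>)"
    by (intro exI[of _ ?A]) (auto simp: emeasure_site_measure ennreal_mult_eq_top_iff indicator_def)
qed

text \<open>
  The density \<open>g\<close> stands for \<open>exp (-V)\<close>: without pinning, the second differences of the field are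
  independent with density \<open>g\<close>.
\<close>

locale increment_density =
  fixes g :: "real \<Rightarrow> real"
  assumes g_measurable [measurable]: "g \<in> borel_measurable borel"
    and g_log_concave: "log_concave g"
    and g_even: "g (- x) = g x"
    and g_integral: "(\<integral>\<^sup>+x. ennreal (g x) \<partial>lborel) = 1"
begin

lemma g_nonneg: "0 \<le> g x" by (rule log_concave_nonneg[OF g_log_concave])
lemma g_le: "g x \<le> g 0" by (rule log_concave_even_le_0[OF g_log_concave g_even])
lemma g_0_pos: "0 < g 0" by (rule log_concave_even_peak_1d[OF g_log_concave g_even g_measurable g_integral])

lemma g_integral_shift: "(\<integral>\<^sup>+x. ennreal (g (x + c)) \<partial>lborel) = 1"
  using nn_integral_real_affine[of "\<lambda>x. ennreal (g x)" 1 c] g_integral by (simp add: add.commute)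

text \<open>
  The arguments \<open>x\<close> and \<open>y\<close> are consecutive heights and \<open>z\<close> is the next one, so that \<open>z + x - 2 * y\<close> is the
  second difference at \<open>y\<close>. The atom of \<open>site_measure \<epsilon>\<close> accounts for a contact at the next site.
\<close>

definition step :: "real \<Rightarrow> (real \<times> real \<Rightarrow> ennreal) \<Rightarrow> real \<times> real \<Rightarrow> ennreal" where
  "step \<epsilon> F = (\<lambda>(x, y). \<integral>\<^sup>+z. ennreal (g (z + x - 2 * y)) * F (y, z) \<partial>site_measure \<epsilon>)"

text \<open>
  The contribution of a contact at the site after \<open>y\<close>, where \<open>f\<close> weighs the height \<open>y\<close> from which the
  contact is reached, that is, minus the slope.
\<close>

definition pin :: "(real \<Rightarrow> ennreal) \<Rightarrow> real \<times> real \<Rightarrow> ennreal" where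
  "pin f = (\<lambda>(x, y). ennreal (g (x - 2 * y)) * f y)"

abbreviation pair_measurable :: "(real \<times> real \<Rightarrow> ennreal) \<Rightarrow> bool" where
  "pair_measurable F \<equiv> F \<in> borel_measurable (borel \<Otimes>\<^sub>M borel)"

lemma pin_measurable [measurable]:
  assumes [measurable]: "f \<in> borel_measurable borel"
  shows "pair_measurable (pin f)"
  unfolding pin_def by measurable

lemma step_measurable [measurable]:
  assumes [measurable]: "pair_measurable F"
  shows "pair_measurable (step \<epsilon> F)"
proof -
  interpret sigma_finite_measure "site_measure \<epsilon>" by (rule sigma_finite_site_measure)
  show ?thesis unfolding step_def by measurable
qed

lemma funpow_step_measurable [measurable]:
  "pair_measurable F \<Longrightarrow> pair_measurable ((step \<epsilon> ^^ n) F)"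
  by (induction n) auto

lemma step_eq:
  assumes [measurable]: "pair_measurable F"
  shows "step \<epsilon> F (x, y) = (\<integral>\<^sup>+z. ennreal (g (z + x - 2 * y)) * F (y, z) \<partial>lborel)
    + ennreal \<epsilon> * (ennreal (g (x - 2 * y)) * F (y, 0))"
  unfolding step_def by (simp add: nn_integral_site_measure)

lemma step_split:
  assumes [measurable]: "pair_measurable F" and "0 \<le> \<epsilon>" "\<epsilon> \<le> \<epsilon>'"
  shows "step \<epsilon>' F p = step \<epsilon> F p + ennreal (\<epsilon>' - \<epsilon>) * pin (\<lambda>y. F (y, 0)) p"
proof -
  obtain x y where p: "p = (x, y)" by (cases p)
  have "ennreal \<epsilon>' = ennreal \<epsilon> + ennreal (\<epsilon>' - \<epsilon>)" using assms by (simp flip: ennreal_plus)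
  then have "ennreal \<epsilon>' * (ennreal (g (x - 2 * y)) * F (y, 0)) =
      ennreal \<epsilon> * (ennreal (g (x - 2 * y)) * F (y, 0)) + ennreal (\<epsilon>' - \<epsilon>) * pin (\<lambda>y. F (y, 0)) p"
    by (simp only: distrib_right pin_def p prod.case)
  then show ?thesis by (simp add: p step_eq add.assoc)
qed

lemma step_add:
  assumes [measurable]: "pair_measurable F" "pair_measurable H"
  shows "step \<epsilon> (\<lambda>p. F p + H p) p = step \<epsilon> F p + step \<epsilon> H p"
  by (cases p) (simp add: step_def nn_integral_add distrib_left)

lemma step_cmult:
  assumes [measurable]: "pair_measurable F"
  shows "step \<epsilon> (\<lambda>p. c * F p) p = c * step \<epsilon> F p"
  by (cases p) (simp add: step_def nn_integral_cmult mult.left_commute)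

lemma step_mono: "(\<And>p. F p \<le> H p) \<Longrightarrow> step \<epsilon> F p \<le> step \<epsilon> H p"
  by (cases p) (auto simp: step_def intro!: nn_integral_mono mult_left_mono)

lemma step_sum:
  assumes "finite I" "\<And>i. i \<in> I \<Longrightarrow> pair_measurable (F i)"
  shows "step \<epsilon> (\<lambda>p. \<Sum>i\<in>I. F i p) p = (\<Sum>i\<in>I. step \<epsilon> (F i) p)"
  using assms
proof (induction)
  case empty
  then show ?case by (cases p) (simp add: step_def)
next
  case (insert i I)
  then show ?case by (simp add: step_add borel_measurable_sum)
qed

lemma funpow_step_add:
  assumes "pair_measurable F" "pair_measurable H"
  shows "(step \<epsilon> ^^ n) (\<lambda>p. F p + H p) p = (step \<epsilon> ^^ n) F p + (step \<epsilon> ^^ n) H p"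
proof (induction n arbitrary: p)
  case (Suc n)
  have "(step \<epsilon> ^^ n) (\<lambda>p. F p + H p) = (\<lambda>p. (step \<epsilon> ^^ n) F p + (step \<epsilon> ^^ n) H p)"
    using Suc by blast
  then show ?case using assms by (simp add: step_add)
qed simp

lemma funpow_step_sum:
  assumes "finite I" "\<And>i. i \<in> I \<Longrightarrow> pair_measurable (F i)"
  shows "(step \<epsilon> ^^ n) (\<lambda>p. \<Sum>i\<in>I. F i p) p = (\<Sum>i\<in>I. (step \<epsilon> ^^ n) (F i) p)"
proof (induction n arbitrary: p)
  case (Suc n)
  have "(step \<epsilon> ^^ n) (\<lambda>p. \<Sum>i\<in>I. F i p) = (\<lambda>p. \<Sum>i\<in>I. (step \<epsilon> ^^ n) (F i) p)"
    using Suc by blast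
  then show ?case using assms by (simp add: step_sum)
qed simp

lemma funpow_step_cmult:
  assumes "pair_measurable F"
  shows "(step \<epsilon> ^^ n) (\<lambda>p. c * F p) p = c * (step \<epsilon> ^^ n) F p"
proof (induction n arbitrary: p)
  case (Suc n)
  have "(step \<epsilon> ^^ n) (\<lambda>p. c * F p) = (\<lambda>p. c * (step \<epsilon> ^^ n) F p)"
    using Suc by blast
  then show ?case using assms by (simp add: step_cmult)
qed simp

lemma funpow_step_mono:
  "(\<And>p. F p \<le> H p) \<Longrightarrow> (step \<epsilon> ^^ n) F p \<le> (step \<epsilon> ^^ n) H p"
  by (induction n arbitrary: p) (auto intro: step_mono)

lemma step_mono_pinning:
  assumes "pair_measurable F" "0 \<le> \<epsilon>" "\<epsilon> \<le> \<epsilon>'"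
  shows "step \<epsilon> F p \<le> step \<epsilon>' F p"
  using assms by (simp add: step_split[OF assms])

lemma funpow_step_mono_pinning:
  assumes "pair_measurable F" "0 \<le> \<epsilon>" "\<epsilon> \<le> \<epsilon>'"
  shows "(step \<epsilon> ^^ n) F p \<le> (step \<epsilon>' ^^ n) F p"
proof (induction n arbitrary: p)
  case (Suc n)
  have "(step \<epsilon> ^^ Suc n) F p \<le> step \<epsilon> ((step \<epsilon>' ^^ n) F) p"
    using Suc by (simp add: step_mono)
  also have "\<dots> \<le> (step \<epsilon>' ^^ Suc n) F p" using assms by (simp add: step_mono_pinning)
  finally show ?case .
qed simp

lemma pin_add: "pin (\<lambda>y. f y + h y) p = pin f p + pin h p"
  by (cases p) (simp add: pin_def distrib_left)

lemma pin_mono: "(\<And>y. f y \<le> h y) \<Longrightarrow> pin f p \<le> pin h p"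
  by (cases p) (auto simp: pin_def intro: mult_left_mono)

lemma pin_cmult: "pin (\<lambda>y. c * f y) p = c * pin f p"
  by (cases p) (simp add: pin_def mult.left_commute)

text \<open>
  Split the weight of every contact into \<open>\<epsilon>\<close> and \<open>\<epsilon>' - \<epsilon>\<close>, and decompose according to the first contact
  that takes the second part.
\<close>

lemma expand_first_pin:
  assumes F: "pair_measurable F" and \<epsilon>: "0 \<le> \<epsilon>" "\<epsilon> \<le> \<epsilon>'"
  shows "(step \<epsilon>' ^^ n) F p = (step \<epsilon> ^^ n) F p +
    (\<Sum>j<n. ennreal (\<epsilon>' - \<epsilon>) * (step \<epsilon> ^^ (n - 1 - j)) (pin (\<lambda>y. (step \<epsilon>' ^^ j) F (y, 0))) p)"
proof (induction n arbitrary: p)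
  case (Suc n)
  note [measurable] = F
  let ?\<theta> = "ennreal (\<epsilon>' - \<epsilon>)"
  let ?P = "\<lambda>j. pin (\<lambda>y. (step \<epsilon>' ^^ j) F (y, 0))"
  have IH: "(step \<epsilon>' ^^ n) F = (\<lambda>p. (step \<epsilon> ^^ n) F p + (\<Sum>j<n. ?\<theta> * (step \<epsilon> ^^ (n - 1 - j)) (?P j) p))"
    using Suc by blast
  have "(step \<epsilon>' ^^ Suc n) F p = step \<epsilon> ((step \<epsilon>' ^^ n) F) p + ?\<theta> * ?P n p"
    using \<epsilon> by (simp add: step_split[of _ \<epsilon> \<epsilon>'])
  also have "step \<epsilon> ((step \<epsilon>' ^^ n) F) p =
      (step \<epsilon> ^^ Suc n) F p + (\<Sum>j<n. ?\<theta> * (step \<epsilon> ^^ Suc (n - 1 - j)) (?P j) p)"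
    by (subst IH) (simp add: step_add step_sum step_cmult)
  also have "(\<Sum>j<n. ?\<theta> * (step \<epsilon> ^^ Suc (n - 1 - j)) (?P j) p) =
      (\<Sum>j<n. ?\<theta> * (step \<epsilon> ^^ (Suc n - 1 - j)) (?P j) p)"
  proof (intro sum.cong refl)
    fix j assume "j \<in> {..<n}"
    then have "Suc (n - 1 - j) = Suc n - 1 - j" by auto
    then show "?\<theta> * (step \<epsilon> ^^ Suc (n - 1 - j)) (?P j) p = ?\<theta> * (step \<epsilon> ^^ (Suc n - 1 - j)) (?P j) p"
      by simp
  qed
  finally show ?case by (simp only: sum.lessThan_Suc add.assoc diff_Suc_1 diff_self_eq_0 funpow_0)
qed simp

text \<open>
  The same splitting, decomposed according to the last contact that takes the second part. For
  \<open>\<epsilon> = 0\<close> this is the last contact.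
\<close>

lemma expand_last_pin:
  assumes F: "pair_measurable F" and \<epsilon>: "0 \<le> \<epsilon>" "\<epsilon> \<le> \<epsilon>'"
  shows "(step \<epsilon>' ^^ n) F p = (step \<epsilon> ^^ n) F p +
    (\<Sum>j<n. ennreal (\<epsilon>' - \<epsilon>) * (step \<epsilon>' ^^ (n - 1 - j)) (pin (\<lambda>y. (step \<epsilon> ^^ j) F (y, 0))) p)"
  using F
proof (induction n arbitrary: F)
  case (Suc n)
  note [measurable] = Suc.prems
  let ?\<theta> = "ennreal (\<epsilon>' - \<epsilon>)"
  let ?P = "\<lambda>j. pin (\<lambda>y. (step \<epsilon> ^^ j) F (y, 0))"
  have "step \<epsilon>' F = (\<lambda>p. step \<epsilon> F p + ?\<theta> * ?P 0 p)"
    using \<epsilon> by (auto simp: step_split[of _ \<epsilon> \<epsilon>'])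
  then have "(step \<epsilon>' ^^ Suc n) F p = (step \<epsilon>' ^^ n) (\<lambda>p. step \<epsilon> F p + ?\<theta> * ?P 0 p) p"
    by (simp only: funpow_Suc_right o_def)
  also have "\<dots> = (step \<epsilon>' ^^ n) (step \<epsilon> F) p + ?\<theta> * (step \<epsilon>' ^^ n) (?P 0) p"
  proof -
    have "pair_measurable (step \<epsilon> F)" "pair_measurable (?P 0)" "pair_measurable (\<lambda>p. ?\<theta> * ?P 0 p)"
      by measurable
    then show ?thesis by (simp only: funpow_step_add funpow_step_cmult)
  qed
  also have "(step \<epsilon>' ^^ n) (step \<epsilon> F) p = (step \<epsilon> ^^ Suc n) F p +
      (\<Sum>j<n. ?\<theta> * (step \<epsilon>' ^^ (n - 1 - j)) (?P (Suc j)) p)"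
    using Suc.IH[of "step \<epsilon> F"] by (simp only: funpow_Suc_right o_def) simp
  also have "\<dots> + ?\<theta> * (step \<epsilon>' ^^ n) (?P 0) p = (step \<epsilon> ^^ Suc n) F p +
      (?\<theta> * (step \<epsilon>' ^^ (Suc n - 1 - 0)) (?P 0) p + (\<Sum>j<n. ?\<theta> * (step \<epsilon>' ^^ (Suc n - 1 - Suc j)) (?P (Suc j)) p))"
    by (simp only: add_ac diff_Suc_1 diff_Suc_Suc diff_zero diff_Suc_eq_diff_pred)
  finally show ?case by (simp only: sum.lessThan_Suc_shift)
qed simp

text \<open>
  Adding an affine function to a path does not change its second differences.
\<close>

lemma step_translate:
  assumes [measurable]: "pair_measurable F"
  shows "step 0 F (z + x, w + y) = step 0 (\<lambda>(z, w). F (z + y, w + (2 * y - x))) (z, w)"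
proof -
  let ?k = "\<lambda>v. ennreal (g (v + (z + x) - 2 * (w + y))) * F (w + y, v)"
  have "step 0 F (z + x, w + y) = (\<integral>\<^sup>+v. ?k v \<partial>lborel)" by (simp add: step_eq)
  also have "\<dots> = (\<integral>\<^sup>+v. ?k ((2 * y - x) + 1 * v) \<partial>lborel)"
    by (subst nn_integral_real_affine[where c = 1 and t = "2 * y - x"]) auto
  also have "\<dots> = step 0 (\<lambda>(z, w). F (z + y, w + (2 * y - x))) (z, w)"
    by (simp add: step_eq algebra_simps)
  finally show ?thesis .
qed

text \<open>
  Here \<open>p\<close> and \<open>q\<close> are the last two values of the affine path that starts with \<open>x\<close> and \<open>y\<close>. They are
  the same for every \<open>F\<close>.
\<close>

lemma free_step_translate:
  "\<exists>p q. \<forall>F. pair_measurable F \<longrightarrow>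
     (\<forall>z w. (step 0 ^^ k) F (z + x, w + y) = (step 0 ^^ k) (\<lambda>(z, w). F (z + p, w + q)) (z, w))"
proof (induction k arbitrary: x y)
  case 0
  then show ?case by auto
next
  case (Suc k)
  obtain p q where pq: "\<And>F z w. pair_measurable F \<Longrightarrow>
    (step 0 ^^ k) F (z + y, w + (2 * y - x)) = (step 0 ^^ k) (\<lambda>(z, w). F (z + p, w + q)) (z, w)"
    using Suc[of y "2 * y - x"] by blast
  have "(step 0 ^^ Suc k) F (z + x, w + y) = (step 0 ^^ Suc k) (\<lambda>(z, w). F (z + p, w + q)) (z, w)"
    if F: "pair_measurable F" for F z w
  proof -
    have eq: "(\<lambda>(z, w). (step 0 ^^ k) F (z + y, w + (2 * y - x))) = (step 0 ^^ k) (\<lambda>(z, w). F (z + p, w + q))"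
      using pq[OF F] by auto
    have "(step 0 ^^ Suc k) F (z + x, w + y) = step 0 ((step 0 ^^ k) F) (z + x, w + y)" by simp
    also have "\<dots> = step 0 ((step 0 ^^ k) (\<lambda>(z, w). F (z + p, w + q))) (z, w)"
      using F by (subst step_translate) (simp_all add: eq)
    finally show ?thesis by simp
  qed
  then show ?case by blast
qed

text \<open>
  The weight of all continuations of a path with current heights \<open>(x, y)\<close> by \<open>k\<close> integrated heights
  and then the two boundary zeros. At \<open>(0, 0)\<close> this is the normalization of the field with \<open>k\<close> inner
  sites.
\<close>

definition weight_to_end :: "real \<Rightarrow> nat \<Rightarrow> real \<times> real \<Rightarrow> ennreal" where
  "weight_to_end \<epsilon> k = (step \<epsilon> ^^ k) (pin (\<lambda>y. ennreal (g y)))"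

lemma weight_to_end_measurable [measurable]: "pair_measurable (weight_to_end \<epsilon> k)"
  unfolding weight_to_end_def by measurable

lemma weight_to_end_Suc: "weight_to_end \<epsilon> (Suc k) = step \<epsilon> (weight_to_end \<epsilon> k)"
  by (simp add: weight_to_end_def)

text \<open>
  Second differences are invariant under time reversal, so the weight of the paths that lead from
  \<open>(0, 0)\<close> to \<open>(x, y)\<close> is the weight of continuing \<open>(y, x)\<close> to the two boundary zeros.
\<close>

lemma time_reversal:
  assumes "pair_measurable H"
  shows "(step \<epsilon> ^^ Suc (Suc k)) H (0, 0) =
    (\<integral>\<^sup>+x. \<integral>\<^sup>+y. H (x, y) * weight_to_end \<epsilon> k (y, x) \<partial>site_measure \<epsilon> \<partial>site_measure \<epsilon>)"
  using assms
proof (induction k arbitrary: H)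
  case 0
  note [measurable] = 0
  interpret sigma_finite_measure "site_measure \<epsilon>" by (rule sigma_finite_site_measure)
  have "(step \<epsilon> ^^ Suc (Suc 0)) H (0, 0) =
      (\<integral>\<^sup>+x. ennreal (g x) * (\<integral>\<^sup>+y. ennreal (g (y - 2 * x)) * H (x, y) \<partial>site_measure \<epsilon>) \<partial>site_measure \<epsilon>)"
    by (simp add: step_def)
  also have "\<dots> = (\<integral>\<^sup>+x. \<integral>\<^sup>+y. ennreal (g x) * (ennreal (g (y - 2 * x)) * H (x, y)) \<partial>site_measure \<epsilon> \<partial>site_measure \<epsilon>)"
    by (intro nn_integral_cong nn_integral_cmult[symmetric]) measurable
  also have "\<dots> = (\<integral>\<^sup>+x. \<integral>\<^sup>+y. H (x, y) * weight_to_end \<epsilon> 0 (y, x) \<partial>site_measure \<epsilon> \<partial>site_measure \<epsilon>)"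
    by (intro nn_integral_cong) (simp add: weight_to_end_def pin_def mult_ac)
  finally show ?case .
next
  case (Suc k)
  note [measurable] = Suc.prems
  interpret pair_sigma_finite "site_measure \<epsilon>" "site_measure \<epsilon>"
    by (intro pair_sigma_finite.intro sigma_finite_site_measure)
  let ?m = "site_measure \<epsilon>"
  let ?G = "\<lambda>x y z. ennreal (g (z + x - 2 * y)) * H (y, z) * weight_to_end \<epsilon> k (y, x)"
  have "(step \<epsilon> ^^ Suc (Suc (Suc k))) H (0, 0) = (step \<epsilon> ^^ Suc (Suc k)) (step \<epsilon> H) (0, 0)"
    by (simp only: funpow_Suc_right o_def)
  also have "\<dots> = (\<integral>\<^sup>+x. \<integral>\<^sup>+y. step \<epsilon> H (x, y) * weight_to_end \<epsilon> k (y, x) \<partial>?m \<partial>?m)"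
    by (rule Suc.IH) simp
  also have "\<dots> = (\<integral>\<^sup>+x. \<integral>\<^sup>+y. \<integral>\<^sup>+z. ?G x y z \<partial>?m \<partial>?m \<partial>?m)"
    unfolding step_def prod.case by (intro nn_integral_cong nn_integral_multc[symmetric]) measurable
  also have "\<dots> = (\<integral>\<^sup>+y. \<integral>\<^sup>+x. \<integral>\<^sup>+z. ?G x y z \<partial>?m \<partial>?m \<partial>?m)"
    by (rule Fubini') measurable
  also have "\<dots> = (\<integral>\<^sup>+y. \<integral>\<^sup>+z. \<integral>\<^sup>+x. ?G x y z \<partial>?m \<partial>?m \<partial>?m)"
    by (intro nn_integral_cong Fubini') measurable
  also have "\<dots> = (\<integral>\<^sup>+y. \<integral>\<^sup>+z. H (y, z) * weight_to_end \<epsilon> (Suc k) (z, y) \<partial>?m \<partial>?m)"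
  proof (intro nn_integral_cong)
    fix y z
    have "(\<integral>\<^sup>+x. ?G x y z \<partial>?m) = (\<integral>\<^sup>+x. H (y, z) * (ennreal (g (x + z - 2 * y)) * weight_to_end \<epsilon> k (y, x)) \<partial>?m)"
      by (intro nn_integral_cong) (simp add: mult_ac add.commute)
    also have "\<dots> = H (y, z) * (\<integral>\<^sup>+x. ennreal (g (x + z - 2 * y)) * weight_to_end \<epsilon> k (y, x) \<partial>?m)"
      by (rule nn_integral_cmult) measurable
    finally show "(\<integral>\<^sup>+x. ?G x y z \<partial>?m) = H (y, z) * weight_to_end \<epsilon> (Suc k) (z, y)"
      by (simp add: weight_to_end_Suc step_def)
  qed
  finally show ?case .
qed

lemma contact_time_reversal:
  assumes [measurable]: "f \<in> borel_measurable borel"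
  shows "(step \<epsilon> ^^ Suc k) (pin f) (0, 0) =
    (\<integral>\<^sup>+x. f x * weight_to_end \<epsilon> k (0, x) \<partial>site_measure \<epsilon>)"
proof (cases k)
  case 0
  then show ?thesis by (simp add: step_def pin_def weight_to_end_def g_even mult_ac)
next
  case (Suc j)
  interpret pair_sigma_finite "site_measure \<epsilon>" "site_measure \<epsilon>"
    by (intro pair_sigma_finite.intro sigma_finite_site_measure)
  let ?m = "site_measure \<epsilon>"
  have "(step \<epsilon> ^^ Suc k) (pin f) (0, 0) =
      (\<integral>\<^sup>+x. \<integral>\<^sup>+y. pin f (x, y) * weight_to_end \<epsilon> j (y, x) \<partial>?m \<partial>?m)"
    unfolding Suc by (rule time_reversal) simp
  also have "\<dots> = (\<integral>\<^sup>+y. \<integral>\<^sup>+x. pin f (x, y) * weight_to_end \<epsilon> j (y, x) \<partial>?m \<partial>?m)"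
    by (rule Fubini') measurable
  also have "\<dots> = (\<integral>\<^sup>+x. f x * weight_to_end \<epsilon> k (0, x) \<partial>?m)"
  proof (intro nn_integral_cong)
    fix y
    have "(\<integral>\<^sup>+x. pin f (x, y) * weight_to_end \<epsilon> j (y, x) \<partial>?m) =
        (\<integral>\<^sup>+x. f y * (ennreal (g (x + 0 - 2 * y)) * weight_to_end \<epsilon> j (y, x)) \<partial>?m)"
      by (intro nn_integral_cong) (simp add: pin_def mult_ac)
    also have "\<dots> = f y * (\<integral>\<^sup>+x. ennreal (g (x + 0 - 2 * y)) * weight_to_end \<epsilon> j (y, x) \<partial>?m)"
      by (rule nn_integral_cmult) measurable
    finally show "(\<integral>\<^sup>+x. pin f (x, y) * weight_to_end \<epsilon> j (y, x) \<partial>?m) = f y * weight_to_end \<epsilon> k (0, y)"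
      by (simp add: Suc weight_to_end_Suc step_def)
  qed
  finally show ?thesis .
qed

end

section \<open>Maxima at the origin and second moments\<close>

text \<open>
  The values are extended reals, as for all weights here, but the witness is a real function. In
  particular such a function is finite everywhere.
\<close>

definition even_log_concave :: "(real \<times> real \<Rightarrow> ennreal) \<Rightarrow> bool" where
  "even_log_concave F \<longleftrightarrow> (\<exists>f. log_concave f \<and> (\<forall>p. f (- p) = f p) \<and>
     f \<in> borel_measurable (borel \<Otimes>\<^sub>M borel) \<and> F = (\<lambda>p. ennreal (f p)))"

text \<open>
  A pinned weight is a sum of log-concave functions, one for each set of contacts. Such sums need
  not be log-concave, but they inherit that the maximum is at the origin.
\<close>

inductive even_log_concave_mixture :: "(real \<times> real \<Rightarrow> ennreal) \<Rightarrow> bool" where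
  component: "even_log_concave F \<Longrightarrow> even_log_concave_mixture F"
| add: "even_log_concave_mixture F \<Longrightarrow> even_log_concave_mixture H \<Longrightarrow>
    even_log_concave_mixture (\<lambda>p. F p + H p)"

lemma even_log_concave_mixture_measurable:
  "even_log_concave_mixture F \<Longrightarrow> F \<in> borel_measurable (borel \<Otimes>\<^sub>M borel)"
  by (induction rule: even_log_concave_mixture.induct) (auto simp: even_log_concave_def)

lemma even_log_concave_mixture_le:
  "even_log_concave_mixture F \<Longrightarrow> F p \<le> F (0, 0)"
proof (induction rule: even_log_concave_mixture.induct)
  case (component F)
  then show ?case
    by (auto simp: even_log_concave_def simp flip: zero_prod_def intro!: ennreal_leI log_concave_even_le_0)
qed (auto intro: add_mono)

lemma even_log_concave_mixture_finite: "even_log_concave_mixture F \<Longrightarrow> F p < \<top>"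
  by (induction rule: even_log_concave_mixture.induct) (auto simp: even_log_concave_def)

lemma even_log_concave_cmult:
  "even_log_concave F \<Longrightarrow> 0 \<le> c \<Longrightarrow> even_log_concave (\<lambda>p. ennreal c * F p)"
proof -
  assume "even_log_concave F" "0 \<le> c"
  then obtain f where f: "log_concave f" "\<And>p. f (- p) = f p"
    "f \<in> borel_measurable (borel \<Otimes>\<^sub>M borel)" "F = (\<lambda>p. ennreal (f p))"
    by (auto simp: even_log_concave_def)
  show "even_log_concave (\<lambda>p. ennreal c * F p)" unfolding even_log_concave_def
    using f \<open>0 \<le> c\<close>
    by (intro exI[of _ "\<lambda>p. c * f p"]) (auto simp: log_concave_cmult log_concave_nonneg ennreal_mult)
qed

lemma site_measure_0 [simp]: "site_measure 0 = lborel"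
  by (intro measure_eqI) (auto simp: emeasure_site_measure)

text \<open>
  The mixed term vanishes because \<open>f\<close> is even. Averaging over \<open>x\<close> and \<open>-x\<close> removes it without a
  subtraction of extended reals.
\<close>

lemma second_moment_affine:
  fixes f :: "real \<Rightarrow> ennreal"
  assumes [measurable]: "f \<in> borel_measurable borel" and even: "\<And>x. f (- x) = f x"
    and int: "(\<integral>\<^sup>+x. f x \<partial>lborel) = 1"
  shows "(\<integral>\<^sup>+x. ennreal ((a + b * x)\<^sup>2) * f x \<partial>lborel) =
    ennreal (a\<^sup>2) + ennreal (b\<^sup>2) * (\<integral>\<^sup>+x. ennreal (x\<^sup>2) * f x \<partial>lborel)" (is "?I b = ?R")
proof -
  have "?I b = ?I (- b)"
    by (subst nn_integral_real_affine[where c = "-1" and t = 0]) (auto simp: even)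
  then have "2 * ?I b = ?I b + ?I (- b)" by (simp add: mult_2)
  also have "\<dots> = (\<integral>\<^sup>+x. (2 * ennreal (a\<^sup>2)) * f x + (2 * ennreal (b\<^sup>2)) * (ennreal (x\<^sup>2) * f x) \<partial>lborel)"
  proof (subst nn_integral_add[symmetric])
    have "ennreal ((a + b * x)\<^sup>2) + ennreal ((a + - b * x)\<^sup>2) = 2 * ennreal (a\<^sup>2) + 2 * ennreal (b\<^sup>2) * ennreal (x\<^sup>2)" for x
      by (simp flip: ennreal_plus ennreal_mult ennreal_numeral) (simp add: power2_eq_square algebra_simps)
    then show "(\<integral>\<^sup>+x. ennreal ((a + b * x)\<^sup>2) * f x + ennreal ((a + - b * x)\<^sup>2) * f x \<partial>lborel) =
      (\<integral>\<^sup>+x. (2 * ennreal (a\<^sup>2)) * f x + (2 * ennreal (b\<^sup>2)) * (ennreal (x\<^sup>2) * f x) \<partial>lborel)"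
      by (intro nn_integral_cong) (simp only: distrib_right[symmetric] mult.assoc[symmetric])
  qed auto
  also have "\<dots> = (2 * ennreal (a\<^sup>2)) * (\<integral>\<^sup>+x. f x \<partial>lborel) + (2 * ennreal (b\<^sup>2)) * (\<integral>\<^sup>+x. ennreal (x\<^sup>2) * f x \<partial>lborel)"
    by (subst nn_integral_add) (auto simp: nn_integral_cmult)
  also have "\<dots> = 2 * ?R" by (simp add: int distrib_left mult.assoc)
  finally show ?thesis by (subst (asm) ennreal_mult_cancel_left) simp
qed

context increment_density
begin

lemma even_log_concave_pin:
  assumes "log_concave h" "h \<in> borel_measurable borel" "\<And>y. h (- y) = h y"
  shows "even_log_concave (pin (\<lambda>y. ennreal (h y)))"
proof -
  let ?f = "\<lambda>p. g (fst p - 2 * snd p) * h (snd p)"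
  have [measurable]: "h \<in> borel_measurable borel" by fact
  have "log_concave ?f"
    by (intro log_concave_mult log_concave_linear[OF g_log_concave] log_concave_linear[OF assms(1)])
      (auto intro!: linearI simp: algebra_simps)
  moreover have "?f (- p) = ?f p" for p
    using g_even[of "fst p - 2 * snd p"] assms(3) by (simp add: algebra_simps)
  moreover have "?f \<in> borel_measurable (borel \<Otimes>\<^sub>M borel)" by measurable
  ultimately show ?thesis unfolding even_log_concave_def pin_def
    using log_concave_nonneg[OF assms(1)]
    by (intro exI[of _ ?f]) (auto simp: ennreal_mult g_nonneg)
qed

lemma even_log_concave_free_step:
  assumes "even_log_concave F"
  shows "even_log_concave (step 0 F)"
proof -
  obtain f where f: "log_concave f" "\<And>p. f (- p) = f p"
    and [measurable]: "f \<in> borel_measurable (borel \<Otimes>\<^sub>M borel)" and F: "F = (\<lambda>p. ennreal (f p))"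
    using assms by (auto simp: even_log_concave_def)
  define k where "k = (\<lambda>q :: (real \<times> real) \<times> real. g (snd q + fst (fst q) - 2 * snd (fst q)) * f (snd (fst q), snd q))"
  have f_le: "f p \<le> f 0" for p by (rule log_concave_even_le_0[OF f])
  have k_lc: "log_concave k" unfolding k_def
    by (intro log_concave_mult log_concave_linear[OF g_log_concave] log_concave_linear[OF f(1)])
      (auto intro!: linearI simp: algebra_simps)
  have k_le: "k q \<le> g 0 * f 0" for q unfolding k_def
    by (intro mult_mono g_le f_le g_nonneg log_concave_nonneg[OF f(1)])
  have [measurable]: "k \<in> borel_measurable ((borel \<Otimes>\<^sub>M borel) \<Otimes>\<^sub>M borel)" unfolding k_def by measurable
  have [measurable]: "(\<lambda>z. k (p, z)) \<in> borel_measurable borel" for p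
    by (rule measurable_compose[OF measurable_Pair1' \<open>k \<in> _\<close>]) (simp add: space_pair_measure)
  have k_eq: "ennreal (k (p, z)) = ennreal (g (z + fst p - 2 * snd p)) * F (snd p, z)" for p z
    by (simp add: k_def F ennreal_mult g_nonneg log_concave_nonneg[OF f(1)])
  have k_fin: "(\<integral>\<^sup>+z. ennreal (k (p, z)) \<partial>lborel) < \<infinity>" for p
  proof -
    have "(\<integral>\<^sup>+z. ennreal (k (p, z)) \<partial>lborel) \<le> (\<integral>\<^sup>+z. ennreal (f 0) * ennreal (g (z + (fst p - 2 * snd p))) \<partial>lborel)"
      unfolding k_eq F using f_le
      by (intro nn_integral_mono) (auto simp: algebra_simps intro!: mult_mono ennreal_leI)
    also have "\<dots> = ennreal (f 0)" by (simp add: nn_integral_cmult g_integral_shift)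
    also have "\<dots> < \<infinity>" by simp
    finally show ?thesis .
  qed
  define f' where "f' = (\<lambda>p. enn2real (\<integral>\<^sup>+z. ennreal (k (p, z)) \<partial>lborel))"
  have eq: "step 0 F = (\<lambda>p. ennreal (f' p))"
    using k_fin by (auto simp: step_def f'_def less_top k_eq)
  have "log_concave f'" unfolding f'_def
  proof (rule log_concave_marginal[OF k_lc _ k_le k_fin])
    show "(\<lambda>z. k (p, z)) \<in> borel_measurable borel" for p by measurable
  qed
  moreover have "f' (- p) = f' p" for p
  proof -
    have k_even: "k (- p, - z) = k (p, z)" for z
      using g_even[of "z + fst p - 2 * snd p"] f(2)[of "(snd p, z)"] by (simp add: k_def algebra_simps)
    have "(\<integral>\<^sup>+z. ennreal (k (- p, z)) \<partial>lborel) = (\<integral>\<^sup>+z. ennreal (k (- p, - z)) \<partial>lborel)"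
      by (subst nn_integral_real_affine[where c = "-1" and t = 0]) auto
    also have "\<dots> = (\<integral>\<^sup>+z. ennreal (k (p, z)) \<partial>lborel)" by (simp add: k_even)
    finally show ?thesis by (simp add: f'_def)
  qed
  moreover have "f' \<in> borel_measurable (borel \<Otimes>\<^sub>M borel)" unfolding f'_def by measurable
  ultimately show ?thesis unfolding even_log_concave_def eq by blast
qed

lemma even_log_concave_funpow_free_step:
  "even_log_concave F \<Longrightarrow> even_log_concave ((step 0 ^^ k) F)"
  by (induction k) (auto intro: even_log_concave_free_step)

lemma even_log_concave_mixture_step:
  assumes "even_log_concave_mixture F" and "0 \<le> \<epsilon>"
  shows "even_log_concave_mixture (step \<epsilon> F)"
  using assms(1)
proof (induction rule: even_log_concave_mixture.induct)
  case (component F)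
  then obtain f where f: "log_concave f" "\<And>p. f (- p) = f p"
    and [measurable]: "f \<in> borel_measurable (borel \<Otimes>\<^sub>M borel)" and F: "F = (\<lambda>p. ennreal (f p))"
    by (auto simp: even_log_concave_def)
  have "even_log_concave (pin (\<lambda>y. ennreal (f (y, 0))))"
    using f(2)[of "(_, 0)"]
    by (intro even_log_concave_pin log_concave_linear[OF f(1)]) (auto intro!: linearI)
  then have "even_log_concave_mixture (\<lambda>p. step 0 F p + ennreal \<epsilon> * pin (\<lambda>y. F (y, 0)) p)"
    using component assms(2) unfolding F
    by (intro even_log_concave_mixture.intros even_log_concave_free_step even_log_concave_cmult) auto
  also have "(\<lambda>p. step 0 F p + ennreal \<epsilon> * pin (\<lambda>y. F (y, 0)) p) = step \<epsilon> F"
    using step_split[of F 0 \<epsilon>] assms(2) by (auto simp: F)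
  finally show ?case .
next
  case (add F H)
  have "step \<epsilon> (\<lambda>p. F p + H p) = (\<lambda>p. step \<epsilon> F p + step \<epsilon> H p)"
    using add.hyps by (auto simp: step_add even_log_concave_mixture_measurable)
  then show ?case using add.IH by (auto intro: even_log_concave_mixture.add)
qed

lemma even_log_concave_mixture_weight_to_end:
  assumes "0 \<le> \<epsilon>"
  shows "even_log_concave_mixture (weight_to_end \<epsilon> k)"
proof (induction k)
  case 0
  then show ?case unfolding weight_to_end_def using g_log_concave g_even
    by (auto intro!: even_log_concave_mixture.component even_log_concave_pin)
next
  case (Suc k)
  then show ?case using assms by (simp add: weight_to_end_Suc even_log_concave_mixture_step)
qed

lemma weight_to_end_le: "0 \<le> \<epsilon> \<Longrightarrow> weight_to_end \<epsilon> k p \<le> weight_to_end \<epsilon> k (0, 0)"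
  by (intro even_log_concave_mixture_le even_log_concave_mixture_weight_to_end)

lemma weight_to_end_finite: "0 \<le> \<epsilon> \<Longrightarrow> weight_to_end \<epsilon> k p < \<top>"
  by (intro even_log_concave_mixture_finite even_log_concave_mixture_weight_to_end)

lemma even_log_concave_weight_to_end_free: "even_log_concave (weight_to_end 0 k)"
  unfolding weight_to_end_def using g_log_concave g_even
  by (intro even_log_concave_funpow_free_step even_log_concave_pin) auto

definition increment_variance :: real where
  "increment_variance = enn2real (\<integral>\<^sup>+x. ennreal (x\<^sup>2) * ennreal (g x) \<partial>lborel)"

lemma increment_variance_eq: "(\<integral>\<^sup>+x. ennreal (x\<^sup>2) * ennreal (g x) \<partial>lborel) = ennreal increment_variance"
  using log_concave_even_peak_1d(2)[OF g_log_concave g_even g_measurable g_integral]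
  by (simp add: increment_variance_def le_less_trans[OF _ ennreal_less_top])

lemma increment_variance_pos: "0 < increment_variance"
proof (rule ccontr)
  assume "\<not> 0 < increment_variance"
  then have "(\<integral>\<^sup>+x. ennreal (x\<^sup>2) * ennreal (g x) \<partial>lborel) = 0"
    by (simp add: increment_variance_eq ennreal_neg)
  then have "AE x in lborel. ennreal (x\<^sup>2) * ennreal (g x) = 0"
    by (subst (asm) nn_integral_0_iff_AE) auto
  then have "AE x in lborel. ennreal (g x) = 0"
    using AE_lborel_singleton[of 0] by eventually_elim auto
  then have "(\<integral>\<^sup>+x. ennreal (g x) \<partial>lborel) = 0"
    by (subst nn_integral_0_iff_AE) auto
  then show False by (simp add: g_integral)
qed

lemma step_const: "step 0 (\<lambda>_. c) = (\<lambda>_. c)"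
proof
  fix p :: "real \<times> real"
  show "step 0 (\<lambda>_. c) p = c"
    using g_integral_shift[of "fst p - 2 * snd p"]
    by (cases p) (simp add: step_def nn_integral_cmult algebra_simps)
qed

lemma funpow_step_const: "(step 0 ^^ k) (\<lambda>_. c) = (\<lambda>_. c)"
  by (induction k) (auto simp: step_const)

lemma step_square:
  "step 0 (\<lambda>(x, y). ennreal ((\<alpha> * x + \<beta> * y)\<^sup>2)) =
    (\<lambda>p. (\<lambda>(x, y). ennreal ((- \<beta> * x + (\<alpha> + 2 * \<beta>) * y)\<^sup>2)) p + ennreal (\<beta>\<^sup>2 * increment_variance))"
proof
  fix p :: "real \<times> real"
  obtain x y where p: "p = (x, y)" by (cases p)
  have "step 0 (\<lambda>(x, y). ennreal ((\<alpha> * x + \<beta> * y)\<^sup>2)) (x, y) =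
      (\<integral>\<^sup>+z. ennreal (g (z + x - 2 * y)) * ennreal ((\<alpha> * y + \<beta> * z)\<^sup>2) \<partial>lborel)"
    by (simp add: step_def)
  also have "\<dots> = (\<integral>\<^sup>+u. ennreal (((- \<beta> * x + (\<alpha> + 2 * \<beta>) * y) + \<beta> * u)\<^sup>2) * ennreal (g u) \<partial>lborel)"
    by (subst nn_integral_real_affine[where c = 1 and t = "2 * y - x"])
      (auto simp: algebra_simps)
  also have "\<dots> = ennreal ((- \<beta> * x + (\<alpha> + 2 * \<beta>) * y)\<^sup>2) + ennreal (\<beta>\<^sup>2) * ennreal increment_variance"
    by (subst second_moment_affine) (auto simp: g_even g_integral increment_variance_eq)
  finally show "step 0 (\<lambda>(x, y). ennreal ((\<alpha> * x + \<beta> * y)\<^sup>2)) p =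
    (\<lambda>(x, y). ennreal ((- \<beta> * x + (\<alpha> + 2 * \<beta>) * y)\<^sup>2)) p + ennreal (\<beta>\<^sup>2 * increment_variance)"
    using increment_variance_pos by (simp add: p ennreal_mult)
qed

text \<open>
  One step turns \<open>\<alpha> * x + \<beta> * y\<close> into \<open>- \<beta> * x + (\<alpha> + 2 * \<beta>) * y\<close> plus \<open>\<beta>\<close> times an independent increment.
  The successive coefficients of the second height form an arithmetic progression with difference
  \<open>\<alpha> + \<beta>\<close>.
\<close>

lemma free_second_moment:
  "(step 0 ^^ k) (\<lambda>(x, y). ennreal ((\<alpha> * x + \<beta> * y)\<^sup>2)) (0, 0) =
    ennreal (increment_variance * (\<Sum>j<k. (\<beta> + real j * (\<alpha> + \<beta>))\<^sup>2))"
proof (induction k arbitrary: \<alpha> \<beta>)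
  case (Suc k)
  let ?q = "\<lambda>\<alpha> \<beta>. \<lambda>(x, y). ennreal ((\<alpha> * x + \<beta> * y)\<^sup>2)"
  have "(step 0 ^^ Suc k) (?q \<alpha> \<beta>) (0, 0) =
      (step 0 ^^ k) (\<lambda>p. ?q (- \<beta>) (\<alpha> + 2 * \<beta>) p + ennreal (\<beta>\<^sup>2 * increment_variance)) (0, 0)"
    by (simp only: funpow_Suc_right o_def step_square)
  also have "\<dots> = (step 0 ^^ k) (?q (- \<beta>) (\<alpha> + 2 * \<beta>)) (0, 0) + ennreal (\<beta>\<^sup>2 * increment_variance)"
    by (subst funpow_step_add) (auto simp: funpow_step_const)
  also have "\<dots> = ennreal (increment_variance * (\<Sum>j<k. (\<beta> + real (Suc j) * (\<alpha> + \<beta>))\<^sup>2)) + ennreal (\<beta>\<^sup>2 * increment_variance)"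
    unfolding Suc by (simp add: algebra_simps)
  also have "\<dots> = ennreal (increment_variance * (\<Sum>j<Suc k. (\<beta> + real j * (\<alpha> + \<beta>))\<^sup>2))"
    using increment_variance_pos
    by (subst sum.lessThan_Suc_shift) (simp add: sum_nonneg algebra_simps flip: ennreal_plus)
  finally show ?case .
qed simp

end

section \<open>The field without pinning\<close>

lemma sum_squares_lower: "real (Suc k) ^ 3 / 3 \<le> (\<Sum>j\<le>k. (real j + 1)\<^sup>2)"
proof (induction k)
  case (Suc k)
  have "real (Suc (Suc k)) ^ 3 / 3 \<le> real (Suc k) ^ 3 / 3 + (real (Suc k) + 1)\<^sup>2"
  proof -
    define x where "x = real (Suc k)"
    have "(x + 1) ^ 3 \<le> x ^ 3 + 3 * (x + 1)\<^sup>2"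
      by (simp add: x_def power3_eq_cube power2_eq_square algebra_simps)
    then show ?thesis by (simp add: x_def add.commute)
  qed
  then show ?case using Suc by simp
qed simp

text \<open>
  The sum is the quadratic polynomial \<open>a * \<gamma>\<^sup>2 - 2 * b * \<gamma> + n\<close> with minimum \<open>n - b\<^sup>2 / a\<close>, where \<open>a\<close> and \<open>b\<close> are
  the sums of the first \<open>n\<close> squares and of the first \<open>n\<close> numbers.
\<close>

lemma affine_square_sum_lower:
  fixes \<gamma> :: real
  assumes "2 \<le> n"
  shows "real n / 10 \<le> (\<Sum>j<n. ((real j + 1) * \<gamma> - 1)\<^sup>2)"
proof -
  define x where "x = real n"
  define a where "a = x * (x + 1) * (2 * x + 1) / 6"
  define b where "b = x * (x + 1) / 2"
  have x: "2 \<le> x" using assms by (simp add: x_def)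
  have "(\<Sum>j<n. ((real j + 1) * \<gamma> - 1)\<^sup>2) = a * \<gamma>\<^sup>2 - 2 * b * \<gamma> + x"
    unfolding a_def b_def x_def
    by (induction n) (auto simp: power2_eq_square algebra_simps add_divide_distrib)
  moreover have "x / 10 \<le> a * \<gamma>\<^sup>2 - 2 * b * \<gamma> + x"
  proof -
    have "0 < a" using x by (simp add: a_def)
    have "0 \<le> (x + 1) * x\<^sup>2 * (3 * x - 6) / 60" using x by simp
    also have "\<dots> = a * (9 * x / 10) - b\<^sup>2"
      by (simp add: a_def b_def power2_eq_square algebra_simps add_divide_distrib diff_divide_distrib)
    also have "\<dots> \<le> a * (9 * x / 10) - b\<^sup>2 + (a * \<gamma> - b)\<^sup>2" by simp
    also have "\<dots> = a * (a * \<gamma>\<^sup>2 - 2 * b * \<gamma> + x - x / 10)"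
      by (simp add: power2_eq_square algebra_simps)
    finally have "0 \<le> a * \<gamma>\<^sup>2 - 2 * b * \<gamma> + x - x / 10" using \<open>0 < a\<close> by (simp add: zero_le_mult_iff)
    then show ?thesis by simp
  qed
  ultimately show ?thesis by (simp add: x_def)
qed

lemma powr_three_halves_square: "0 < x \<Longrightarrow> (x powr (- 3 / 2))\<^sup>2 = 1 / x ^ 3" for x :: real
proof -
  assume x: "0 < x"
  have "(x powr (- 3 / 2))\<^sup>2 = x powr (- 3)" by (simp add: power2_eq_square flip: powr_add)
  then show ?thesis using x by (simp add: powr_minus_divide)
qed

context increment_density
begin

text \<open>
  The density of \<open>X\<^sub>1 + 2 * X\<^sub>2 + \<dots> + (k + 1) * X\<^sub>k\<^sub>+\<^sub>1\<close> for independent increments with density \<open>g\<close>, which is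
  the height of the field without pinning after \<open>k + 1\<close> steps from two zeros.
\<close>

primrec hitting_density :: "nat \<Rightarrow> real \<Rightarrow> ennreal" where
  "hitting_density 0 = (\<lambda>t. ennreal (g t))"
| "hitting_density (Suc k) = (\<lambda>t. \<integral>\<^sup>+u. ennreal (g u) * hitting_density k (t + (real k + 2) * u) \<partial>lborel)"

lemma hitting_density_measurable [measurable]: "hitting_density k \<in> borel_measurable borel"
  by (induction k) simp_all

text \<open>
  After \<open>k + 1\<close> steps the field returns to \<open>0\<close> if the increments cancel the linear extrapolation of \<open>x\<close>
  and \<open>y\<close>.
\<close>

lemma free_return_eq:
  "(step 0 ^^ k) (pin (\<lambda>_. 1)) (x, y) = hitting_density k (y + (real k + 1) * (y - x))"
proof (induction k arbitrary: x y)
  case 0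
  then show ?case using g_even[of "x - 2 * y"] by (simp add: pin_def algebra_simps)
next
  case (Suc k)
  have "(step 0 ^^ Suc k) (pin (\<lambda>_. 1)) (x, y) =
      (\<integral>\<^sup>+z. ennreal (g (z + x - 2 * y)) * hitting_density k (z + (real k + 1) * (z - y)) \<partial>lborel)"
    by (simp add: step_def Suc)
  also have "\<dots> = hitting_density (Suc k) (y + (real (Suc k) + 1) * (y - x))"
    by (subst nn_integral_real_affine[where c = 1 and t = "2 * y - x"]) (auto simp: algebra_simps)
  finally show ?case .
qed

lemma even_log_concave_free_return: "even_log_concave ((step 0 ^^ k) (pin (\<lambda>_. 1)))"
proof -
  have "log_concave (\<lambda>_::real. 1::real)" by (simp add: log_concave_def)
  then have "even_log_concave (pin (\<lambda>_. ennreal 1))" by (intro even_log_concave_pin) auto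
  then show ?thesis by (intro even_log_concave_funpow_free_step) simp
qed

lemma hitting_density_log_concave:
  obtains f where "log_concave f" "\<And>t. f (- t) = f t" "f \<in> borel_measurable borel"
    "hitting_density k = (\<lambda>t. ennreal (f t))"
proof -
  obtain f where f: "log_concave f" "\<And>p. f (- p) = f p"
    "f \<in> borel_measurable (borel \<Otimes>\<^sub>M borel)" "(step 0 ^^ k) (pin (\<lambda>_. 1)) = (\<lambda>p. ennreal (f p))"
    using even_log_concave_free_return[of k] by (auto simp: even_log_concave_def)
  have "hitting_density k t = ennreal (f (- t / (real k + 1), 0))" for t
    using free_return_eq[of k "- t / (real k + 1)" 0] f(4) by simp
  moreover have "log_concave (\<lambda>t. f (- t / (real k + 1), 0))"
    by (rule log_concave_linear[OF f(1)]) (auto intro!: linearI simp: add_divide_distrib)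
  moreover have "f (- (- t) / (real k + 1), 0) = f (- t / (real k + 1), 0)" for t
    using f(2)[of "(t / (real k + 1), 0)"] by simp
  moreover have "(\<lambda>t. f (- t / (real k + 1), 0)) \<in> borel_measurable borel"
    using f(3) by measurable
  ultimately show ?thesis using that[of "\<lambda>t. f (- t / (real k + 1), 0)"] by blast
qed

lemma hitting_density_even: "hitting_density k (- t) = hitting_density k t"
  using hitting_density_log_concave[of k] by metis

lemma hitting_density_integral: "(\<integral>\<^sup>+t. hitting_density k t \<partial>lborel) = 1"
proof (induction k)
  case (Suc k)
  have "(\<integral>\<^sup>+t. hitting_density (Suc k) t \<partial>lborel) =
      (\<integral>\<^sup>+u. \<integral>\<^sup>+t. ennreal (g u) * hitting_density k (t + (real k + 2) * u) \<partial>lborel \<partial>lborel)"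
    by (simp only: hitting_density.simps, rule lborel_pair.Fubini') measurable
  also have "\<dots> = (\<integral>\<^sup>+u. ennreal (g u) * (\<integral>\<^sup>+t. hitting_density k t \<partial>lborel) \<partial>lborel)"
  proof (intro nn_integral_cong)
    fix u
    have "(\<integral>\<^sup>+t. hitting_density k (t + (real k + 2) * u) \<partial>lborel) = (\<integral>\<^sup>+t. hitting_density k t \<partial>lborel)"
      by (subst nn_integral_real_affine[where c = 1 and t = "(real k + 2) * u"]) (auto simp: add.commute)
    then show "(\<integral>\<^sup>+t. ennreal (g u) * hitting_density k (t + (real k + 2) * u) \<partial>lborel) =
        ennreal (g u) * (\<integral>\<^sup>+t. hitting_density k t \<partial>lborel)"
      by (simp add: nn_integral_cmult)
  qed
  finally show ?case by (simp add: Suc g_integral)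
qed (simp add: g_integral)

lemma hitting_density_second_moment:
  "(\<integral>\<^sup>+t. ennreal (t\<^sup>2) * hitting_density k t \<partial>lborel) = ennreal (increment_variance * (\<Sum>j\<le>k. (real j + 1)\<^sup>2))"
proof (induction k)
  case 0
  then show ?case by (simp add: increment_variance_eq)
next
  case (Suc k)
  let ?c = "real k + 2" and ?m = "increment_variance * (\<Sum>j\<le>k. (real j + 1)\<^sup>2)"
  have "(\<integral>\<^sup>+t. ennreal (t\<^sup>2) * hitting_density (Suc k) t \<partial>lborel) =
      (\<integral>\<^sup>+t. \<integral>\<^sup>+u. ennreal (t\<^sup>2) * (ennreal (g u) * hitting_density k (t + ?c * u)) \<partial>lborel \<partial>lborel)"
    by (simp add: nn_integral_cmult)
  also have "\<dots> = (\<integral>\<^sup>+u. \<integral>\<^sup>+t. ennreal (t\<^sup>2) * (ennreal (g u) * hitting_density k (t + ?c * u)) \<partial>lborel \<partial>lborel)"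
    by (rule lborel_pair.Fubini') measurable
  also have "\<dots> = (\<integral>\<^sup>+u. ennreal (g u) * (ennreal ?m + ennreal (?c\<^sup>2) * ennreal (u\<^sup>2)) \<partial>lborel)"
  proof (intro nn_integral_cong)
    fix u
    have "(\<integral>\<^sup>+t. ennreal (t\<^sup>2) * (ennreal (g u) * hitting_density k (t + ?c * u)) \<partial>lborel) =
        (\<integral>\<^sup>+t. ennreal (g u) * (ennreal (t\<^sup>2) * hitting_density k (t + ?c * u)) \<partial>lborel)"
      by (simp add: mult_ac)
    also have "\<dots> = ennreal (g u) * (\<integral>\<^sup>+t. ennreal (t\<^sup>2) * hitting_density k (t + ?c * u) \<partial>lborel)"
      by (rule nn_integral_cmult) measurable
    also have "(\<integral>\<^sup>+t. ennreal (t\<^sup>2) * hitting_density k (t + ?c * u) \<partial>lborel) =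
        (\<integral>\<^sup>+s. ennreal ((- (?c * u) + 1 * s)\<^sup>2) * hitting_density k s \<partial>lborel)"
      by (subst nn_integral_real_affine[where c = 1 and t = "- (?c * u)"]) auto
    also have "\<dots> = ennreal ((- (?c * u))\<^sup>2) + ennreal (1\<^sup>2) * ennreal ?m"
      by (subst second_moment_affine) (auto simp: hitting_density_even hitting_density_integral Suc)
    also have "\<dots> = ennreal ?m + ennreal (?c\<^sup>2) * ennreal (u\<^sup>2)"
      by (simp add: power_mult_distrib ennreal_mult add.commute)
    finally show "(\<integral>\<^sup>+t. ennreal (t\<^sup>2) * (ennreal (g u) * hitting_density k (t + ?c * u)) \<partial>lborel) =
      ennreal (g u) * (ennreal ?m + ennreal (?c\<^sup>2) * ennreal (u\<^sup>2))" .
  qed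
  also have "\<dots> = (\<integral>\<^sup>+u. ennreal ?m * ennreal (g u) + ennreal (?c\<^sup>2) * (ennreal (u\<^sup>2) * ennreal (g u)) \<partial>lborel)"
    by (intro nn_integral_cong) (simp only: distrib_left mult_ac)
  also have "\<dots> = ennreal ?m + ennreal (?c\<^sup>2) * ennreal increment_variance"
    by (simp add: nn_integral_add nn_integral_cmult g_integral increment_variance_eq)
  also have "\<dots> = ennreal (increment_variance * (\<Sum>j\<le>Suc k. (real j + 1)\<^sup>2))"
    using increment_variance_pos
    by (simp add: sum_nonneg distrib_left add.commute mult.commute flip: ennreal_mult ennreal_plus)
  finally show ?case .
qed

definition hitting_constant :: real where "hitting_constant = sqrt (216 / increment_variance)"

lemma hitting_constant_pos: "0 < hitting_constant"
  using increment_variance_pos by (simp add: hitting_constant_def)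

text \<open>
  The variance is at least of order \<open>(k + 1)\<^sup>3\<close>, and the value of an even log-concave density at its
  maximum is at most of the order of the inverse standard deviation.
\<close>

lemma hitting_density_le: "hitting_density k t \<le> ennreal (hitting_constant * (real k + 1) powr (- 3 / 2))"
proof -
  obtain f where f: "log_concave f" "\<And>t. f (- t) = f t" and [measurable]: "f \<in> borel_measurable borel"
    and eq: "hitting_density k = (\<lambda>t. ennreal (f t))" using hitting_density_log_concave[of k] by blast
  have int: "(\<integral>\<^sup>+t. ennreal (f t) \<partial>lborel) = 1" using hitting_density_integral[of k] by (simp add: eq)
  note peak = log_concave_even_peak_1d[OF f _ int, simplified]
  have "ennreal (increment_variance * (\<Sum>j\<le>k. (real j + 1)\<^sup>2)) \<le> ennreal (72 / (f 0)\<^sup>2)"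
    using peak(2) hitting_density_second_moment[of k] by (simp add: eq)
  then have "increment_variance * (\<Sum>j\<le>k. (real j + 1)\<^sup>2) \<le> 72 / (f 0)\<^sup>2"
    by (subst (asm) ennreal_le_iff) auto
  moreover have "increment_variance * (real (Suc k) ^ 3 / 3) \<le> increment_variance * (\<Sum>j\<le>k. (real j + 1)\<^sup>2)"
    using increment_variance_pos by (intro mult_left_mono sum_squares_lower) auto
  ultimately have "increment_variance * (real k + 1) ^ 3 / 3 \<le> 72 / (f 0)\<^sup>2" by (simp add: add.commute)
  then have "(f 0)\<^sup>2 \<le> 216 / (increment_variance * (real k + 1) ^ 3)"
    using increment_variance_pos peak(1) by (simp add: field_simps)
  also have "\<dots> = (hitting_constant * (real k + 1) powr (- 3 / 2))\<^sup>2"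
  proof -
    have d: "((real k + 1) powr (- 3 / 2))\<^sup>2 = 1 / (real k + 1) ^ 3"
      by (rule powr_three_halves_square) simp
    show ?thesis unfolding power_mult_distrib d
      using increment_variance_pos by (simp add: hitting_constant_def)
  qed
  finally have "f 0 \<le> hitting_constant * (real k + 1) powr (- 3 / 2)"
    by (rule power2_le_imp_le) (use hitting_constant_pos in auto)
  then show ?thesis
    using log_concave_even_le_0[OF f, of t] by (auto simp: eq intro!: ennreal_leI)
qed

lemma hitting_density_decay:
  assumes "t \<noteq> 0"
  shows "hitting_density k t \<le> ennreal (1 / (2 * \<bar>t\<bar>))"
proof -
  obtain f where f: "log_concave f" "\<And>t. f (- t) = f t" and [measurable]: "f \<in> borel_measurable borel"
    and eq: "hitting_density k = (\<lambda>t. ennreal (f t))" using hitting_density_log_concave[of k] by blast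
  have int: "(\<integral>\<^sup>+t. ennreal (f t) \<partial>lborel) \<le> ennreal 1" using hitting_density_integral[of k] by (simp add: eq)
  show ?thesis
  proof (cases "f t = 0")
    case False
    then have "0 < f t" using log_concave_nonneg[OF f(1), of t] by simp
    then have "\<bar>t\<bar> \<le> 1 / (2 * f t)"
      by (intro log_concave_even_core_le[OF f _ int]) auto
    then show ?thesis using \<open>0 < f t\<close> assms by (auto simp: eq field_simps intro!: ennreal_leI)
  qed (simp add: eq)
qed

definition free_return_constant :: real where
  "free_return_constant = sqrt (1440 * hitting_constant\<^sup>2 / increment_variance)"

text \<open>
  Up to the order of its arguments, \<open>weight_to_end 0 k\<close> is the density of two consecutive heights after
  \<open>n = k + 2\<close> steps, and its maximum is at the origin. For the lower bound, Chebyshev's inequality for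
  the height and for the slope leaves mass at least \<open>1 / 2\<close> in a parallelogram with area of order
  \<open>n\<^sup>3\<^sup>/\<^sup>2 * n\<^sup>1\<^sup>/\<^sup>2\<close>. For the upper bound, the slice where the last height is \<open>0\<close> has mass of order \<open>n\<^sup>-\<^sup>3\<^sup>/\<^sup>2\<close>,
  and every functional \<open>x + \<beta> * y\<close> has variance at least of order \<open>n\<close>.
\<close>

lemma free_weight_bounds:
  obtains m where "weight_to_end 0 k (0, 0) = ennreal m"
    "1 / (32 * increment_variance) / (real k + 2)\<^sup>2 \<le> m" "m \<le> free_return_constant / (real k + 2)\<^sup>2"
proof -
  obtain f where f: "log_concave f" "\<And>p. f (- p) = f p"
    and [measurable]: "f \<in> borel_measurable (borel \<Otimes>\<^sub>M borel)"
    and eq: "weight_to_end 0 k = (\<lambda>p. ennreal (f p))"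
    using even_log_concave_weight_to_end_free[of k] by (auto simp: even_log_concave_def)
  define F where "F = (\<lambda>(x, y). f (y, x))"
  define n where "n = k + 2"
  have F: "log_concave F" unfolding F_def case_prod_unfold
    by (rule log_concave_linear[OF f(1)]) (auto intro!: linearI)
  have F_even: "F (- p) = F p" for p using f(2)[of "(snd p, fst p)"] by (simp add: F_def case_prod_unfold)
  have [measurable]: "F \<in> borel_measurable (borel \<Otimes>\<^sub>M borel)" unfolding F_def by measurable
  have law: "(\<integral>\<^sup>+x. \<integral>\<^sup>+y. H (x, y) * ennreal (F (x, y)) \<partial>lborel \<partial>lborel) = (step 0 ^^ n) H (0, 0)"
    if "pair_measurable H" for H
    using time_reversal[OF that, where \<epsilon> = 0 and k = k] by (simp add: eq F_def n_def)
  have int: "(\<integral>\<^sup>+x. \<integral>\<^sup>+y. ennreal (F (x, y)) \<partial>lborel \<partial>lborel) = 1"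
    using law[of "\<lambda>_. 1"] by (simp add: funpow_step_const)
  have sq: "(\<integral>\<^sup>+x. \<integral>\<^sup>+y. ennreal ((\<alpha> * x + \<beta> * y)\<^sup>2) * ennreal (F (x, y)) \<partial>lborel \<partial>lborel) =
      ennreal (increment_variance * (\<Sum>j<n. (\<beta> + real j * (\<alpha> + \<beta>))\<^sup>2))" for \<alpha> \<beta>
    using law[of "\<lambda>(x, y). ennreal ((\<alpha> * x + \<beta> * y)\<^sup>2)"] free_second_moment[of n \<alpha> \<beta>] by simp
  define A where "A = hitting_constant * (real k + 2) powr (- 3 / 2)"
  have A: "0 < A" using hitting_constant_pos by (simp add: A_def)
  have slice: "(\<integral>\<^sup>+x. ennreal (F (x, 0)) \<partial>lborel) \<le> ennreal A"
  proof -
    have "(\<integral>\<^sup>+x. ennreal (F (x, 0)) \<partial>lborel) = (step 0 ^^ Suc k) (pin (\<lambda>_. 1)) (0, 0)"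
      by (subst contact_time_reversal) (auto simp: eq F_def)
    also have "\<dots> = hitting_density (Suc k) 0" using free_return_eq[of "Suc k" 0 0] by simp
    also have "\<dots> \<le> ennreal A" using hitting_density_le[of "Suc k" 0] by (simp add: A_def add.commute)
    finally show ?thesis .
  qed
  have M: "0 \<le> F 0" using log_concave_nonneg[OF F] by simp
  have upper: "(F 0)\<^sup>2 * (increment_variance * (real n / 10)) \<le> 144 * A\<^sup>2"
  proof (rule log_concave_even_peak_2d[OF F F_even _ int slice A])
    fix \<beta>
    have "(\<Sum>j<n. (\<beta> + real j * (1 + \<beta>))\<^sup>2) = (\<Sum>j<n. ((real j + 1) * (1 + \<beta>) - 1)\<^sup>2)"
      by (simp add: algebra_simps)
    then have "increment_variance * (real n / 10) \<le> increment_variance * (\<Sum>j<n. (\<beta> + real j * (1 + \<beta>))\<^sup>2)"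
      using affine_square_sum_lower[of n "1 + \<beta>"] increment_variance_pos by (simp add: n_def)
    then show "ennreal (increment_variance * (real n / 10)) \<le>
        (\<integral>\<^sup>+x. \<integral>\<^sup>+y. ennreal ((x + \<beta> * y)\<^sup>2) * ennreal (F (x, y)) \<partial>lborel \<partial>lborel)"
      using sq[of 1 \<beta>] by (simp add: ennreal_leI)
  qed (use increment_variance_pos in auto)
  have "F 0 \<le> free_return_constant / (real k + 2)\<^sup>2"
  proof (rule power2_le_imp_le)
    have n: "real n = real k + 2" "0 < real k + 2" by (simp_all add: n_def)
    have "(F 0)\<^sup>2 \<le> 1440 * A\<^sup>2 / (increment_variance * real n)"
      using upper increment_variance_pos n(2) unfolding n(1)[symmetric] by (simp add: pos_le_divide_eq mult_ac)
    also have "\<dots> = (free_return_constant / (real k + 2)\<^sup>2)\<^sup>2"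
    proof -
      have "A\<^sup>2 = hitting_constant\<^sup>2 / real n ^ 3"
        unfolding A_def n(1) power_mult_distrib powr_three_halves_square[OF n(2)] by simp
      moreover have "(free_return_constant / (real n)\<^sup>2)\<^sup>2 = 1440 * hitting_constant\<^sup>2 / increment_variance / real n ^ 4"
        using increment_variance_pos by (simp add: free_return_constant_def power_divide flip: power_mult)
      ultimately show ?thesis
        using increment_variance_pos n(2) unfolding n(1)[symmetric] by (simp add: field_simps eval_nat_numeral)
    qed
    finally show "(F 0)\<^sup>2 \<le> (free_return_constant / (real k + 2)\<^sup>2)\<^sup>2" .
    show "0 \<le> free_return_constant / (real k + 2)\<^sup>2"
      using increment_variance_pos by (simp add: free_return_constant_def)
  qed
  moreover have "1 / (32 * increment_variance) / (real k + 2)\<^sup>2 \<le> F 0"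
  proof -
    define v where "v = increment_variance * real n"
    define h where "h = increment_variance * real n ^ 3"
    have pos: "0 < v" "0 < h" using increment_variance_pos by (auto simp: v_def h_def n_def)
    \<comment> \<open>The factors 2 and Chebyshev's inequality leave mass at most 1/4 outside each of the two strips.\<close>
    define B where "B = (\<lambda>(x::real, y::real). indicator {- (2 * sqrt h)..2 * sqrt h} y
        * indicator {- (2 * sqrt v)..2 * sqrt v} (y - x) :: ennreal)"
    have [measurable]: "pair_measurable B" unfolding B_def by measurable
    have outside: "1 \<le> B (x, y) + ennreal (1 / (4 * h)) * ennreal ((0 * x + 1 * y)\<^sup>2)
        + ennreal (1 / (4 * v)) * ennreal ((- 1 * x + 1 * y)\<^sup>2)" for x y
    proof (cases "B (x, y) = 1")
      case False
      then have "2 * sqrt h < \<bar>y\<bar> \<or> 2 * sqrt v < \<bar>y - x\<bar>"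
      proof (rule contrapos_np)
        assume "\<not> (2 * sqrt h < \<bar>y\<bar> \<or> 2 * sqrt v < \<bar>y - x\<bar>)"
        then have "y \<in> {- (2 * sqrt h)..2 * sqrt h}" "y - x \<in> {- (2 * sqrt v)..2 * sqrt v}"
          by (simp_all add: abs_le_iff not_less)
        then show "B (x, y) = 1" by (simp only: B_def prod.case indicator_simps mult_1)
      qed
      then have "4 * h \<le> y\<^sup>2 \<or> 4 * v \<le> (y - x)\<^sup>2"
      proof (elim disjE)
        assume "2 * sqrt h < \<bar>y\<bar>"
        then have "(2 * sqrt h)\<^sup>2 \<le> \<bar>y\<bar>\<^sup>2" using pos by (intro power_mono) auto
        then show ?thesis using pos by (simp add: power_mult_distrib)
      next
        assume "2 * sqrt v < \<bar>y - x\<bar>"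
        then have "(2 * sqrt v)\<^sup>2 \<le> \<bar>y - x\<bar>\<^sup>2" using pos by (intro power_mono) auto
        then show ?thesis using pos by (simp add: power_mult_distrib)
      qed
      then have "1 \<le> 1 / (4 * h) * y\<^sup>2 + 1 / (4 * v) * (y - x)\<^sup>2"
      proof (elim disjE)
        assume "4 * h \<le> y\<^sup>2"
        then have "1 \<le> 1 / (4 * h) * y\<^sup>2" using pos by (simp add: field_simps)
        moreover have "0 \<le> 1 / (4 * v) * (y - x)\<^sup>2" using pos by simp
        ultimately show ?thesis by linarith
      next
        assume "4 * v \<le> (y - x)\<^sup>2"
        then have "1 \<le> 1 / (4 * v) * (y - x)\<^sup>2" using pos by (simp add: field_simps)
        moreover have "0 \<le> 1 / (4 * h) * y\<^sup>2" using pos by simp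
        ultimately show ?thesis by linarith
      qed
      then have "ennreal 1 \<le> ennreal (1 / (4 * h) * y\<^sup>2 + 1 / (4 * v) * (y - x)\<^sup>2)" by (rule ennreal_leI)
      also have "\<dots> = ennreal (1 / (4 * h)) * ennreal (y\<^sup>2) + ennreal (1 / (4 * v)) * ennreal ((y - x)\<^sup>2)"
        using pos by (simp only: ennreal_plus ennreal_mult zero_le_power2 zero_le_divide_1_iff mult_nonneg_nonneg)
      also have "\<dots> \<le> B (x, y) + \<dots>" by simp
      finally show ?thesis by (simp add: add.assoc)
    next
      case True
      then show ?thesis by (simp add: add.assoc)
    qed
    have "1 = (\<integral>\<^sup>+x. \<integral>\<^sup>+y. 1 * ennreal (F (x, y)) \<partial>lborel \<partial>lborel)" using int by simp
    also have "\<dots> \<le> (\<integral>\<^sup>+x. \<integral>\<^sup>+y. (B (x, y) + ennreal (1 / (4 * h)) * ennreal ((0 * x + 1 * y)\<^sup>2)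
        + ennreal (1 / (4 * v)) * ennreal ((- 1 * x + 1 * y)\<^sup>2)) * ennreal (F (x, y)) \<partial>lborel \<partial>lborel)"
      by (intro nn_integral_mono mult_right_mono outside) auto
    also have "\<dots> = (\<integral>\<^sup>+x. \<integral>\<^sup>+y. B (x, y) * ennreal (F (x, y)) \<partial>lborel \<partial>lborel)
        + ennreal (1 / (4 * h)) * (\<integral>\<^sup>+x. \<integral>\<^sup>+y. ennreal ((0 * x + 1 * y)\<^sup>2) * ennreal (F (x, y)) \<partial>lborel \<partial>lborel)
        + ennreal (1 / (4 * v)) * (\<integral>\<^sup>+x. \<integral>\<^sup>+y. ennreal ((- 1 * x + 1 * y)\<^sup>2) * ennreal (F (x, y)) \<partial>lborel \<partial>lborel)"
      by (simp only: distrib_right mult.assoc) (simp add: nn_integral_add nn_integral_cmult del: mult_minus1 mult_1 mult_zero_left)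
    also have "\<dots> \<le> ennreal (F 0 * (16 * sqrt h * sqrt v)) + ennreal (1 / 4) + ennreal (1 / 4)"
    proof (intro add_mono)
      have "(\<integral>\<^sup>+x. \<integral>\<^sup>+y. B (x, y) * ennreal (F (x, y)) \<partial>lborel \<partial>lborel)
          \<le> (\<integral>\<^sup>+x. \<integral>\<^sup>+y. ennreal (F 0) * B (x, y) \<partial>lborel \<partial>lborel)"
        unfolding mult.commute[of "ennreal (F 0)"]
        by (intro nn_integral_mono mult_left_mono ennreal_leI log_concave_even_le_0[OF F F_even]) simp
      also have "\<dots> = ennreal (F 0) * (\<integral>\<^sup>+x. \<integral>\<^sup>+y. B (x, y) \<partial>lborel \<partial>lborel)"
        by (simp add: nn_integral_cmult)
      also have "(\<integral>\<^sup>+x. \<integral>\<^sup>+y. B (x, y) \<partial>lborel \<partial>lborel) = (\<integral>\<^sup>+y. \<integral>\<^sup>+x. B (x, y) \<partial>lborel \<partial>lborel)"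
        by (rule lborel_pair.Fubini') measurable
      also have "\<dots> = (\<integral>\<^sup>+y. ennreal (4 * sqrt v) * indicator {- (2 * sqrt h)..2 * sqrt h} y \<partial>lborel)"
      proof (intro nn_integral_cong)
        fix y
        have "B (x, y) = indicator {- (2 * sqrt h)..2 * sqrt h} y * indicator {y - 2 * sqrt v..y + 2 * sqrt v} x" for x
          by (auto simp: B_def indicator_def)
        then show "(\<integral>\<^sup>+x. B (x, y) \<partial>lborel) = ennreal (4 * sqrt v) * indicator {- (2 * sqrt h)..2 * sqrt h} y"
          using pos by (simp add: nn_integral_cmult mult.commute)
      qed
      also have "\<dots> = ennreal (4 * sqrt v) * ennreal (4 * sqrt h)"
        using pos by (simp add: nn_integral_cmult)
      finally show "(\<integral>\<^sup>+x. \<integral>\<^sup>+y. B (x, y) * ennreal (F (x, y)) \<partial>lborel \<partial>lborel) \<le> ennreal (F 0 * (16 * sqrt h * sqrt v))"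
        using pos M by (simp add: mult_ac flip: ennreal_mult)
      have "(\<Sum>j<n. (1 + real j * (0 + 1))\<^sup>2) \<le> (\<Sum>j<n. (real n)\<^sup>2)"
        by (intro sum_mono power_mono) auto
      then have "increment_variance * (\<Sum>j<n. (1 + real j * (0 + 1))\<^sup>2) \<le> h"
        using increment_variance_pos by (simp add: h_def power2_eq_square power3_eq_cube)
      then show "ennreal (1 / (4 * h)) * (\<integral>\<^sup>+x. \<integral>\<^sup>+y. ennreal ((0 * x + 1 * y)\<^sup>2) * ennreal (F (x, y)) \<partial>lborel \<partial>lborel) \<le> ennreal (1 / 4)"
        unfolding sq using pos increment_variance_pos
        by (subst ennreal_mult[symmetric]) (auto simp: sum_nonneg field_simps intro!: ennreal_leI)
      show "ennreal (1 / (4 * v)) * (\<integral>\<^sup>+x. \<integral>\<^sup>+y. ennreal ((- 1 * x + 1 * y)\<^sup>2) * ennreal (F (x, y)) \<partial>lborel \<partial>lborel) \<le> ennreal (1 / 4)"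
        unfolding sq using pos increment_variance_pos
        by (subst ennreal_mult[symmetric]) (auto simp: v_def)
    qed
    also have "\<dots> = ennreal (F 0 * (16 * sqrt h * sqrt v) + 1 / 2)"
      using pos M by (simp flip: ennreal_plus)
    finally have "ennreal 1 \<le> ennreal (F 0 * (16 * sqrt h * sqrt v) + 1 / 2)"
      by (simp only: ennreal_1)
    then have "1 \<le> F 0 * (16 * sqrt h * sqrt v) + 1 / 2"
      by (rule iffD1[OF ennreal_le_iff, rotated]) (use pos M in auto)
    then have "1 / 2 \<le> F 0 * (16 * sqrt h * sqrt v)" by simp
    also have "sqrt h * sqrt v = increment_variance * (real n)\<^sup>2"
    proof -
      have "sqrt h * sqrt v = sqrt ((increment_variance * (real n)\<^sup>2)\<^sup>2)"
        by (simp add: h_def v_def power2_eq_square power3_eq_cube mult_ac flip: real_sqrt_mult)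
      then show ?thesis using increment_variance_pos by simp
    qed
    then have "F 0 * (16 * sqrt h * sqrt v) = F 0 * (16 * (increment_variance * (real n)\<^sup>2))" by (simp add: mult.assoc)
    finally have "1 \<le> F 0 * (32 * (increment_variance * (real n)\<^sup>2))" by simp
    moreover have "0 < increment_variance * (real n)\<^sup>2" using increment_variance_pos by (simp add: n_def)
    ultimately show ?thesis by (simp add: field_simps n_def)
  qed
  ultimately show ?thesis
    using that[of "F 0"] by (simp add: eq F_def zero_prod_def)
qed

end

section \<open>Summability of the contact masses\<close>

lemma ennreal_le_double_of_half:
  fixes S A :: ennreal
  assumes "S \<le> A + ennreal (1 / 2) * S" "S < \<top>"
  shows "S \<le> 2 * A"
proof (cases A)
  case (real a)
  obtain s where s: "S = ennreal s" "0 \<le> s" using assms(2) by (cases S) auto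
  have "ennreal s \<le> ennreal a + ennreal (1 / 2) * ennreal s"
    using assms(1) unfolding s(1) \<open>A = ennreal a\<close> .
  also have "ennreal (1 / 2) * ennreal s = ennreal (1 / 2 * s)"
    using s by (intro ennreal_mult[symmetric]) auto
  also have "ennreal a + ennreal (1 / 2 * s) = ennreal (a + 1 / 2 * s)"
    using real s by (intro ennreal_plus[symmetric]) auto
  finally have "ennreal s \<le> ennreal (a + 1 / 2 * s)" .
  then have "s \<le> a + 1 / 2 * s"
    by (rule iffD1[OF ennreal_le_iff, rotated]) (use real s in auto)
  then show ?thesis using s real by (simp flip: ennreal_mult ennreal_numeral)
qed (simp add: ennreal_mult_top)

text \<open>
  The left side sums \<open>F i j\<close> over \<open>i + j + 1 < N\<close>.
\<close>

lemma sum_triangle_le_square: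
  fixes F :: "nat \<Rightarrow> nat \<Rightarrow> ennreal"
  shows "(\<Sum>n<N. \<Sum>j<n. F (n - 1 - j) j) \<le> (\<Sum>i<N. \<Sum>j<N. F i j)"
proof -
  let ?S = "SIGMA n:{..<N}. {..<n}" and ?\<phi> = "\<lambda>(n, j). (n - 1 - j, j)"
  have "(\<Sum>n<N. \<Sum>j<n. F (n - 1 - j) j) = (\<Sum>p\<in>?S. (case_prod F \<circ> ?\<phi>) p)"
    by (subst sum.Sigma) (auto simp: case_prod_unfold)
  also have "\<dots> = sum (case_prod F) (?\<phi> ` ?S)"
    by (rule sum.reindex[symmetric]) (auto simp: inj_on_def)
  also have "\<dots> \<le> sum (case_prod F) ({..<N} \<times> {..<N})"
    by (rule sum_mono2) auto
  also have "\<dots> = (\<Sum>i<N. \<Sum>j<N. F i j)" by (simp add: sum.cartesian_product)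
  finally show ?thesis .
qed

context increment_density
begin

text \<open>
  The weight of all paths from two zeros to a contact at site \<open>n + 1\<close>, weighted by \<open>f\<close> of the height at
  site \<open>n\<close>; the factor \<open>\<epsilon>\<close> of this contact is left out.
\<close>

definition contact_weight :: "real \<Rightarrow> nat \<Rightarrow> (real \<Rightarrow> ennreal) \<Rightarrow> ennreal" where
  "contact_weight \<epsilon> n f = (step \<epsilon> ^^ n) (pin f) (0, 0)"

abbreviation contact_mass :: "real \<Rightarrow> nat \<Rightarrow> ennreal" where
  "contact_mass \<epsilon> n \<equiv> contact_weight \<epsilon> n (\<lambda>_. 1)"

abbreviation return_weight :: "real \<Rightarrow> nat \<Rightarrow> ennreal" where
  "return_weight \<epsilon> k \<equiv> weight_to_end \<epsilon> k (0, 0)"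

lemma contact_weight_mono: "(\<And>x. f x \<le> h x) \<Longrightarrow> contact_weight \<epsilon> n f \<le> contact_weight \<epsilon> n h"
  unfolding contact_weight_def by (intro funpow_step_mono pin_mono)

lemma contact_weight_cmult:
  assumes [measurable]: "f \<in> borel_measurable borel"
  shows "contact_weight \<epsilon> n (\<lambda>x. c * f x) = c * contact_weight \<epsilon> n f"
proof -
  have "pin (\<lambda>x. c * f x) = (\<lambda>p. c * pin f p)" by (auto simp: pin_cmult)
  then show ?thesis by (simp add: contact_weight_def funpow_step_cmult)
qed

lemma contact_weight_add:
  assumes [measurable]: "f \<in> borel_measurable borel" "h \<in> borel_measurable borel"
  shows "contact_weight \<epsilon> n (\<lambda>x. f x + h x) = contact_weight \<epsilon> n f + contact_weight \<epsilon> n h"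
proof -
  have "pin (\<lambda>x. f x + h x) = (\<lambda>p. pin f p + pin h p)" by (auto simp: pin_add)
  then show ?thesis by (simp add: contact_weight_def funpow_step_add)
qed

lemma contact_weight_le:
  assumes "\<And>x. f x \<le> c"
  shows "contact_weight \<epsilon> n f \<le> c * contact_mass \<epsilon> n"
proof -
  have "contact_weight \<epsilon> n f \<le> contact_weight \<epsilon> n (\<lambda>x. c * 1)"
    using assms by (intro contact_weight_mono) simp
  also have "\<dots> = c * contact_mass \<epsilon> n" by (rule contact_weight_cmult) simp
  finally show ?thesis .
qed

lemma site_integral_g_le:
  "0 \<le> \<epsilon> \<Longrightarrow> (\<integral>\<^sup>+z. ennreal (g (z + c)) \<partial>site_measure \<epsilon>) \<le> ennreal (1 + \<epsilon> * g 0)"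
  by (subst nn_integral_site_measure)
    (auto simp: g_integral_shift g_nonneg ennreal_mult g_le simp flip: ennreal_plus ennreal_mult ennreal_1
      intro!: ennreal_leI mult_left_mono)

lemma step_le:
  assumes "0 \<le> \<epsilon>" "\<And>p. F p \<le> c"
  shows "step \<epsilon> F p \<le> ennreal (1 + \<epsilon> * g 0) * c"
proof -
  obtain x y where p: "p = (x, y)" by (cases p)
  have "step \<epsilon> F p \<le> (\<integral>\<^sup>+z. ennreal (g (z + (x - 2 * y))) * c \<partial>site_measure \<epsilon>)"
    unfolding step_def p prod.case add_diff_eq by (intro nn_integral_mono mult_left_mono assms) simp
  also have "\<dots> = (\<integral>\<^sup>+z. ennreal (g (z + (x - 2 * y))) \<partial>site_measure \<epsilon>) * c"
    by (rule nn_integral_multc) measurable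
  also have "\<dots> \<le> ennreal (1 + \<epsilon> * g 0) * c"
    using assms(1) by (intro mult_right_mono site_integral_g_le) auto
  finally show ?thesis .
qed

lemma funpow_step_le:
  assumes "0 \<le> \<epsilon>" "\<And>p. F p \<le> c"
  shows "(step \<epsilon> ^^ n) F p \<le> ennreal (1 + \<epsilon> * g 0) ^ n * c"
proof (induction n arbitrary: p)
  case (Suc n)
  then show ?case using step_le[OF assms(1), of "(step \<epsilon> ^^ n) F" "ennreal (1 + \<epsilon> * g 0) ^ n * c" p]
    by (simp add: mult.assoc)
qed (simp add: assms)

lemma contact_mass_finite: "0 \<le> \<epsilon> \<Longrightarrow> contact_mass \<epsilon> n < \<top>"
proof -
  assume \<epsilon>: "0 \<le> \<epsilon>"
  have "pin (\<lambda>_. 1) p \<le> ennreal (g 0)" for p by (cases p) (simp add: pin_def ennreal_leI g_le)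
  then have "(step \<epsilon> ^^ n) (pin (\<lambda>_. 1)) (0, 0) \<le> ennreal (1 + \<epsilon> * g 0) ^ n * ennreal (g 0)"
    by (rule funpow_step_le[OF \<epsilon>])
  then show ?thesis
    unfolding contact_weight_def
    using \<epsilon> g_0_pos by (elim le_less_trans) (simp add: ennreal_mult_less_top power_less_top_ennreal)
qed

lemma return_weight_le_contact_mass: "return_weight \<epsilon> k \<le> ennreal (g 0) * contact_mass \<epsilon> k"
  unfolding weight_to_end_def contact_weight_def[symmetric]
  by (intro contact_weight_le ennreal_leI g_le)

text \<open>
  Decomposition at the last contact before site \<open>n + 1\<close>, which lies \<open>j + 1\<close> sites earlier. From there the
  field runs without pinning, with a slope that is minus the height \<open>y\<close> before that contact.
\<close>

lemma contact_mass_expand: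
  assumes "0 \<le> \<epsilon>"
  shows "contact_mass \<epsilon> n = hitting_density n 0 +
    (\<Sum>j<n. ennreal \<epsilon> * contact_weight \<epsilon> (n - 1 - j) (\<lambda>y. hitting_density j (- (real j + 1) * y)))"
proof -
  have "contact_mass \<epsilon> n = (step 0 ^^ n) (pin (\<lambda>_. 1)) (0, 0) +
    (\<Sum>j<n. ennreal (\<epsilon> - 0) * (step \<epsilon> ^^ (n - 1 - j)) (pin (\<lambda>y. (step 0 ^^ j) (pin (\<lambda>_. 1)) (y, 0))) (0, 0))"
    unfolding contact_weight_def by (rule expand_last_pin) (use assms in auto)
  moreover have "(\<lambda>y. (step 0 ^^ j) (pin (\<lambda>_. 1)) (y, 0)) = (\<lambda>y. hitting_density j (- (real j + 1) * y))" for j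
    unfolding free_return_eq by (auto simp: fun_eq_iff algebra_simps)
  ultimately show ?thesis using free_return_eq[of n 0 0] by (simp only: contact_weight_def) simp
qed

text \<open>
  In the decomposition at the last contact, bound the hitting density by \<open>s j\<close> for slopes in the window
  \<open>{-R..R}\<close> and by \<open>\<eta> j\<close> otherwise. Since the total weight of the \<open>\<eta> j\<close> is at most \<open>1 / 2\<close>, the large
  slopes contribute at most half of the left side, and this half is absorbed. That the left side is
  finite is needed here, and it is the reason for working with partial sums.
\<close>

lemma sum_contact_mass_le:
  assumes \<epsilon>: "0 \<le> \<epsilon>" and small: "\<And>j y. R < \<bar>y\<bar> \<Longrightarrow> hitting_density j (- (real j + 1) * y) \<le> ennreal (\<eta> j)"
    and \<eta>: "\<And>j. 0 \<le> \<eta> j" "\<And>N. \<epsilon> * (\<Sum>j<N. \<eta> j) \<le> 1 / 2"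
    and s: "\<And>j t. hitting_density j t \<le> ennreal (s j)" "\<And>j. 0 \<le> s j" "\<And>N. (\<Sum>j<N. s j) \<le> C"
  shows "(\<Sum>n<N. contact_mass \<epsilon> n) \<le>
    2 * (ennreal C + ennreal (\<epsilon> * C) * (\<Sum>i<N. contact_weight \<epsilon> i (indicator {-R..R})))"
proof (rule ennreal_le_double_of_half)
  have C: "0 \<le> C" using s(3)[of 0] by simp
  let ?S = "\<Sum>n<N. contact_mass \<epsilon> n" and ?I = "\<lambda>i. contact_weight \<epsilon> i (indicator {-R..R})"
  show "?S < \<top>" using contact_mass_finite[OF \<epsilon>] by (simp add: less_top)
  have term_le: "contact_weight \<epsilon> i (\<lambda>y. hitting_density j (- (real j + 1) * y)) \<le>
      ennreal (s j) * ?I i + ennreal (\<eta> j) * contact_mass \<epsilon> i" for i j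
  proof -
    have "contact_weight \<epsilon> i (\<lambda>y. hitting_density j (- (real j + 1) * y)) \<le>
        contact_weight \<epsilon> i (\<lambda>y. ennreal (s j) * indicator {-R..R} y + ennreal (\<eta> j) * 1)"
    proof (rule contact_weight_mono)
      fix y show "hitting_density j (- (real j + 1) * y) \<le> ennreal (s j) * indicator {-R..R} y + ennreal (\<eta> j) * 1"
      proof (cases "R < \<bar>y\<bar>")
        case True
        then show ?thesis using small[of y j] by (auto intro: order_trans)
      next
        case False
        then have "y \<in> {-R..R}" by auto
        then show ?thesis using s(1)[of j "- (real j + 1) * y"] by (auto intro: order_trans)
      qed
    qed
    also have "\<dots> = ennreal (s j) * ?I i + ennreal (\<eta> j) * contact_mass \<epsilon> i"
      using contact_weight_add[of "\<lambda>y. ennreal (s j) * indicator {-R..R} y" "\<lambda>y. ennreal (\<eta> j) * 1" \<epsilon> i]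
        contact_weight_cmult[of "indicator {-R..R}" \<epsilon> i "ennreal (s j)"]
        contact_weight_cmult[of "\<lambda>_. 1" \<epsilon> i "ennreal (\<eta> j)"] by simp
    finally show ?thesis .
  qed
  have "?S = (\<Sum>n<N. hitting_density n 0) + (\<Sum>n<N. \<Sum>j<n. ennreal \<epsilon> *
      contact_weight \<epsilon> (n - 1 - j) (\<lambda>y. hitting_density j (- (real j + 1) * y)))"
    by (subst contact_mass_expand[OF \<epsilon>]) (simp add: sum.distrib)
  also have "(\<Sum>n<N. hitting_density n 0) \<le> (\<Sum>n<N. ennreal (s n))" by (intro sum_mono s)
  also have "(\<Sum>n<N. ennreal (s n)) \<le> ennreal C" using s by (simp add: ennreal_leI)
  also have "(\<Sum>n<N. \<Sum>j<n. ennreal \<epsilon> * contact_weight \<epsilon> (n - 1 - j) (\<lambda>y. hitting_density j (- (real j + 1) * y)))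
      \<le> (\<Sum>i<N. \<Sum>j<N. ennreal \<epsilon> * contact_weight \<epsilon> i (\<lambda>y. hitting_density j (- (real j + 1) * y)))"
    by (rule sum_triangle_le_square)
  also have "\<dots> \<le> (\<Sum>i<N. \<Sum>j<N. ennreal \<epsilon> * (ennreal (s j) * ?I i + ennreal (\<eta> j) * contact_mass \<epsilon> i))"
    by (intro sum_mono mult_left_mono term_le) auto
  also have "\<dots> = (ennreal \<epsilon> * (\<Sum>j<N. ennreal (s j))) * (\<Sum>i<N. ?I i) + (ennreal \<epsilon> * (\<Sum>j<N. ennreal (\<eta> j))) * ?S"
    by (simp add: distrib_left sum.distrib sum_distrib_left sum_distrib_right mult_ac)
  also have "\<dots> \<le> ennreal (\<epsilon> * C) * (\<Sum>i<N. ?I i) + ennreal (1 / 2) * ?S"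
  proof (intro add_mono mult_right_mono)
    show "ennreal \<epsilon> * (\<Sum>j<N. ennreal (s j)) \<le> ennreal (\<epsilon> * C)"
      using \<epsilon> s by (simp add: sum_nonneg ennreal_leI mult_left_mono flip: ennreal_mult)
    show "ennreal \<epsilon> * (\<Sum>j<N. ennreal (\<eta> j)) \<le> ennreal (1 / 2)"
      using \<epsilon> \<eta> by (simp only: sum_ennreal sum_nonneg flip: ennreal_mult) (rule ennreal_leI, simp)
  qed auto
  finally show "?S \<le> ennreal C + ennreal (\<epsilon> * C) * (\<Sum>i<N. ?I i) + ennreal (1 / 2) * ?S"
    by (simp add: add_left_mono add.assoc)
qed

definition hitting_bound :: "nat \<Rightarrow> real" where
  "hitting_bound j = hitting_constant * (real j + 1) powr (- 3 / 2)"

lemma hitting_bound_nonneg: "0 \<le> hitting_bound j"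
  using hitting_constant_pos by (simp add: hitting_bound_def)

lemma hitting_density_le_bound: "hitting_density j t \<le> ennreal (hitting_bound j)"
  using hitting_density_le by (simp add: hitting_bound_def)

lemma summable_hitting_bound: "summable hitting_bound"
proof -
  have "summable (\<lambda>j. real (Suc j) powr (- 3 / 2))"
    by (subst summable_Suc_iff) (simp add: summable_real_powr_iff)
  then show ?thesis unfolding hitting_bound_def by (intro summable_mult) (simp add: add.commute)
qed

lemma sum_hitting_bound_le: "(\<Sum>j<N. hitting_bound j) \<le> suminf hitting_bound"
  using summable_hitting_bound hitting_bound_nonneg by (intro sum_le_suminf) auto

text \<open>
  By time reversal the slope at a contact has a density which is largest at \<open>0\<close>, where its value is a
  return weight.
\<close>

lemma contact_weight_window_le:
  assumes "0 \<le> \<epsilon>" "0 \<le> R"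
  shows "contact_weight \<epsilon> (Suc k) (indicator {-R..R}) \<le> return_weight \<epsilon> k * ennreal (2 * R + \<epsilon>)"
proof -
  have "contact_weight \<epsilon> (Suc k) (indicator {-R..R}) =
      (\<integral>\<^sup>+x. indicator {-R..R} x * weight_to_end \<epsilon> k (0, x) \<partial>site_measure \<epsilon>)"
    unfolding contact_weight_def by (rule contact_time_reversal) simp
  also have "\<dots> \<le> (\<integral>\<^sup>+x. return_weight \<epsilon> k * indicator {-R..R} x \<partial>site_measure \<epsilon>)"
    using assms by (intro nn_integral_mono) (auto simp: indicator_def weight_to_end_le)
  also have "\<dots> = return_weight \<epsilon> k * ennreal (2 * R + \<epsilon>)"
    using assms by (subst nn_integral_cmult) (auto simp: emeasure_site_measure add.commute simp flip: ennreal_plus)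
  finally show ?thesis .
qed

text \<open>
  The hitting density at a point of modulus at least \<open>(j + 1) * R\<close> is at most \<open>1 / (2 * (j + 1) * R)\<close>, and
  also at most \<open>hitting_bound j\<close>. The second bound makes the sum over large \<open>j\<close> small, and then a large
  \<open>R\<close> makes the sum over the remaining \<open>j\<close> small.
\<close>

lemma suminf_contact_mass_finite:
  assumes \<epsilon>: "0 \<le> \<epsilon>" and ret: "(\<Sum>k. return_weight \<epsilon> k) < \<top>"
  shows "(\<Sum>n. contact_mass \<epsilon> n) < \<top>"
proof -
  have "0 < 1 / (4 * (\<epsilon> + 1))" using \<epsilon> by simp
  then obtain K where "\<And>m n. K \<le> m \<Longrightarrow> norm (sum hitting_bound {m..<n}) < 1 / (4 * (\<epsilon> + 1))"
    using summable_hitting_bound unfolding summable_Cauchy by blast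
  then have K: "sum hitting_bound {K..<n} < 1 / (4 * (\<epsilon> + 1))" for n
    using abs_le_D1 by (force simp: sum_nonneg hitting_bound_nonneg)
  \<comment> \<open>With this R the indices below K contribute at most K / (2 * R) to the sum of the \<eta> j.\<close>
  define R where "R = 2 * (real K + 1) * (\<epsilon> + 1)"
  have R: "0 < R" using \<epsilon> by (simp add: R_def)
  define \<eta> where "\<eta> = (\<lambda>j. if j < K then 1 / (2 * R) else hitting_bound j)"
  have "(\<Sum>n<N. contact_mass \<epsilon> n) \<le> 2 * (ennreal (suminf hitting_bound) +
      ennreal (\<epsilon> * suminf hitting_bound) * (\<Sum>i<N. contact_weight \<epsilon> i (indicator {-R..R})))" for N
  proof (rule sum_contact_mass_le[OF \<epsilon>, where \<eta> = \<eta> and s = hitting_bound])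
    fix j and y :: real assume y: "R < \<bar>y\<bar>"
    show "hitting_density j (- (real j + 1) * y) \<le> ennreal (\<eta> j)"
    proof (cases "j < K")
      case True
      have "0 < \<bar>y\<bar>" using R y by linarith
      then have "- (real j + 1) * y \<noteq> 0" by (simp add: add_eq_0_iff)
      then have decay: "hitting_density j (- (real j + 1) * y) \<le> ennreal (1 / (2 * \<bar>- (real j + 1) * y\<bar>))"
        by (rule hitting_density_decay)
      have "R \<le> (real j + 1) * \<bar>y\<bar>" using y mult_right_mono[of 1 "real j + 1" "\<bar>y\<bar>"] by simp
      then have "R \<le> \<bar>- (real j + 1) * y\<bar>" by (simp only: abs_mult)
      then have "1 / (2 * \<bar>- (real j + 1) * y\<bar>) \<le> 1 / (2 * R)"
        using R by (intro frac_le) auto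
      then show ?thesis using True decay by (auto simp: \<eta>_def intro: order_trans ennreal_leI)
    next
      case False
      then show ?thesis using hitting_density_le_bound[of j] by (simp add: \<eta>_def)
    qed
  next
    fix N
    have "(\<Sum>j<N. \<eta> j) \<le> (\<Sum>j\<in>{..<K} \<union> {K..<N}. \<eta> j)"
      using R by (intro sum_mono2) (auto simp: \<eta>_def hitting_bound_nonneg)
    also have "\<dots> = (\<Sum>j<K. \<eta> j) + (\<Sum>j\<in>{K..<N}. \<eta> j)" by (rule sum.union_disjoint) auto
    also have "(\<Sum>j<K. \<eta> j) = real K / (2 * R)" by (simp add: \<eta>_def)
    also have "(\<Sum>j\<in>{K..<N}. \<eta> j) = sum hitting_bound {K..<N}" by (intro sum.cong) (auto simp: \<eta>_def)
    also have "\<dots> \<le> 1 / (4 * (\<epsilon> + 1))" using K[of N] by simp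
    also have "real K / (2 * R) = real K / (real K + 1) * (1 / (4 * (\<epsilon> + 1)))"
      by (simp add: R_def) (simp add: algebra_simps)
    also have "\<dots> \<le> 1 * (1 / (4 * (\<epsilon> + 1)))" using \<epsilon> by (intro mult_right_mono) auto
    finally have "\<epsilon> * (\<Sum>j<N. \<eta> j) \<le> \<epsilon> * (1 * (1 / (4 * (\<epsilon> + 1))) + 1 / (4 * (\<epsilon> + 1)))"
      using \<epsilon> by (intro mult_left_mono) auto
    also have "\<dots> \<le> 1 / 2" using \<epsilon> by (simp add: field_simps)
    finally show "\<epsilon> * (\<Sum>j<N. \<eta> j) \<le> 1 / 2" .
  qed (use R sum_hitting_bound_le hitting_bound_nonneg hitting_density_le_bound in \<open>auto simp: \<eta>_def\<close>)
  also have "\<dots> N \<le> 2 * (ennreal (suminf hitting_bound) + ennreal (\<epsilon> * suminf hitting_bound) *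
      (ennreal (g 0) + (\<Sum>k. return_weight \<epsilon> k) * ennreal (2 * R + \<epsilon>)))" for N
  proof (intro mult_left_mono add_left_mono)
    have "(\<Sum>i<N. contact_weight \<epsilon> i (indicator {-R..R})) \<le> (\<Sum>i<Suc N. contact_weight \<epsilon> i (indicator {-R..R}))"
      by (intro sum_mono2) auto
    also have "\<dots> = contact_weight \<epsilon> 0 (indicator {-R..R}) + (\<Sum>i<N. contact_weight \<epsilon> (Suc i) (indicator {-R..R}))"
      by (rule sum.lessThan_Suc_shift)
    also have "\<dots> \<le> ennreal (g 0) + (\<Sum>i<N. return_weight \<epsilon> i * ennreal (2 * R + \<epsilon>))"
      using \<epsilon> R by (intro add_mono sum_mono contact_weight_window_le) (auto simp: contact_weight_def pin_def indicator_def)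
    also have "\<dots> \<le> ennreal (g 0) + (\<Sum>k. return_weight \<epsilon> k) * ennreal (2 * R + \<epsilon>)"
      unfolding sum_distrib_right[symmetric] by (intro add_left_mono mult_right_mono sum_le_suminf) auto
    finally show "(\<Sum>i<N. contact_weight \<epsilon> i (indicator {-R..R})) \<le>
      ennreal (g 0) + (\<Sum>k. return_weight \<epsilon> k) * ennreal (2 * R + \<epsilon>)" .
  qed auto
  finally have "(\<Sum>n. contact_mass \<epsilon> n) \<le> 2 * (ennreal (suminf hitting_bound) + ennreal (\<epsilon> * suminf hitting_bound) *
      (ennreal (g 0) + (\<Sum>k. return_weight \<epsilon> k) * ennreal (2 * R + \<epsilon>)))"
    by (intro suminf_le_const) auto
  also have "\<dots> < \<top>" using ret by (simp add: ennreal_mult_less_top)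
  finally show ?thesis .
qed

text \<open>
  For small \<open>\<epsilon>\<close> the whole expansion can be absorbed. The empty window \<open>R = -1\<close> in \<open>sum_contact_mass_le\<close>
  expresses this.
\<close>

lemma return_weight_bounded_weak_pinning:
  assumes "0 < \<epsilon>'"
  obtains \<epsilon> B where "0 < \<epsilon>" "\<epsilon> \<le> \<epsilon>'" "0 \<le> B" "\<And>k. return_weight \<epsilon> k \<le> ennreal B"
proof -
  define C where "C = suminf hitting_bound"
  have C: "0 \<le> C" using sum_hitting_bound_le[of 0] by (simp add: C_def)
  define \<epsilon> where "\<epsilon> = min \<epsilon>' (1 / (2 * (C + 1)))"
  have \<epsilon>: "0 < \<epsilon>" "\<epsilon> \<le> \<epsilon>'" using assms C by (auto simp: \<epsilon>_def)
  have small: "\<epsilon> * C \<le> 1 / 2"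
  proof -
    have "\<epsilon> * C \<le> 1 / (2 * (C + 1)) * C" using C by (intro mult_right_mono) (auto simp: \<epsilon>_def)
    also have "\<dots> \<le> 1 / 2" using C by (simp add: field_simps)
    finally show ?thesis .
  qed
  have "(indicator {- (- 1)..- 1} :: real \<Rightarrow> ennreal) = (\<lambda>_. 0)" by (auto simp: indicator_def)
  then have "contact_weight \<epsilon> i (indicator {- (- 1)..- 1}) = 0" for i
    using contact_weight_cmult[of "\<lambda>_. 1" \<epsilon> i 0] by simp
  moreover have "(\<Sum>n<N. contact_mass \<epsilon> n) \<le> 2 * (ennreal C + ennreal (\<epsilon> * C) *
      (\<Sum>i<N. contact_weight \<epsilon> i (indicator {- (- 1)..- 1})))" for N
  proof (rule sum_contact_mass_le[where \<eta> = hitting_bound and s = hitting_bound])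
    fix N
    have "\<epsilon> * (\<Sum>j<N. hitting_bound j) \<le> \<epsilon> * C"
      using \<epsilon> sum_hitting_bound_le by (intro mult_left_mono) (auto simp: C_def)
    with small show "\<epsilon> * (\<Sum>j<N. hitting_bound j) \<le> 1 / 2" by linarith
  qed (use \<epsilon> hitting_density_le_bound hitting_bound_nonneg sum_hitting_bound_le in \<open>auto simp: C_def\<close>)
  ultimately have sum_le: "(\<Sum>n<N. contact_mass \<epsilon> n) \<le> 2 * ennreal C" for N by simp
  have "return_weight \<epsilon> k \<le> ennreal (g 0 * (2 * C))" for k
  proof -
    have "return_weight \<epsilon> k \<le> ennreal (g 0) * contact_mass \<epsilon> k" by (rule return_weight_le_contact_mass)
    also have "contact_mass \<epsilon> k \<le> (\<Sum>n<Suc k. contact_mass \<epsilon> n)" by simp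
    also have "\<dots> \<le> 2 * ennreal C" by (rule sum_le)
    finally show ?thesis using C g_0_pos by (simp add: mult_left_mono ennreal_mult)
  qed
  then show ?thesis using that[of \<epsilon> "g 0 * (2 * C)"] \<epsilon> C g_0_pos by simp
qed

end

section \<open>Quadratic decay of the return weights\<close>

lemma suminf_ennreal_tail:
  fixes f :: "nat \<Rightarrow> ennreal"
  assumes "suminf f < \<top>" "0 < h"
  obtains P where "1 \<le> P" "\<And>Q n. P \<le> Q \<Longrightarrow> (\<Sum>i\<in>{Q..<n}. f i) \<le> ennreal h"
proof -
  have fin: "f i < \<top>" for i
    using assms(1) sum_le_suminf[of f "{i}"] by (auto intro: le_less_trans)
  define r where "r = (\<lambda>i. enn2real (f i))"
  have f: "f i = ennreal (r i)" "0 \<le> r i" for i using fin[of i] by (auto simp: r_def)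
  have "summable r"
  proof (rule summable_suminf_not_top)
    have "f = (\<lambda>i. ennreal (r i))" using f by auto
    then show "(\<Sum>i. ennreal (r i)) \<noteq> \<top>" using assms(1) by auto
  qed (rule f)
  then obtain P where "\<And>m n. P \<le> m \<Longrightarrow> norm (sum r {m..<n}) < h"
    using assms(2) unfolding summable_Cauchy by blast
  then have "sum r {Q..<n} \<le> h" if "P \<le> Q" for Q n
    using that by (auto intro: less_imp_le abs_le_D1)
  then have "(\<Sum>i\<in>{Q..<n}. f i) \<le> ennreal h" if "P \<le> Q" for Q n
    using that by (simp add: f ennreal_leI)
  then show ?thesis using that[of "Suc P"] by auto
qed

lemma nn_integral_shift:
  fixes f :: "real \<Rightarrow> ennreal"
  assumes [measurable]: "f \<in> borel_measurable borel"
  shows "(\<integral>\<^sup>+x. f (x + c) \<partial>lborel) = (\<integral>\<^sup>+x. f x \<partial>lborel)"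
  using nn_integral_real_affine[of f 1 c] by (simp add: add.commute)

context increment_density
begin

text \<open>
  The weight of the paths counted by \<open>return_weight \<epsilon> k\<close> that have a contact at site \<open>i + 1\<close>; the factor
  \<open>\<epsilon>\<close> of this contact is left out.
\<close>

definition contact_split_weight :: "real \<Rightarrow> nat \<Rightarrow> nat \<Rightarrow> ennreal" where
  "contact_split_weight \<epsilon> k i = contact_weight \<epsilon> i (\<lambda>x. weight_to_end \<epsilon> (k - 1 - i) (x, 0))"

text \<open>
  The weight to the right of the contact is largest for slope \<open>0\<close>.
\<close>

lemma contact_split_weight_le_left:
  assumes "0 \<le> \<epsilon>"
  shows "contact_split_weight \<epsilon> k i \<le> return_weight \<epsilon> (k - 1 - i) * contact_mass \<epsilon> i"
  unfolding contact_split_weight_def by (intro contact_weight_le weight_to_end_le assms)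

lemma weight_to_end_slope_integral_le:
  assumes "0 \<le> \<epsilon>"
  shows "(\<integral>\<^sup>+x. weight_to_end \<epsilon> (Suc m) (x, 0) \<partial>site_measure \<epsilon>) \<le> ennreal (1 + \<epsilon> * g 0) * contact_mass \<epsilon> (Suc m)"
proof -
  interpret pair_sigma_finite "site_measure \<epsilon>" "site_measure \<epsilon>"
    by (intro pair_sigma_finite.intro sigma_finite_site_measure)
  let ?m = "site_measure \<epsilon>"
  have "(\<integral>\<^sup>+x. weight_to_end \<epsilon> (Suc m) (x, 0) \<partial>?m) =
      (\<integral>\<^sup>+x. \<integral>\<^sup>+z. ennreal (g (z + x)) * weight_to_end \<epsilon> m (0, z) \<partial>?m \<partial>?m)"
    by (simp add: weight_to_end_Suc step_def)
  also have "\<dots> = (\<integral>\<^sup>+z. \<integral>\<^sup>+x. ennreal (g (z + x)) * weight_to_end \<epsilon> m (0, z) \<partial>?m \<partial>?m)"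
    by (rule Fubini') measurable
  also have "\<dots> = (\<integral>\<^sup>+z. (\<integral>\<^sup>+x. ennreal (g (x + z)) \<partial>?m) * weight_to_end \<epsilon> m (0, z) \<partial>?m)"
    by (intro nn_integral_cong) (simp add: nn_integral_multc add.commute)
  also have "\<dots> \<le> (\<integral>\<^sup>+z. ennreal (1 + \<epsilon> * g 0) * weight_to_end \<epsilon> m (0, z) \<partial>?m)"
    by (intro nn_integral_mono mult_right_mono site_integral_g_le assms) simp
  also have "\<dots> = ennreal (1 + \<epsilon> * g 0) * (\<integral>\<^sup>+z. 1 * weight_to_end \<epsilon> m (0, z) \<partial>?m)"
    by (subst nn_integral_cmult) simp_all
  also have "(\<integral>\<^sup>+z. 1 * weight_to_end \<epsilon> m (0, z) \<partial>?m) = contact_mass \<epsilon> (Suc m)"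
    unfolding contact_weight_def by (rule contact_time_reversal[symmetric]) simp
  finally show ?thesis .
qed

text \<open>
  The weight to the left of the contact, as a function of the height before it, is largest at \<open>0\<close>. What
  remains is the weight to the right with a free height before the contact. Integrating this height
  costs a factor \<open>1 + \<epsilon> * g 0\<close> and leaves, by time reversal, a contact mass.
\<close>

lemma contact_split_weight_le_right:
  assumes "0 \<le> \<epsilon>" "1 \<le> i" "i + 2 \<le> k"
  shows "contact_split_weight \<epsilon> k i \<le>
    return_weight \<epsilon> (i - 1) * (ennreal (1 + \<epsilon> * g 0) * contact_mass \<epsilon> (k - 1 - i))"
proof -
  obtain i' where i: "i = Suc i'" using assms by (cases i) auto
  obtain m where m: "k - 1 - i = Suc m" using assms by (cases "k - 1 - i") auto
  let ?m = "site_measure \<epsilon>"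
  have "contact_split_weight \<epsilon> k i =
      (\<integral>\<^sup>+x. weight_to_end \<epsilon> (Suc m) (x, 0) * weight_to_end \<epsilon> i' (0, x) \<partial>?m)"
    unfolding contact_split_weight_def contact_weight_def m unfolding i
    by (rule contact_time_reversal) measurable
  also have "\<dots> \<le> (\<integral>\<^sup>+x. return_weight \<epsilon> i' * weight_to_end \<epsilon> (Suc m) (x, 0) \<partial>?m)"
    by (subst mult.commute, intro nn_integral_mono mult_right_mono weight_to_end_le assms) simp
  also have "\<dots> = return_weight \<epsilon> i' * (\<integral>\<^sup>+x. weight_to_end \<epsilon> (Suc m) (x, 0) \<partial>?m)"
    by (rule nn_integral_cmult) measurable
  also have "\<dots> \<le> return_weight \<epsilon> i' * (ennreal (1 + \<epsilon> * g 0) * contact_mass \<epsilon> (Suc m))"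
    by (intro mult_left_mono weight_to_end_slope_integral_le assms) simp
  finally show ?thesis unfolding m unfolding i by simp
qed

text \<open>
  One of the two pieces of a path that is cut at site \<open>i + 1\<close> has length at least \<open>k / 2\<close>. Its return weight
  is at most \<open>4 * D / (k + 2)\<^sup>2\<close>, and the contact masses of the other piece have sum at most \<open>h\<close>. Only
  return weights below \<open>k\<close> enter, so that the lemma can be used in an induction on \<open>k\<close>.
\<close>

lemma sum_contact_split_weight_le:
  assumes \<epsilon>: "0 \<le> \<epsilon>" and P: "1 \<le> P" and D: "0 \<le> D"
    and ret: "\<And>m. m < k \<Longrightarrow> return_weight \<epsilon> m \<le> ennreal (D / (real m + 2)\<^sup>2)"
    and tail: "\<And>n. (\<Sum>i\<in>{P..<n}. contact_mass \<epsilon> i) \<le> ennreal h" and h: "0 \<le> h"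
  shows "(\<Sum>i\<in>{P..<k - P}. contact_split_weight \<epsilon> k i) \<le>
    ennreal (8 * (1 + \<epsilon> * g 0) * h * D / (real k + 2)\<^sup>2)"
proof -
  define c where "c = 4 * D / (real k + 2)\<^sup>2"
  define b where "b = 1 + \<epsilon> * g 0"
  have cb: "0 \<le> c" "1 \<le> b" using D \<epsilon> g_0_pos by (auto simp: c_def b_def)
  have ret_le: "return_weight \<epsilon> m \<le> ennreal c" if "m < k" "real k + 2 \<le> 2 * (real m + 2)" for m
  proof -
    have "(real k + 2)\<^sup>2 \<le> (2 * (real m + 2))\<^sup>2" using that by (intro power_mono) auto
    then have "(real k + 2)\<^sup>2 / 4 \<le> (real m + 2)\<^sup>2" unfolding power_mult_distrib by simp
    then have "D / (real m + 2)\<^sup>2 \<le> D / ((real k + 2)\<^sup>2 / 4)"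
      using D by (intro divide_left_mono) (auto intro!: mult_pos_pos)
    also have "\<dots> = c" by (simp add: c_def)
    finally show ?thesis using ret[OF that(1)] by (auto intro: order_trans ennreal_leI)
  qed
  have term_le: "contact_split_weight \<epsilon> k i \<le>
      ennreal c * ennreal b * (contact_mass \<epsilon> i + contact_mass \<epsilon> (k - 1 - i))" if i: "i \<in> {P..<k - P}" for i
  proof (cases "2 * i \<le> k")
    case True
    have "contact_split_weight \<epsilon> k i \<le> return_weight \<epsilon> (k - 1 - i) * contact_mass \<epsilon> i"
      by (rule contact_split_weight_le_left[OF \<epsilon>])
    also have "\<dots> \<le> ennreal c * 1 * (contact_mass \<epsilon> i + contact_mass \<epsilon> (k - 1 - i))"
      unfolding mult_1_right using True i P
      by (intro mult_mono ret_le) (auto simp: of_nat_diff)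
    also have "\<dots> \<le> ennreal c * ennreal b * (contact_mass \<epsilon> i + contact_mass \<epsilon> (k - 1 - i))"
      using cb by (intro mult_mono) (auto simp flip: ennreal_1 intro: ennreal_leI)
    finally show ?thesis .
  next
    case False
    have "contact_split_weight \<epsilon> k i \<le>
        return_weight \<epsilon> (i - 1) * (ennreal b * contact_mass \<epsilon> (k - 1 - i))"
      unfolding b_def using i P by (intro contact_split_weight_le_right[OF \<epsilon>]) auto
    also have "\<dots> \<le> ennreal c * (ennreal b * (contact_mass \<epsilon> i + contact_mass \<epsilon> (k - 1 - i)))"
      using False i P by (intro mult_mono ret_le) (auto simp: of_nat_diff)
    finally show ?thesis by (simp add: mult.assoc)
  qed
  have refl_sum: "(\<Sum>i\<in>{P..<k - P}. contact_mass \<epsilon> (k - 1 - i)) = (\<Sum>i\<in>{P..<k - P}. contact_mass \<epsilon> i)"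
    by (rule sum.reindex_bij_witness[of _ "\<lambda>i. k - 1 - i" "\<lambda>i. k - 1 - i"]) auto
  have "(\<Sum>i\<in>{P..<k - P}. contact_split_weight \<epsilon> k i) \<le>
      (\<Sum>i\<in>{P..<k - P}. ennreal c * ennreal b * (contact_mass \<epsilon> i + contact_mass \<epsilon> (k - 1 - i)))"
    by (intro sum_mono term_le)
  also have "\<dots> = ennreal c * ennreal b * ((\<Sum>i\<in>{P..<k - P}. contact_mass \<epsilon> i) + (\<Sum>i\<in>{P..<k - P}. contact_mass \<epsilon> i))"
    by (simp only: sum_distrib_left[symmetric] sum.distrib refl_sum)
  also have "\<dots> \<le> ennreal c * ennreal b * (ennreal h + ennreal h)"
    by (intro mult_left_mono add_mono tail) auto
  also have "\<dots> = ennreal (c * b * (h + h))"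
    using cb h by (subst ennreal_plus[symmetric], simp, simp, subst ennreal_mult[symmetric], simp, simp,
      subst ennreal_mult[symmetric]) auto
  also have "c * b * (h + h) = 8 * (1 + \<epsilon> * g 0) * h * D / (real k + 2)\<^sup>2"
    by (simp add: c_def b_def)
  finally show ?thesis .
qed

text \<open>
  By translation invariance, the transition density of two consecutive heights over \<open>q + 2\<close> steps without
  pinning is a shifted copy of \<open>weight_to_end 0 q\<close>, so it is at most the return weight.
\<close>

lemma funpow_free_step_le:
  assumes [measurable]: "pair_measurable F"
  shows "(step 0 ^^ (q + 2)) F (x, y) \<le>
    ennreal (free_return_constant / (real q + 2)\<^sup>2) * (\<integral>\<^sup>+x. \<integral>\<^sup>+y. F (x, y) \<partial>lborel \<partial>lborel)"
proof -
  obtain a b where ab: "(step 0 ^^ (q + 2)) F (0 + x, 0 + y) = (step 0 ^^ (q + 2)) (\<lambda>(z, w). F (z + a, w + b)) (0, 0)"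
    using free_step_translate[of "q + 2" x y] assms by blast
  obtain m where m: "weight_to_end 0 q (0, 0) = ennreal m" "m \<le> free_return_constant / (real q + 2)\<^sup>2"
    using free_weight_bounds[of q] by metis
  have "(step 0 ^^ (q + 2)) F (x, y) = (step 0 ^^ Suc (Suc q)) (\<lambda>(z, w). F (z + a, w + b)) (0, 0)"
    using ab by simp
  also have "\<dots> = (\<integral>\<^sup>+x. \<integral>\<^sup>+y. F (x + a, y + b) * weight_to_end 0 q (y, x) \<partial>lborel \<partial>lborel)"
    by (subst time_reversal) auto
  also have "\<dots> \<le> (\<integral>\<^sup>+x. \<integral>\<^sup>+y. F (x + a, y + b) * ennreal m \<partial>lborel \<partial>lborel)"
    unfolding m(1)[symmetric] by (intro nn_integral_mono mult_left_mono weight_to_end_le) auto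
  also have "\<dots> = ennreal m * (\<integral>\<^sup>+x. \<integral>\<^sup>+y. F (x + a, y + b) \<partial>lborel \<partial>lborel)"
    by (simp add: nn_integral_cmult mult.commute[of _ "ennreal m"])
  also have "(\<integral>\<^sup>+x. \<integral>\<^sup>+y. F (x + a, y + b) \<partial>lborel \<partial>lborel) = (\<integral>\<^sup>+x. \<integral>\<^sup>+y. F (x + a, y) \<partial>lborel \<partial>lborel)"
    by (intro nn_integral_cong nn_integral_shift) measurable
  also have "\<dots> = (\<integral>\<^sup>+x. \<integral>\<^sup>+y. F (x, y) \<partial>lborel \<partial>lborel)"
    by (rule nn_integral_shift) measurable
  finally show ?thesis using m(2) by (elim order_trans) (intro mult_right_mono ennreal_leI, auto)
qed

lemma weight_to_end_integral_finite:
  assumes \<epsilon>: "0 \<le> \<epsilon>"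
  shows "(\<integral>\<^sup>+x. \<integral>\<^sup>+y. weight_to_end \<epsilon> k (x, y) \<partial>lborel \<partial>lborel) < \<top>"
proof -
  let ?m = "site_measure \<epsilon>" and ?b = "ennreal (1 + \<epsilon> * g 0)"
  interpret pair_sigma_finite "site_measure \<epsilon>" "site_measure \<epsilon>"
    by (intro pair_sigma_finite.intro sigma_finite_site_measure)
  have contract: "(\<integral>\<^sup>+x. \<integral>\<^sup>+y. ennreal (g (x - 2 * y + c y)) * f y \<partial>?m \<partial>?m) \<le> ?b * (\<integral>\<^sup>+y. f y \<partial>?m)"
    if [measurable]: "f \<in> borel_measurable borel" "c \<in> borel_measurable borel" for f c
  proof -
    have "(\<integral>\<^sup>+x. \<integral>\<^sup>+y. ennreal (g (x - 2 * y + c y)) * f y \<partial>?m \<partial>?m) =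
        (\<integral>\<^sup>+y. \<integral>\<^sup>+x. ennreal (g (x - 2 * y + c y)) * f y \<partial>?m \<partial>?m)"
      by (rule Fubini') measurable
    also have "\<dots> = (\<integral>\<^sup>+y. (\<integral>\<^sup>+x. ennreal (g (x + (c y - 2 * y))) \<partial>?m) * f y \<partial>?m)"
      by (intro nn_integral_cong) (simp add: nn_integral_multc add_diff_eq diff_add_eq)
    also have "\<dots> \<le> (\<integral>\<^sup>+y. ?b * f y \<partial>?m)"
      by (intro nn_integral_mono mult_right_mono site_integral_g_le \<epsilon>) simp
    also have "\<dots> = ?b * (\<integral>\<^sup>+y. f y \<partial>?m)" by (rule nn_integral_cmult) measurable
    finally show ?thesis .
  qed
  have fin: "(\<integral>\<^sup>+x. \<integral>\<^sup>+y. weight_to_end \<epsilon> k (x, y) \<partial>?m \<partial>?m) < \<top>"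
  proof (induction k)
    case 0
    have "(\<integral>\<^sup>+x. \<integral>\<^sup>+y. weight_to_end \<epsilon> 0 (x, y) \<partial>?m \<partial>?m) \<le> ?b * (\<integral>\<^sup>+y. ennreal (g y) \<partial>?m)"
      using contract[of "\<lambda>y. ennreal (g y)" "\<lambda>_. 0"] by (simp add: weight_to_end_def pin_def)
    also have "\<dots> \<le> ?b * ?b" using site_integral_g_le[OF \<epsilon>, of 0] by (intro mult_left_mono) auto
    also have "\<dots> < \<top>" by (simp add: ennreal_mult_less_top)
    finally show ?case .
  next
    case (Suc k)
    have "(\<integral>\<^sup>+x. \<integral>\<^sup>+y. weight_to_end \<epsilon> (Suc k) (x, y) \<partial>?m \<partial>?m) =
        (\<integral>\<^sup>+x. \<integral>\<^sup>+y. \<integral>\<^sup>+z. ennreal (g (z + x - 2 * y)) * weight_to_end \<epsilon> k (y, z) \<partial>?m \<partial>?m \<partial>?m)"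
      by (simp add: weight_to_end_Suc step_def)
    also have "\<dots> = (\<integral>\<^sup>+x. \<integral>\<^sup>+z. \<integral>\<^sup>+y. ennreal (g (z + x - 2 * y)) * weight_to_end \<epsilon> k (y, z) \<partial>?m \<partial>?m \<partial>?m)"
      by (intro nn_integral_cong Fubini') measurable
    also have "\<dots> = (\<integral>\<^sup>+z. \<integral>\<^sup>+x. \<integral>\<^sup>+y. ennreal (g (x - 2 * y + z)) * weight_to_end \<epsilon> k (y, z) \<partial>?m \<partial>?m \<partial>?m)"
    proof -
      have [measurable]: "(\<lambda>(x, z). \<integral>\<^sup>+y. ennreal (g (z + x - 2 * y)) * weight_to_end \<epsilon> k (y, z) \<partial>?m)
          \<in> borel_measurable (?m \<Otimes>\<^sub>M ?m)" by measurable
      have "z + x - 2 * y = x - 2 * y + z" for x y z :: real by simp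
      then show ?thesis by (simp only:) (rule Fubini', measurable)
    qed
    also have "\<dots> \<le> (\<integral>\<^sup>+z. ?b * (\<integral>\<^sup>+y. weight_to_end \<epsilon> k (y, z) \<partial>?m) \<partial>?m)"
      by (intro nn_integral_mono contract) measurable
    also have "\<dots> = ?b * (\<integral>\<^sup>+z. \<integral>\<^sup>+y. weight_to_end \<epsilon> k (y, z) \<partial>?m \<partial>?m)"
      by (rule nn_integral_cmult) measurable
    also have "(\<integral>\<^sup>+z. \<integral>\<^sup>+y. weight_to_end \<epsilon> k (y, z) \<partial>?m \<partial>?m) = (\<integral>\<^sup>+y. \<integral>\<^sup>+z. weight_to_end \<epsilon> k (y, z) \<partial>?m \<partial>?m)"
      by (rule Fubini') measurable
    also have "?b * \<dots> < \<top>" using Suc by (simp add: ennreal_mult_less_top)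
    finally show ?case .
  qed
  have le: "(\<integral>\<^sup>+x. f x \<partial>lborel) \<le> (\<integral>\<^sup>+x. f x \<partial>?m)" if "f \<in> borel_measurable borel" for f
    using that by (simp add: nn_integral_site_measure)
  have "(\<integral>\<^sup>+x. \<integral>\<^sup>+y. weight_to_end \<epsilon> k (x, y) \<partial>lborel \<partial>lborel) \<le>
      (\<integral>\<^sup>+x. \<integral>\<^sup>+y. weight_to_end \<epsilon> k (x, y) \<partial>?m \<partial>lborel)"
    by (intro nn_integral_mono le) measurable
  also have "\<dots> \<le> (\<integral>\<^sup>+x. \<integral>\<^sup>+y. weight_to_end \<epsilon> k (x, y) \<partial>?m \<partial>?m)"
    by (intro le) measurable
  also note fin
  finally show ?thesis .
qed

text \<open>
  The expansion at the last contact is applied to the middle sites only. Without a contact there, the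
  transition density of the middle part is at most of order \<open>1 / q\<^sup>2\<close>, and the two outer parts of fixed
  length \<open>P\<close> contribute a constant.
\<close>

lemma return_weight_expand_middle:
  assumes \<epsilon>: "0 \<le> \<epsilon>" and k: "k = 2 * P + q + 2"
  shows "return_weight \<epsilon> k \<le>
    ennreal (1 + \<epsilon> * g 0) ^ P * (ennreal (free_return_constant / (real q + 2)\<^sup>2) *
      (\<integral>\<^sup>+x. \<integral>\<^sup>+y. weight_to_end \<epsilon> P (x, y) \<partial>lborel \<partial>lborel)) +
    ennreal \<epsilon> * (\<Sum>i\<in>{P..<k - P}. contact_split_weight \<epsilon> k i)"
proof -
  let ?W = "weight_to_end \<epsilon> P" and ?q = "q + 2"
  let ?pin = "\<lambda>j. pin (\<lambda>y. (step 0 ^^ j) ?W (y, 0))"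
  have [measurable]: "pair_measurable (?pin j)" for j by measurable
  have "k = P + (?q + P)" using k by simp
  then have "return_weight \<epsilon> k = (step \<epsilon> ^^ P) ((step \<epsilon> ^^ ?q) ?W) (0, 0)"
    by (simp only: weight_to_end_def funpow_add o_apply)
  also have "(step \<epsilon> ^^ ?q) ?W = (\<lambda>p. (step 0 ^^ ?q) ?W p +
      (\<Sum>j<?q. ennreal \<epsilon> * (step \<epsilon> ^^ (?q - 1 - j)) (?pin j) p))"
    using expand_last_pin[OF weight_to_end_measurable order_refl \<epsilon>, where n = ?q] by auto
  also have "(step \<epsilon> ^^ P) \<dots> (0, 0) = (step \<epsilon> ^^ P) ((step 0 ^^ ?q) ?W) (0, 0) +
      (\<Sum>j<?q. ennreal \<epsilon> * (step \<epsilon> ^^ P) ((step \<epsilon> ^^ (?q - 1 - j)) (?pin j)) (0, 0))"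
    by (subst funpow_step_add, measurable, subst funpow_step_sum) (auto simp: funpow_step_cmult)
  also have "\<dots> \<le> ennreal (1 + \<epsilon> * g 0) ^ P * (ennreal (free_return_constant / (real q + 2)\<^sup>2) *
      (\<integral>\<^sup>+x. \<integral>\<^sup>+y. ?W (x, y) \<partial>lborel \<partial>lborel)) +
      (\<Sum>j<?q. ennreal \<epsilon> * contact_split_weight \<epsilon> k (P + ?q - 1 - j))"
  proof (intro add_mono sum_mono mult_left_mono)
    show "(step \<epsilon> ^^ P) ((step 0 ^^ ?q) ?W) (0, 0) \<le> ennreal (1 + \<epsilon> * g 0) ^ P *
      (ennreal (free_return_constant / (real q + 2)\<^sup>2) * (\<integral>\<^sup>+x. \<integral>\<^sup>+y. ?W (x, y) \<partial>lborel \<partial>lborel))"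
    proof (rule funpow_step_le[OF \<epsilon>])
      fix p :: "real \<times> real"
      show "(step 0 ^^ ?q) ?W p \<le> ennreal (free_return_constant / (real q + 2)\<^sup>2) * (\<integral>\<^sup>+x. \<integral>\<^sup>+y. ?W (x, y) \<partial>lborel \<partial>lborel)"
        using funpow_free_step_le[OF weight_to_end_measurable, of q \<epsilon> P "fst p" "snd p"] by simp
    qed
    fix j assume j: "j \<in> {..<?q}"
    have "(step \<epsilon> ^^ P) ((step \<epsilon> ^^ (?q - 1 - j)) (?pin j)) (0, 0) = (step \<epsilon> ^^ (P + ?q - 1 - j)) (?pin j) (0, 0)"
    proof -
      have "P + ?q - 1 - j = P + (?q - 1 - j)" using j by auto
      then show ?thesis by (simp only: funpow_add o_apply)
    qed
    also have "\<dots> \<le> contact_weight \<epsilon> (P + ?q - 1 - j) (\<lambda>y. weight_to_end \<epsilon> (k - 1 - (P + ?q - 1 - j)) (y, 0))"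
      unfolding contact_weight_def
    proof (intro funpow_step_mono pin_mono)
      fix y
      have "k - 1 - (P + ?q - 1 - j) = j + P" using j k by auto
      then have "weight_to_end \<epsilon> (k - 1 - (P + ?q - 1 - j)) = (step \<epsilon> ^^ j) ?W"
        by (simp add: weight_to_end_def funpow_add)
      then show "(step 0 ^^ j) ?W (y, 0) \<le> weight_to_end \<epsilon> (k - 1 - (P + ?q - 1 - j)) (y, 0)"
        using \<epsilon> by (simp add: funpow_step_mono_pinning)
    qed
    finally show "(step \<epsilon> ^^ P) ((step \<epsilon> ^^ (?q - 1 - j)) (?pin j)) (0, 0) \<le> contact_split_weight \<epsilon> k (P + ?q - 1 - j)"
      by (simp add: contact_split_weight_def)
  qed auto
  also have "(\<Sum>j<?q. ennreal \<epsilon> * contact_split_weight \<epsilon> k (P + ?q - 1 - j)) =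
      (\<Sum>i\<in>{P..<k - P}. ennreal \<epsilon> * contact_split_weight \<epsilon> k i)"
    by (rule sum.reindex_bij_witness[of _ "\<lambda>i. P + ?q - 1 - i" "\<lambda>j. P + ?q - 1 - j"]) (auto simp: k)
  finally show ?thesis by (simp add: sum_distrib_left)
qed

text \<open>
  Choose \<open>P\<close> so large that the contacts in the middle contribute at most half of the bound that is to
  be shown. The induction then closes as soon as \<open>D\<close> is at least twice the constant of the paths
  without contacts in the middle.
\<close>

lemma return_weight_bound:
  assumes \<epsilon>: "0 \<le> \<epsilon>" and fin: "(\<Sum>n. contact_mass \<epsilon> n) < \<top>"
  obtains D where "0 \<le> D" "\<And>k. return_weight \<epsilon> k \<le> ennreal (D / (real k + 2)\<^sup>2)"
proof -
  define b where "b = 1 + \<epsilon> * g 0"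
  have b: "1 \<le> b" using \<epsilon> g_0_pos by (simp add: b_def)
  define h where "h = 1 / (16 * b * (\<epsilon> + 1))"
  have h: "0 < h" using b \<epsilon> by (simp add: h_def)
  obtain P where P: "1 \<le> P" and tail: "\<And>Q n. P \<le> Q \<Longrightarrow> (\<Sum>i\<in>{Q..<n}. contact_mass \<epsilon> i) \<le> ennreal h"
    using suminf_ennreal_tail[OF fin h] by metis
  have "(\<integral>\<^sup>+x. \<integral>\<^sup>+y. weight_to_end \<epsilon> P (x, y) \<partial>lborel \<partial>lborel) < \<top>"
    by (rule weight_to_end_integral_finite[OF \<epsilon>])
  then obtain w where w: "(\<integral>\<^sup>+x. \<integral>\<^sup>+y. weight_to_end \<epsilon> P (x, y) \<partial>lborel \<partial>lborel) = ennreal w" "0 \<le> w"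
    by (cases "\<integral>\<^sup>+x. \<integral>\<^sup>+y. weight_to_end \<epsilon> P (x, y) \<partial>lborel \<partial>lborel") auto
  define r where "r = (\<lambda>k. enn2real (return_weight \<epsilon> k))"
  have r: "return_weight \<epsilon> k = ennreal (r k)" "0 \<le> r k" for k
    using weight_to_end_finite[OF \<epsilon>] by (auto simp: r_def)
  have frc: "0 \<le> free_return_constant" using increment_variance_pos by (simp add: free_return_constant_def)
  define C where "C = b ^ P * free_return_constant * w * (real P + 2)\<^sup>2"
  have C: "0 \<le> C" using b frc w by (simp add: C_def)
  define D where "D = 2 * C + (\<Sum>k<2 * P + 2. (real k + 2)\<^sup>2 * r k)"
  have D_sum: "0 \<le> (\<Sum>k<2 * P + 2. (real k + 2)\<^sup>2 * r k)" using r by (intro sum_nonneg) auto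
  have D: "0 \<le> D" "2 * C \<le> D" using C D_sum by (auto simp: D_def)
  have "return_weight \<epsilon> k \<le> ennreal (D / (real k + 2)\<^sup>2)" for k
  proof (induction k rule: less_induct)
    case (less k)
    show ?case
    proof (cases "k < 2 * P + 2")
      case True
      then have "(real k + 2)\<^sup>2 * r k \<le> (\<Sum>k<2 * P + 2. (real k + 2)\<^sup>2 * r k)"
        using r by (intro member_le_sum) auto
      then have "(real k + 2)\<^sup>2 * r k \<le> D" using C by (simp add: D_def)
      then have "r k \<le> D / (real k + 2)\<^sup>2" by (simp add: field_simps)
      then show ?thesis by (simp add: r ennreal_leI)
    next
      case False
      define q where "q = k - (2 * P + 2)"
      \<comment> \<open>The middle part needs at least two steps for the last two heights to have a density.\<close>
      have k: "k = 2 * P + q + 2" using False by (simp add: q_def)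
      have "return_weight \<epsilon> k \<le> ennreal b ^ P * (ennreal (free_return_constant / (real q + 2)\<^sup>2) * ennreal w) +
          ennreal \<epsilon> * (\<Sum>i\<in>{P..<k - P}. contact_split_weight \<epsilon> k i)"
        using return_weight_expand_middle[OF \<epsilon> k] by (simp only: w b_def)
      also have "\<dots> \<le> ennreal (C / (real k + 2)\<^sup>2) + ennreal \<epsilon> * ennreal (8 * b * h * D / (real k + 2)\<^sup>2)"
      proof (intro add_mono mult_left_mono)
        show "(\<Sum>i\<in>{P..<k - P}. contact_split_weight \<epsilon> k i) \<le> ennreal (8 * b * h * D / (real k + 2)\<^sup>2)"
          unfolding b_def using less.IH D P h tail
          by (intro sum_contact_split_weight_le[OF \<epsilon>]) auto
        have "real k + 2 \<le> (real P + 2) * (real q + 2)"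
          by (simp add: k algebra_simps)
        then have "(real k + 2)\<^sup>2 \<le> ((real P + 2) * (real q + 2))\<^sup>2" by (intro power_mono) auto
        then have "1 / (real q + 2)\<^sup>2 \<le> (real P + 2)\<^sup>2 / (real k + 2)\<^sup>2"
          unfolding power_mult_distrib by (simp add: field_simps)
        then have "(b ^ P * free_return_constant * w) * (1 / (real q + 2)\<^sup>2) \<le>
            (b ^ P * free_return_constant * w) * ((real P + 2)\<^sup>2 / (real k + 2)\<^sup>2)"
          using b frc w by (intro mult_left_mono) auto
        then have "b ^ P * (free_return_constant / (real q + 2)\<^sup>2 * w) \<le> C / (real k + 2)\<^sup>2"
          by (simp add: C_def mult_ac)
        moreover have "ennreal b ^ P * (ennreal (free_return_constant / (real q + 2)\<^sup>2) * ennreal w) =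
            ennreal (b ^ P * (free_return_constant / (real q + 2)\<^sup>2 * w))"
        proof -
          define A where "A = free_return_constant / (real q + 2)\<^sup>2"
          have A: "0 \<le> A" using frc by (simp add: A_def)
          have "ennreal b ^ P * (ennreal A * ennreal w) = ennreal (b ^ P) * ennreal (A * w)"
            using A w b by (subst ennreal_mult[symmetric]) (auto simp: ennreal_power)
          also have "\<dots> = ennreal (b ^ P * (A * w))"
            using A w b by (intro ennreal_mult[symmetric]) auto
          finally show ?thesis by (simp only: A_def)
        qed
        ultimately show "ennreal b ^ P * (ennreal (free_return_constant / (real q + 2)\<^sup>2) * ennreal w) \<le>
            ennreal (C / (real k + 2)\<^sup>2)" by (simp only: ennreal_leI)
      qed simp
      also have "\<dots> = ennreal ((C + \<epsilon> * (8 * b * h * D)) / (real k + 2)\<^sup>2)"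
        using \<epsilon> b h D C by (subst ennreal_mult[symmetric], simp, simp, subst ennreal_plus[symmetric])
          (auto simp: add_divide_distrib)
      also have "\<dots> \<le> ennreal (D / (real k + 2)\<^sup>2)"
      proof (intro ennreal_leI divide_right_mono)
        have "16 * (b * h) * (\<epsilon> + 1) = 1" "0 \<le> b * h" using b \<epsilon> by (simp_all add: h_def)
        then have "\<epsilon> * (8 * b * h) \<le> 1 / 2" by (simp add: algebra_simps)
        then have "\<epsilon> * (8 * b * h) * D \<le> 1 / 2 * D" using D by (intro mult_right_mono) auto
        then show "C + \<epsilon> * (8 * b * h * D) \<le> D" using D by (simp add: mult_ac)
      qed simp
      finally show ?thesis .
    qed
  qed
  then show ?thesis using that D by blast
qed

end

section \<open>Summability of the return weights below the critical point\<close>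

lemma suminf_ennreal_shift_le:
  fixes f :: "nat \<Rightarrow> ennreal"
  shows "(\<Sum>k. f (k + i)) \<le> (\<Sum>k. f k)"
proof -
  have "(\<Sum>k. f k) = (\<Sum>k. f (k + i)) + (\<Sum>k<i. f k)"
    by (rule suminf_offset) (rule summableI)
  then show ?thesis by simp
qed

context increment_density
begin

text \<open>
  Give each contact of the field at \<open>\<epsilon>'\<close> either the weight \<open>\<epsilon>\<close> or the weight \<open>\<epsilon>' - \<epsilon>\<close>. The paths whose first
  contact of the second kind is directly followed by another zero are cut there into a path at \<open>\<epsilon>\<close> and
  a path at \<open>\<epsilon>'\<close>; different cutting points give disjoint sets of coloured paths.
\<close>

lemma return_weight_decompose:
  assumes \<epsilon>: "0 \<le> \<epsilon>" "\<epsilon> \<le> \<epsilon>'"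
  shows "(\<Sum>i\<le>k. ennreal ((\<epsilon>' - \<epsilon>) * \<epsilon>') * (return_weight \<epsilon> i * return_weight \<epsilon>' (k - i))) \<le> return_weight \<epsilon>' (k + 2)"
proof -
  let ?\<theta> = "ennreal (\<epsilon>' - \<epsilon>)"
  have \<epsilon>': "0 \<le> \<epsilon>'" using \<epsilon> by simp
  have lower: "ennreal ((\<epsilon>' - \<epsilon>) * \<epsilon>') * (return_weight \<epsilon> i * return_weight \<epsilon>' j) \<le>
      ?\<theta> * contact_weight \<epsilon> i (\<lambda>y. weight_to_end \<epsilon>' (Suc j) (y, 0))" for i j
  proof -
    have "return_weight \<epsilon> i * (ennreal \<epsilon>' * return_weight \<epsilon>' j) =
        contact_weight \<epsilon> i (\<lambda>y. (ennreal \<epsilon>' * return_weight \<epsilon>' j) * ennreal (g y))"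
      by (subst contact_weight_cmult) (simp_all add: contact_weight_def weight_to_end_def mult.commute)
    also have "\<dots> \<le> contact_weight \<epsilon> i (\<lambda>y. weight_to_end \<epsilon>' (Suc j) (y, 0))"
    proof (rule contact_weight_mono)
      fix y
      have "weight_to_end \<epsilon>' (Suc j) (y, 0) = step 0 (weight_to_end \<epsilon>' j) (y, 0) +
          ennreal (\<epsilon>' - 0) * pin (\<lambda>y. weight_to_end \<epsilon>' j (y, 0)) (y, 0)"
        unfolding weight_to_end_Suc by (rule step_split) (use \<epsilon>' in auto)
      then show "(ennreal \<epsilon>' * return_weight \<epsilon>' j) * ennreal (g y) \<le> weight_to_end \<epsilon>' (Suc j) (y, 0)"
        by (simp add: pin_def mult_ac)
    qed
    finally have "?\<theta> * (return_weight \<epsilon> i * (ennreal \<epsilon>' * return_weight \<epsilon>' j)) \<le>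
        ?\<theta> * contact_weight \<epsilon> i (\<lambda>y. weight_to_end \<epsilon>' (Suc j) (y, 0))" by (rule mult_left_mono) simp
    moreover have "ennreal ((\<epsilon>' - \<epsilon>) * \<epsilon>') = ?\<theta> * ennreal \<epsilon>'" using \<epsilon> \<epsilon>' by (simp add: ennreal_mult)
    ultimately show ?thesis by (simp add: mult_ac)
  qed
  have "(\<Sum>i\<le>k. ennreal ((\<epsilon>' - \<epsilon>) * \<epsilon>') * (return_weight \<epsilon> i * return_weight \<epsilon>' (k - i))) \<le>
      (\<Sum>i\<le>k. ?\<theta> * contact_weight \<epsilon> i (\<lambda>y. weight_to_end \<epsilon>' (Suc (k - i)) (y, 0)))"
    by (intro sum_mono lower)
  also have "\<dots> = (\<Sum>j\<in>{1..<k + 2}. ?\<theta> * contact_weight \<epsilon> (k + 2 - 1 - j) (\<lambda>y. weight_to_end \<epsilon>' j (y, 0)))"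
    by (rule sum.reindex_bij_witness[of _ "\<lambda>j. Suc k - j" "\<lambda>i. Suc k - i"]) (auto simp: Suc_diff_le)
  also have "\<dots> \<le> (\<Sum>j<k + 2. ?\<theta> * contact_weight \<epsilon> (k + 2 - 1 - j) (\<lambda>y. weight_to_end \<epsilon>' j (y, 0)))"
    by (rule sum_mono2) auto
  also have "\<dots> \<le> return_weight \<epsilon>' (k + 2)"
    unfolding weight_to_end_def contact_weight_def
    by (subst expand_first_pin[OF _ \<epsilon>, where n = "k + 2"]) simp_all
  finally show ?thesis .
qed

text \<open>
  Let \<open>x\<close> and \<open>y\<close> be the generating functions of the return weights at \<open>\<epsilon>'\<close> and at \<open>\<epsilon>\<close>. The decomposition at a
  double zero gives \<open>c * z\<^sup>2 * y * x \<le> x\<close>. Subexponential growth makes \<open>x\<close> finite for \<open>z < 1\<close>, so \<open>c * z\<^sup>2 * y \<le> 1\<close>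
  and \<open>z\<close> can tend to \<open>1\<close>.
\<close>

lemma suminf_return_weight_finite:
  assumes \<epsilon>: "0 \<le> \<epsilon>" "\<epsilon> < \<epsilon>'"
    and growth: "\<And>\<rho>. 1 < \<rho> \<Longrightarrow> \<exists>K\<ge>0. \<forall>k. return_weight \<epsilon>' k \<le> ennreal (K * \<rho> ^ k)"
  shows "(\<Sum>k. return_weight \<epsilon> k) < \<top>"
proof -
  have \<epsilon>': "0 < \<epsilon>'" using \<epsilon> by simp
  define c where "c = (\<epsilon>' - \<epsilon>) * \<epsilon>'"
  have c: "0 < c" using \<epsilon> by (simp add: c_def)
  define r where "r = (\<lambda>k. enn2real (return_weight \<epsilon> k))"
  have r: "return_weight \<epsilon> k = ennreal (r k)" "0 \<le> r k" for k
    using weight_to_end_finite[OF \<epsilon>(1)] by (auto simp: r_def)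
  have gen: "c * z\<^sup>2 * (\<Sum>i<N. z ^ i * r i) \<le> 1" if z: "0 < z" "z < 1" for z N
  proof -
    define h where "h = (\<lambda>k. ennreal (z ^ k) * return_weight \<epsilon>' k)"
    define x where "x = (\<Sum>k. h k)"
    have "0 < x"
    proof -
      have "0 < ennreal ((g 0)\<^sup>2)" using g_0_pos by simp
      also have "ennreal ((g 0)\<^sup>2) = h 0" using g_0_pos
        by (simp add: h_def weight_to_end_def pin_def power2_eq_square ennreal_mult)
      also have "h 0 \<le> x" unfolding x_def using sum_le_suminf[of h "{0}"] by simp
      finally show ?thesis .
    qed
    have "x < \<top>"
    proof -
      \<comment> \<open>Any growth rate strictly between 1 and 1 / z bounds the series by a geometric one.\<close>
      define \<rho> where "\<rho> = (1 / z + 1) / 2"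
      have \<rho>: "1 < \<rho>" "0 \<le> z * \<rho>" "z * \<rho> < 1" using z by (auto simp: \<rho>_def field_simps)
      obtain K where K: "0 \<le> K" "\<And>k. return_weight \<epsilon>' k \<le> ennreal (K * \<rho> ^ k)" using growth[OF \<rho>(1)] by blast
      have "h k \<le> ennreal (K * (z * \<rho>) ^ k)" for k
      proof -
        have "h k \<le> ennreal (z ^ k) * ennreal (K * \<rho> ^ k)" unfolding h_def by (intro mult_left_mono K) simp
        also have "\<dots> = ennreal (K * (z * \<rho>) ^ k)"
          using z by (simp add: power_mult_distrib mult_ac flip: ennreal_mult')
        finally show ?thesis .
      qed
      then have "x \<le> (\<Sum>k. ennreal (K * (z * \<rho>) ^ k))" unfolding x_def by (intro suminf_le summableI)
      also have "\<dots> = ennreal (\<Sum>k. K * (z * \<rho>) ^ k)"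
        using K \<rho> by (intro suminf_ennreal2 summable_mult summable_geometric) auto
      also have "\<dots> < \<top>" by simp
      finally show ?thesis .
    qed
    have "ennreal (c * z\<^sup>2 * (\<Sum>i<N. z ^ i * r i)) * x \<le> x"
    proof -
      let ?a = "\<lambda>i k. if i \<le> k then ennreal (z ^ (k + 2)) * (ennreal c * (return_weight \<epsilon> i * return_weight \<epsilon>' (k - i))) else 0"
      have "ennreal (c * z\<^sup>2 * (\<Sum>i<N. z ^ i * r i)) * x = (\<Sum>i<N. ennreal (c * z\<^sup>2 * (z ^ i * r i)) * x)"
        using c z r by (simp add: sum_distrib_left sum_distrib_right flip: sum_ennreal)
      also have "\<dots> \<le> (\<Sum>i<N. \<Sum>k. ?a i k)"
      proof (rule sum_mono)
        fix i
        have "ennreal (c * z\<^sup>2 * (z ^ i * r i)) * x = (\<Sum>m. ennreal (c * z\<^sup>2 * (z ^ i * r i)) * h m)"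
          unfolding x_def by (rule ennreal_suminf_cmult[symmetric])
        also have "\<dots> = (\<Sum>m. ?a i (m + i))"
        proof (rule suminf_cong)
          fix m
          have "z ^ (m + i + 2) = z\<^sup>2 * z ^ i * z ^ m" by (simp add: power_add power2_eq_square mult_ac)
          then show "ennreal (c * z\<^sup>2 * (z ^ i * r i)) * h m = ?a i (m + i)"
            using c z r by (simp add: h_def ennreal_mult mult_ac)
        qed
        also have "\<dots> \<le> (\<Sum>k. ?a i k)" by (rule suminf_ennreal_shift_le)
        finally show "ennreal (c * z\<^sup>2 * (z ^ i * r i)) * x \<le> (\<Sum>k. ?a i k)" .
      qed
      also have "\<dots> = (\<Sum>k. \<Sum>i<N. ?a i k)" by (rule suminf_sum[symmetric]) (rule summableI)
      also have "\<dots> \<le> (\<Sum>k. h (k + 2))"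
      proof (intro suminf_le summableI)
        fix k
        have "(\<Sum>i<N. ?a i k) \<le> (\<Sum>i\<in>{..<N} \<union> {..k}. ?a i k)" by (rule sum_mono2) auto
        also have "\<dots> = (\<Sum>i\<le>k. ?a i k)" by (rule sum.mono_neutral_right) auto
        also have "\<dots> = ennreal (z ^ (k + 2)) * (\<Sum>i\<le>k. ennreal c * (return_weight \<epsilon> i * return_weight \<epsilon>' (k - i)))"
          by (simp add: sum_distrib_left)
        also have "\<dots> \<le> ennreal (z ^ (k + 2)) * return_weight \<epsilon>' (k + 2)"
          unfolding c_def using \<epsilon> by (intro mult_left_mono return_weight_decompose) auto
        finally show "(\<Sum>i<N. ?a i k) \<le> h (k + 2)" by (simp add: h_def)
      qed
      also have "\<dots> \<le> x" unfolding x_def by (rule suminf_ennreal_shift_le)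
      finally show ?thesis .
    qed
    moreover obtain t where t: "x = ennreal t" "0 < t" using \<open>0 < x\<close> \<open>x < \<top>\<close> by (cases x) auto
    moreover have "0 \<le> c * z\<^sup>2 * (\<Sum>i<N. z ^ i * r i)" using c z r by (simp add: sum_nonneg)
    ultimately have "c * z\<^sup>2 * (\<Sum>i<N. z ^ i * r i) * t \<le> 1 * t" by (simp flip: ennreal_mult)
    then show ?thesis using t(2) by simp
  qed
  have bound: "(\<Sum>i<N. r i) \<le> 1 / c" for N
  proof -
    have "((\<lambda>z. c * z\<^sup>2 * (\<Sum>i<N. z ^ i * r i)) \<longlongrightarrow> c * 1\<^sup>2 * (\<Sum>i<N. 1 ^ i * r i)) (at_left 1)"
      by (intro tendsto_intros)
    moreover have "\<forall>\<^sub>F z in at_left 1. c * z\<^sup>2 * (\<Sum>i<N. z ^ i * r i) \<le> 1"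
      using eventually_at_left_real[OF zero_less_one] by eventually_elim (simp add: gen)
    ultimately have "c * 1\<^sup>2 * (\<Sum>i<N. 1 ^ i * r i) \<le> 1"
      by (rule tendsto_upperbound) simp
    then show ?thesis using c by (simp add: field_simps)
  qed
  have "(\<Sum>k. return_weight \<epsilon> k) \<le> ennreal (1 / c)"
    using bound r by (intro suminf_le_const summableI) (simp add: ennreal_leI)
  also have "\<dots> < \<top>" by simp
  finally show ?thesis .
qed

end

section \<open>From the product measure to transfer operators\<close>

text \<open>
  As the sum of a convex function and a parabola, \<open>V\<close> is convex, and \<open>exp (-V)\<close> is log-concave.
\<close>

lemma increment_density_exp_neg:
  assumes "admissible_potential V"
  shows "increment_density (\<lambda>x. exp_neg (V x))"
proof
  have not_MInf: "V x \<noteq> -\<infinity>" and even: "V (- x) = V x" for x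
    using assms by (auto simp: admissible_potential_def)
  have int: "has_bochner_integral lborel (\<lambda>x. exp_neg (V x)) 1"
    using assms by (simp add: admissible_potential_def)
  have nonneg: "0 \<le> exp_neg h" for h by (simp add: exp_neg_def)
  show "(\<lambda>x. exp_neg (V x)) \<in> borel_measurable borel"
    using int by (auto simp: has_bochner_integral_iff dest: borel_measurable_integrable)
  show "exp_neg (V (- x)) = exp_neg (V x)" for x by (simp add: even)
  show "(\<integral>\<^sup>+x. ennreal (exp_neg (V x)) \<partial>lborel) = 1"
    using int by (subst nn_integral_eq_integral) (auto simp: has_bochner_integral_iff nonneg)
  obtain \<gamma> where \<gamma>: "0 < \<gamma>" and convex: "ereal_convex (\<lambda>x. V x - ereal (\<gamma> * x\<^sup>2 / 2))"
    using assms by (auto simp: admissible_potential_def)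
  show "log_concave (\<lambda>x. exp_neg (V x))"
    unfolding log_concave_def
  proof (intro conjI allI impI nonneg)
    fix x y t :: real assume t: "0 < t \<and> t < 1"
    define z where "z = (1 - t) * x + t * y"
    show "exp_neg (V x) powr (1 - t) * exp_neg (V y) powr t \<le> exp_neg (V ((1 - t) *\<^sub>R x + t *\<^sub>R y))"
    proof (cases "V x = \<infinity> \<or> V y = \<infinity>")
      case True
      then show ?thesis using nonneg by (auto simp: exp_neg_def)
    next
      case False
      then obtain vx vy where v: "V x = ereal vx" "V y = ereal vy"
        using not_MInf[of x] not_MInf[of y] by (cases "V x"; cases "V y") auto
      have le: "V z - ereal (\<gamma> * z\<^sup>2 / 2) \<le>
          ereal (1 - t) * (V x - ereal (\<gamma> * x\<^sup>2 / 2)) + ereal t * (V y - ereal (\<gamma> * y\<^sup>2 / 2))"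
        using convex t unfolding ereal_convex_def z_def by blast
      then have "V z \<noteq> \<infinity>" by (auto simp: v)
      then obtain vz where vz: "V z = ereal vz" using not_MInf[of z] by (cases "V z") auto
      have "vz \<le> (1 - t) * (vx - \<gamma> * x\<^sup>2 / 2) + t * (vy - \<gamma> * y\<^sup>2 / 2) + \<gamma> * z\<^sup>2 / 2"
        using le by (simp add: v vz)
      also have "\<dots> = (1 - t) * vx + t * vy - \<gamma> / 2 * (t * (1 - t) * (x - y)\<^sup>2)"
        by (simp add: z_def power2_eq_square field_simps)
      also have "\<dots> \<le> (1 - t) * vx + t * vy" using \<gamma> t by simp
      finally have "exp (- ((1 - t) * vx + t * vy)) \<le> exp (- vz)" by simp
      moreover have "exp (- vx) powr (1 - t) * exp (- vy) powr t = exp (- ((1 - t) * vx + t * vy))"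
        by (simp add: powr_def algebra_simps flip: exp_add)
      ultimately show ?thesis by (simp add: exp_neg_def v vz flip: z_def)
    qed
  qed
qed

lemma exp_neg_add: "a \<noteq> -\<infinity> \<Longrightarrow> b \<noteq> -\<infinity> \<Longrightarrow> exp_neg (a + b) = exp_neg a * exp_neg b"
  by (cases a; cases b) (auto simp: exp_neg_def exp_add[symmetric])

lemma exp_neg_sum:
  assumes "finite I" "\<And>i. i \<in> I \<Longrightarrow> f i \<noteq> -\<infinity>"
  shows "exp_neg (\<Sum>i\<in>I. f i) = (\<Prod>i\<in>I. exp_neg (f i))"
proof -
  have "exp_neg (\<Sum>i\<in>I. f i) = (\<Prod>i\<in>I. exp_neg (f i)) \<and> (\<Sum>i\<in>I. f i) \<noteq> -\<infinity>"
    using assms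
  proof (induction)
    case (insert i I)
    then show ?case by (simp add: exp_neg_add)
  qed (simp add: exp_neg_def zero_ereal_def)
  then show ?thesis by simp
qed

text \<open>
  The left boundary condition alone. The values to the right of the current site are left as they are,
  so that sites can be integrated out one after another from the right.
\<close>

definition zero_before :: "(int \<Rightarrow> real) \<Rightarrow> int \<Rightarrow> real" where
  "zero_before \<phi> j = (if 1 \<le> j then \<phi> j else 0)"

lemma zero_before_fun_upd:
  "1 \<le> i \<Longrightarrow> zero_before (\<phi>(i := y)) j = (if j = i then y else zero_before \<phi> j)"
  by (simp add: zero_before_def)

context increment_density
begin

definition path_weight :: "nat \<Rightarrow> (int \<Rightarrow> real) \<Rightarrow> ennreal" where
  "path_weight n \<phi> = (\<Prod>j<n. ennreal (g (laplacian (zero_before \<phi>) (int j))))"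

definition sites :: "real \<Rightarrow> nat \<Rightarrow> (int \<Rightarrow> real) measure" where
  "sites \<epsilon> n = Pi\<^sub>M {1..int n} (\<lambda>_. site_measure \<epsilon>)"

lemma zero_before_measurable:
  assumes "j \<le> int n"
  shows "(\<lambda>\<phi>. zero_before \<phi> j) \<in> borel_measurable (sites \<epsilon> n)"
proof (cases "1 \<le> j")
  case True
  then have "(\<lambda>\<phi>. \<phi> j) \<in> measurable (sites \<epsilon> n) (site_measure \<epsilon>)"
    unfolding sites_def using assms by (intro measurable_component_singleton) auto
  then show ?thesis using True by (simp add: zero_before_def cong: measurable_cong_sets)
qed (simp add: zero_before_def)

lemma path_weight_measurable:
  "n \<le> m \<Longrightarrow> path_weight n \<in> borel_measurable (sites \<epsilon> m)"
  unfolding path_weight_def laplacian_def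
  by (intro borel_measurable_prod_ennreal measurable_compose[OF _ measurable_ennreal]
        measurable_compose[OF _ g_measurable] borel_measurable_diff borel_measurable_add
        borel_measurable_times borel_measurable_const zero_before_measurable) auto

text \<open>
  Integrating out the last site is one application of \<open>step\<close>. The factor \<open>f\<close> of an earlier site is
  carried along; it will be the indicator of a contact.
\<close>

lemma sites_integral_Suc:
  assumes [measurable]: "f \<in> borel_measurable borel" "pair_measurable F" and i: "i \<le> int n"
  shows "(\<integral>\<^sup>+\<phi>. f (zero_before \<phi> i) * path_weight (Suc n) \<phi> *
        F (zero_before \<phi> (int n), zero_before \<phi> (int (Suc n))) \<partial>sites \<epsilon> (Suc n)) =
    (\<integral>\<^sup>+\<phi>. f (zero_before \<phi> i) * path_weight n \<phi> *
        step \<epsilon> F (zero_before \<phi> (int n - 1), zero_before \<phi> (int n)) \<partial>sites \<epsilon> n)"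
proof -
  interpret product_sigma_finite "\<lambda>_::int. site_measure \<epsilon>"
    by (intro product_sigma_finite.intro sigma_finite_site_measure)
  let ?h = "\<lambda>\<phi>. f (zero_before \<phi> i) * path_weight (Suc n) \<phi> *
        F (zero_before \<phi> (int n), zero_before \<phi> (int (Suc n)))"
  have ins: "{1..int (Suc n)} = insert (int (Suc n)) {1..int n}" by auto
  have meas: "?h \<in> borel_measurable (sites \<epsilon> (Suc n))"
    using i
    by (intro borel_measurable_times_ennreal path_weight_measurable
          measurable_compose[OF zero_before_measurable assms(1)]
          measurable_compose[OF measurable_Pair assms(2)] zero_before_measurable) auto
  have "(\<integral>\<^sup>+\<phi>. ?h \<phi> \<partial>sites \<epsilon> (Suc n)) =
      (\<integral>\<^sup>+\<phi>. \<integral>\<^sup>+y. ?h (\<phi>(int (Suc n) := y)) \<partial>site_measure \<epsilon> \<partial>sites \<epsilon> n)"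
    using meas unfolding sites_def ins by (intro product_nn_integral_insert) auto
  also have "\<dots> = (\<integral>\<^sup>+\<phi>. f (zero_before \<phi> i) * path_weight n \<phi> *
        step \<epsilon> F (zero_before \<phi> (int n - 1), zero_before \<phi> (int n)) \<partial>sites \<epsilon> n)"
  proof (intro nn_integral_cong)
    fix \<phi> :: "int \<Rightarrow> real"
    let ?x = "zero_before \<phi>"
    have upd: "zero_before (\<phi>(int (Suc n) := y)) j = (if j = int (Suc n) then y else ?x j)" for y j
      by (rule zero_before_fun_upd) simp
    have pw: "path_weight (Suc n) (\<phi>(int (Suc n) := y)) =
        path_weight n \<phi> * ennreal (g (y + ?x (int n - 1) - 2 * ?x (int n)))" for y
    proof -
      have "(\<Prod>j<n. ennreal (g (laplacian (zero_before (\<phi>(int (Suc n) := y))) (int j)))) = path_weight n \<phi>"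
        unfolding path_weight_def
      proof (intro prod.cong refl)
        fix j assume "j \<in> {..<n}"
        then have "int j + 1 \<noteq> int (Suc n)" "int j - 1 \<noteq> int (Suc n)" "int j \<noteq> int (Suc n)" by auto
        then show "ennreal (g (laplacian (zero_before (\<phi>(int (Suc n) := y))) (int j))) =
          ennreal (g (laplacian ?x (int j)))"
          by (simp only: laplacian_def upd if_False)
      qed
      moreover have "laplacian (zero_before (\<phi>(int (Suc n) := y))) (int n) = y + ?x (int n - 1) - 2 * ?x (int n)"
      proof -
        have "int n + 1 = int (Suc n)" "int n - 1 \<noteq> int (Suc n)" "int n \<noteq> int (Suc n)" by auto
        then show ?thesis by (simp only: laplacian_def upd if_True if_False simp_thms)
      qed
      ultimately show ?thesis by (simp only: path_weight_def prod.lessThan_Suc)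
    qed
    have "(\<integral>\<^sup>+y. ?h (\<phi>(int (Suc n) := y)) \<partial>site_measure \<epsilon>) =
        (\<integral>\<^sup>+y. (f (?x i) * path_weight n \<phi>) *
          (ennreal (g (y + ?x (int n - 1) - 2 * ?x (int n))) * F (?x (int n), y)) \<partial>site_measure \<epsilon>)"
    proof (intro nn_integral_cong)
      fix y
      have "i \<noteq> int (Suc n)" "int n \<noteq> int (Suc n)" using i by auto
      then show "?h (\<phi>(int (Suc n) := y)) = (f (?x i) * path_weight n \<phi>) *
          (ennreal (g (y + ?x (int n - 1) - 2 * ?x (int n))) * F (?x (int n), y))"
        by (simp only: pw upd if_False if_True simp_thms mult_ac)
    qed
    also have "\<dots> = (f (?x i) * path_weight n \<phi>) *
        (\<integral>\<^sup>+y. ennreal (g (y + ?x (int n - 1) - 2 * ?x (int n))) * F (?x (int n), y) \<partial>site_measure \<epsilon>)"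
      by (rule nn_integral_cmult) measurable
    finally show "(\<integral>\<^sup>+y. ?h (\<phi>(int (Suc n) := y)) \<partial>site_measure \<epsilon>) =
        f (?x i) * path_weight n \<phi> * step \<epsilon> F (?x (int n - 1), ?x (int n))"
      by (simp add: step_def)
  qed
  finally show ?thesis .
qed

lemma sites_integral_add:
  assumes "f \<in> borel_measurable borel" "pair_measurable F" and i: "i \<le> int n"
  shows "(\<integral>\<^sup>+\<phi>. f (zero_before \<phi> i) * path_weight (n + q) \<phi> *
        F (zero_before \<phi> (int (n + q) - 1), zero_before \<phi> (int (n + q))) \<partial>sites \<epsilon> (n + q)) =
    (\<integral>\<^sup>+\<phi>. f (zero_before \<phi> i) * path_weight n \<phi> *
        (step \<epsilon> ^^ q) F (zero_before \<phi> (int n - 1), zero_before \<phi> (int n)) \<partial>sites \<epsilon> n)"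
  using assms(2)
proof (induction q arbitrary: F)
  case (Suc q)
  have "(\<integral>\<^sup>+\<phi>. f (zero_before \<phi> i) * path_weight (n + Suc q) \<phi> *
        F (zero_before \<phi> (int (n + Suc q) - 1), zero_before \<phi> (int (n + Suc q))) \<partial>sites \<epsilon> (n + Suc q)) =
      (\<integral>\<^sup>+\<phi>. f (zero_before \<phi> i) * path_weight (n + q) \<phi> *
        step \<epsilon> F (zero_before \<phi> (int (n + q) - 1), zero_before \<phi> (int (n + q))) \<partial>sites \<epsilon> (n + q))"
    using sites_integral_Suc[OF assms(1) Suc.prems, of i "n + q" \<epsilon>] i by simp
  also have "\<dots> = (\<integral>\<^sup>+\<phi>. f (zero_before \<phi> i) * path_weight n \<phi> *
        (step \<epsilon> ^^ q) (step \<epsilon> F) (zero_before \<phi> (int n - 1), zero_before \<phi> (int n)) \<partial>sites \<epsilon> n)"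
    by (rule Suc.IH) (use Suc.prems in simp)
  finally show ?case by (simp only: funpow_Suc_right o_def)
qed simp

lemma sites_integral:
  assumes "pair_measurable F"
  shows "(\<integral>\<^sup>+\<phi>. path_weight n \<phi> * F (zero_before \<phi> (int n - 1), zero_before \<phi> (int n)) \<partial>sites \<epsilon> n) =
    (step \<epsilon> ^^ n) F (0, 0)"
proof -
  interpret product_sigma_finite "\<lambda>_::int. site_measure \<epsilon>"
    by (intro product_sigma_finite.intro sigma_finite_site_measure)
  have "(\<integral>\<^sup>+\<phi>. 1 * path_weight (0 + n) \<phi> * F (zero_before \<phi> (int (0 + n) - 1), zero_before \<phi> (int (0 + n))) \<partial>sites \<epsilon> (0 + n)) =
    (\<integral>\<^sup>+\<phi>. 1 * path_weight 0 \<phi> * (step \<epsilon> ^^ n) F (zero_before \<phi> (int 0 - 1), zero_before \<phi> (int 0)) \<partial>sites \<epsilon> 0)"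
    by (rule sites_integral_add[where f = "\<lambda>_. 1" and i = 0]) (use assms in auto)
  also have "\<dots> = (step \<epsilon> ^^ n) F (0, 0)"
    by (simp add: path_weight_def zero_before_def sites_def space_PiM_empty emeasure_PiM_empty)
  finally show ?thesis by simp
qed

lemma sites_integral_contact:
  assumes \<epsilon>: "0 \<le> \<epsilon>" and i: "1 \<le> i" "i \<le> n"
  shows "(\<integral>\<^sup>+\<phi>. indicator {0} (zero_before \<phi> (int i)) * path_weight n \<phi> *
      pin (\<lambda>y. ennreal (g y)) (zero_before \<phi> (int n - 1), zero_before \<phi> (int n)) \<partial>sites \<epsilon> n) =
    ennreal \<epsilon> * contact_split_weight \<epsilon> n (i - 1)"
proof -
  define G where "G = weight_to_end \<epsilon> (n - i)"
  have [measurable]: "pair_measurable G" by (simp add: G_def)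
  define H where "H = (\<lambda>(x::real, y). indicator {0} y * G (x, y))"
  have [measurable]: "pair_measurable H" unfolding H_def by measurable
  obtain i' where i': "i = Suc i'" using i by (cases i) auto
  have "(\<integral>\<^sup>+\<phi>. indicator {0} (zero_before \<phi> (int i)) * path_weight n \<phi> *
      pin (\<lambda>y. ennreal (g y)) (zero_before \<phi> (int n - 1), zero_before \<phi> (int n)) \<partial>sites \<epsilon> n) =
    (\<integral>\<^sup>+\<phi>. indicator {0} (zero_before \<phi> (int i)) * path_weight i \<phi> *
      G (zero_before \<phi> (int i - 1), zero_before \<phi> (int i)) \<partial>sites \<epsilon> i)"
    using sites_integral_add[where f = "indicator {0}" and F = "pin (\<lambda>y. ennreal (g y))"
        and i = "int i" and n = i and q = "n - i" and \<epsilon> = \<epsilon>] i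
    by (simp add: G_def weight_to_end_def)
  also have "\<dots> = (\<integral>\<^sup>+\<phi>. path_weight i \<phi> * H (zero_before \<phi> (int i - 1), zero_before \<phi> (int i)) \<partial>sites \<epsilon> i)"
    by (simp add: H_def mult_ac)
  also have "\<dots> = (step \<epsilon> ^^ i) H (0, 0)" by (rule sites_integral) simp
  also have "\<dots> = (step \<epsilon> ^^ i') (step \<epsilon> H) (0, 0)" by (simp only: i' funpow_Suc_right o_def)
  also have "step \<epsilon> H = (\<lambda>p. ennreal \<epsilon> * pin (\<lambda>y. G (y, 0)) p)"
  proof
    fix p :: "real \<times> real"
    obtain x y where p: "p = (x, y)" by (cases p)
    have "(\<integral>\<^sup>+z. ennreal (g (z + x - 2 * y)) * H (y, z) \<partial>lborel) = (\<integral>\<^sup>+(z::real). 0 \<partial>lborel)"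
    proof (rule nn_integral_cong_AE)
      show "AE z in lborel. ennreal (g (z + x - 2 * y)) * H (y, z) = 0"
        using AE_lborel_singleton[of 0] by eventually_elim (simp add: H_def)
    qed
    then show "step \<epsilon> H p = ennreal \<epsilon> * pin (\<lambda>y. G (y, 0)) p"
      by (simp add: p step_eq pin_def) (simp add: H_def)
  qed
  also have "(step \<epsilon> ^^ i') (\<lambda>p. ennreal \<epsilon> * pin (\<lambda>y. G (y, 0)) p) (0, 0) =
      ennreal \<epsilon> * (step \<epsilon> ^^ i') (pin (\<lambda>y. G (y, 0))) (0, 0)"
    by (rule funpow_step_cmult) measurable
  also have "\<dots> = ennreal \<epsilon> * contact_split_weight \<epsilon> n (i - 1)"
    using i by (simp add: contact_split_weight_def contact_weight_def G_def i')
  finally show ?thesis .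
qed

end

text \<open>
  The two site measures differ in the mass of their atom only, so each zero of the field contributes
  the factor \<open>\<epsilon>' / \<epsilon>\<close>.
\<close>

lemma change_of_pinning:
  assumes \<epsilon>: "0 < \<epsilon>" "0 \<le> \<epsilon>'" and "finite I"
    and "F \<in> borel_measurable (Pi\<^sub>M I (\<lambda>_. site_measure \<epsilon>))"
  shows "(\<integral>\<^sup>+\<phi>. F \<phi> * (\<Prod>i\<in>I. if \<phi> i = 0 then ennreal (\<epsilon>' / \<epsilon>) else 1) \<partial>Pi\<^sub>M I (\<lambda>_. site_measure \<epsilon>)) =
    (\<integral>\<^sup>+\<phi>. F \<phi> \<partial>Pi\<^sub>M I (\<lambda>_::int. site_measure \<epsilon>'))"
  using assms(3,4)
proof (induction I arbitrary: F)
  case empty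
  interpret A: product_sigma_finite "\<lambda>_::int. site_measure \<epsilon>"
    by (intro product_sigma_finite.intro sigma_finite_site_measure)
  interpret B: product_sigma_finite "\<lambda>_::int. site_measure \<epsilon>'"
    by (intro product_sigma_finite.intro sigma_finite_site_measure)
  show ?case by (simp add: A.nn_integral_empty B.nn_integral_empty)
next
  case (insert i I)
  interpret A: product_sigma_finite "\<lambda>_::int. site_measure \<epsilon>"
    by (intro product_sigma_finite.intro sigma_finite_site_measure)
  interpret B: product_sigma_finite "\<lambda>_::int. site_measure \<epsilon>'"
    by (intro product_sigma_finite.intro sigma_finite_site_measure)
  let ?A = "\<lambda>I. Pi\<^sub>M I (\<lambda>_::int. site_measure \<epsilon>)" and ?B = "\<lambda>I. Pi\<^sub>M I (\<lambda>_::int. site_measure \<epsilon>')"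
  let ?d = "\<lambda>y::real. if y = 0 then ennreal (\<epsilon>' / \<epsilon>) else 1"
  have sets_eq: "sets (?A I) = sets (?B I)" for I by (intro sets_PiM_cong) auto
  have meas_eq: "borel_measurable (?A I) = (borel_measurable (?B I) :: ((int \<Rightarrow> real) \<Rightarrow> ennreal) set)" for I
    by (intro measurable_cong_sets sets_eq refl)
  have single: "(\<integral>\<^sup>+y. h y * ?d y \<partial>site_measure \<epsilon>) = (\<integral>\<^sup>+y. h y \<partial>site_measure \<epsilon>')"
    if [measurable]: "h \<in> borel_measurable borel" for h
  proof -
    have "(\<integral>\<^sup>+y. h y * ?d y \<partial>lborel) = (\<integral>\<^sup>+y. h y \<partial>lborel)"
    proof (rule nn_integral_cong_AE)
      show "AE y in lborel. h y * ?d y = h y"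
        using AE_lborel_singleton[of 0] by eventually_elim simp
    qed
    moreover have "ennreal \<epsilon> * ennreal (\<epsilon>' / \<epsilon>) = ennreal \<epsilon>'"
      using \<epsilon> by (simp flip: ennreal_mult)
    then have "ennreal \<epsilon> * (h 0 * ennreal (\<epsilon>' / \<epsilon>)) = ennreal \<epsilon>' * h 0"
      by (metis mult.assoc mult.commute)
    ultimately show ?thesis
      by (simp add: nn_integral_site_measure)
  qed
  have F': "F \<in> borel_measurable (?B (insert i I))" using insert.prems meas_eq by blast
  have dm: "?d \<in> borel_measurable borel" by measurable
  have upd: "(\<lambda>(\<phi>, y). F (\<phi>(i := y))) \<in> borel_measurable (?B I \<Otimes>\<^sub>M site_measure \<epsilon>')"
    using measurable_compose[OF measurable_add_dim F'] by (simp add: case_prod_unfold)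
  define G where "G = (\<lambda>\<phi>. \<integral>\<^sup>+y. F (\<phi>(i := y)) \<partial>site_measure \<epsilon>')"
  have "G \<in> borel_measurable (?B I)" unfolding G_def
    using sigma_finite_measure.borel_measurable_nn_integral[OF sigma_finite_site_measure upd] by simp
  then have G: "G \<in> borel_measurable (?A I)" using meas_eq by blast
  have comp: "(\<lambda>\<phi>. ?d (\<phi> j)) \<in> borel_measurable (?A J)" if "j \<in> J" for j J
    by (rule measurable_compose[OF measurable_component_singleton[OF that]]) (simp add: dm cong: measurable_cong_sets)
  have Fm: "(\<lambda>\<phi>. F \<phi> * (\<Prod>j\<in>insert i I. ?d (\<phi> j))) \<in> borel_measurable (?A (insert i I))"
    by (intro borel_measurable_times_ennreal borel_measurable_prod_ennreal insert.prems comp)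
  have "(\<integral>\<^sup>+\<phi>. F \<phi> * (\<Prod>j\<in>insert i I. ?d (\<phi> j)) \<partial>?A (insert i I)) =
      (\<integral>\<^sup>+\<phi>. \<integral>\<^sup>+y. F (\<phi>(i := y)) * (\<Prod>j\<in>insert i I. ?d ((\<phi>(i := y)) j)) \<partial>site_measure \<epsilon> \<partial>?A I)"
    by (rule A.product_nn_integral_insert[OF insert.hyps Fm])
  also have "\<dots> = (\<integral>\<^sup>+\<phi>. G \<phi> * (\<Prod>j\<in>I. ?d (\<phi> j)) \<partial>?A I)"
  proof (intro nn_integral_cong)
    fix \<phi> assume \<phi>: "\<phi> \<in> space (?A I)"
    then have "\<phi> \<in> space (?B I)" by (simp add: space_PiM)
    then have slice: "(\<lambda>y. F (\<phi>(i := y))) \<in> borel_measurable borel"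
      using measurable_compose[OF measurable_Pair1' upd] by (simp cong: measurable_cong_sets)
    have prod_upd: "(\<Prod>j\<in>insert i I. ?d ((\<phi>(i := y)) j)) = ?d y * (\<Prod>j\<in>I. ?d (\<phi> j))" for y
    proof -
      have "(\<Prod>j\<in>I. ?d ((\<phi>(i := y)) j)) = (\<Prod>j\<in>I. ?d (\<phi> j))"
        using insert.hyps by (intro prod.cong) auto
      then show ?thesis using insert.hyps by (subst prod.insert) simp_all
    qed
    have "(\<integral>\<^sup>+y. F (\<phi>(i := y)) * (\<Prod>j\<in>insert i I. ?d ((\<phi>(i := y)) j)) \<partial>site_measure \<epsilon>) =
        (\<integral>\<^sup>+y. (F (\<phi>(i := y)) * ?d y) * (\<Prod>j\<in>I. ?d (\<phi> j)) \<partial>site_measure \<epsilon>)"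
      by (simp only: prod_upd mult.assoc)
    also have "\<dots> = (\<integral>\<^sup>+y. F (\<phi>(i := y)) * ?d y \<partial>site_measure \<epsilon>) * (\<Prod>j\<in>I. ?d (\<phi> j))"
      using slice dm by (intro nn_integral_multc) (simp cong: measurable_cong_sets)
    also have "(\<integral>\<^sup>+y. F (\<phi>(i := y)) * ?d y \<partial>site_measure \<epsilon>) = G \<phi>"
      unfolding G_def by (rule single[OF slice])
    finally show "(\<integral>\<^sup>+y. F (\<phi>(i := y)) * (\<Prod>j\<in>insert i I. ?d ((\<phi>(i := y)) j)) \<partial>site_measure \<epsilon>) =
      G \<phi> * (\<Prod>j\<in>I. ?d (\<phi> j))" .
  qed
  also have "\<dots> = (\<integral>\<^sup>+\<phi>. G \<phi> \<partial>?B I)" by (rule insert.IH[OF G])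
  also have "\<dots> = (\<integral>\<^sup>+\<phi>. F \<phi> \<partial>?B (insert i I))"
    unfolding G_def by (rule B.product_nn_integral_insert[OF insert.hyps F', symmetric])
  finally show ?case .
qed

section \<open>The pinning measure\<close>

locale pinning_model =
  fixes V :: "real \<Rightarrow> ereal"
  assumes admissible: "admissible_potential V"

sublocale pinning_model \<subseteq> increment_density "\<lambda>x. exp_neg (V x)"
  by (rule increment_density_exp_neg[OF admissible])

context pinning_model
begin

abbreviation terminal_weight :: "real \<times> real \<Rightarrow> ennreal" where
  "terminal_weight \<equiv> pin (\<lambda>y. ennreal (exp_neg (V y)))"

lemma reference_measure_Suc: "reference_measure \<epsilon> (Suc n) = sites \<epsilon> n"
  by (simp add: reference_measure_def sites_def)

lemma boltzmann_weight_Suc: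
  "boltzmann_weight V (Suc n) \<phi> =
    path_weight n \<phi> * terminal_weight (zero_before \<phi> (int n - 1), zero_before \<phi> (int n))"
proof -
  let ?z = "zero_boundary (Suc n) \<phi>" and ?x = "zero_before \<phi>"
  let ?g = "\<lambda>x. exp_neg (V x)"
  have not_MInf: "V x \<noteq> -\<infinity>" for x using admissible by (auto simp: admissible_potential_def)
  have inside: "?z j = ?x j" if "j \<le> int n" for j
    using that by (simp add: zero_boundary_def zero_before_def)
  have outside: "?z j = 0" if "int n < j" for j
    using that by (simp add: zero_boundary_def)
  have "exp_neg (hamiltonian V (- 1) (int (Suc n) + 1) ?z) = (\<Prod>j\<in>{0..int n + 1}. ?g (laplacian ?z j))"
    using not_MInf by (simp add: hamiltonian_def exp_neg_sum add.commute)
  also have "\<dots> = (\<Prod>j<n + 2. ?g (laplacian ?z (int j)))"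
    by (rule prod.reindex_bij_witness[of _ int nat]) auto
  also have "\<dots> = (\<Prod>j<n. ?g (laplacian ?z (int j))) * (?g (laplacian ?z (int n)) * ?g (laplacian ?z (int (Suc n))))"
    by (simp add: mult.assoc)
  also have "(\<Prod>j<n. ?g (laplacian ?z (int j))) = (\<Prod>j<n. ?g (laplacian ?x (int j)))"
    by (intro prod.cong) (auto simp: laplacian_def inside)
  also have "laplacian ?z (int n) = ?x (int n - 1) - 2 * ?x (int n)"
    by (simp add: laplacian_def inside outside)
  also have "laplacian ?z (int (Suc n)) = ?x (int n)"
    by (simp add: laplacian_def inside outside)
  finally show ?thesis
    unfolding boltzmann_weight_def path_weight_def pin_def
    by (simp add: ennreal_mult prod_nonneg g_nonneg flip: prod_ennreal)
qed

lemma boltzmann_weight_measurable: "boltzmann_weight V (Suc n) \<in> borel_measurable (sites \<epsilon> n)"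
  unfolding boltzmann_weight_Suc
  by (intro borel_measurable_times_ennreal path_weight_measurable
        measurable_compose[OF measurable_Pair pin_measurable] zero_before_measurable) auto

lemma partition_function_Suc: "partition_function V \<epsilon> (Suc n) = return_weight \<epsilon> n"
  unfolding partition_function_def reference_measure_Suc boltzmann_weight_Suc
  by (subst sites_integral) (simp_all add: weight_to_end_def)

lemma return_weight_lower:
  assumes "0 \<le> \<epsilon>"
  shows "ennreal (1 / (32 * increment_variance) / (real k + 2)\<^sup>2) \<le> return_weight \<epsilon> k"
proof -
  obtain m where m: "weight_to_end 0 k (0, 0) = ennreal m" "1 / (32 * increment_variance) / (real k + 2)\<^sup>2 \<le> m"
    using free_weight_bounds[of k] by metis
  have "ennreal (1 / (32 * increment_variance) / (real k + 2)\<^sup>2) \<le> weight_to_end 0 k (0, 0)"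
    using m by (simp add: ennreal_leI)
  also have "\<dots> \<le> return_weight \<epsilon> k"
    unfolding weight_to_end_def by (rule funpow_step_mono_pinning) (use assms in auto)
  finally show ?thesis .
qed

lemma return_weight_pos: "0 \<le> \<epsilon> \<Longrightarrow> 0 < return_weight \<epsilon> k"
  by (rule less_le_trans[OF _ return_weight_lower]) (use increment_variance_pos in simp_all)

lemma pinning_measure_space [simp]: "space (pinning_measure V \<epsilon> (Suc n)) = space (sites \<epsilon> n)"
  and pinning_measure_sets [simp]: "sets (pinning_measure V \<epsilon> (Suc n)) = sets (sites \<epsilon> n)"
  by (simp_all add: pinning_measure_def reference_measure_Suc)

lemma emeasure_pinning_measure:
  assumes "A \<in> sets (sites \<epsilon> n)"
  shows "emeasure (pinning_measure V \<epsilon> (Suc n)) A =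
    (\<integral>\<^sup>+\<phi>. boltzmann_weight V (Suc n) \<phi> * indicator A \<phi> \<partial>sites \<epsilon> n) / return_weight \<epsilon> n"
proof -
  have "emeasure (pinning_measure V \<epsilon> (Suc n)) A =
      (\<integral>\<^sup>+\<phi>. boltzmann_weight V (Suc n) \<phi> / return_weight \<epsilon> n * indicator A \<phi> \<partial>sites \<epsilon> n)"
    unfolding pinning_measure_def reference_measure_Suc partition_function_Suc
    using assms boltzmann_weight_measurable by (intro emeasure_density borel_measurable_divide_ennreal) auto
  also have "\<dots> = (\<integral>\<^sup>+\<phi>. (boltzmann_weight V (Suc n) \<phi> * indicator A \<phi>) / return_weight \<epsilon> n \<partial>sites \<epsilon> n)"
    by (intro nn_integral_cong) (simp add: divide_ennreal_def mult_ac)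
  also have "\<dots> = (\<integral>\<^sup>+\<phi>. boltzmann_weight V (Suc n) \<phi> * indicator A \<phi> \<partial>sites \<epsilon> n) / return_weight \<epsilon> n"
    using assms boltzmann_weight_measurable by (intro nn_integral_divide borel_measurable_times_ennreal) auto
  finally show ?thesis .
qed

lemma prob_space_pinning_measure:
  assumes "0 \<le> \<epsilon>"
  shows "prob_space (pinning_measure V \<epsilon> (Suc n))"
proof
  have "(\<integral>\<^sup>+\<phi>. boltzmann_weight V (Suc n) \<phi> * indicator (space (sites \<epsilon> n)) \<phi> \<partial>sites \<epsilon> n) = return_weight \<epsilon> n"
    unfolding partition_function_Suc[symmetric] partition_function_def reference_measure_Suc
    by (intro nn_integral_cong) simp
  then show "emeasure (pinning_measure V \<epsilon> (Suc n)) (space (pinning_measure V \<epsilon> (Suc n))) = 1"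
    using return_weight_pos[OF assms, of n] weight_to_end_finite[OF assms, of n "(0, 0)"]
    by (simp add: emeasure_pinning_measure ennreal_divide_self)
qed

lemma zero_site_measurable:
  assumes "i \<le> int n"
  shows "{\<phi> \<in> space (sites \<epsilon> n). zero_before \<phi> i = 0} \<in> sets (sites \<epsilon> n)"
proof -
  have "(\<lambda>\<phi>. zero_before \<phi> i) -` {0} \<inter> space (sites \<epsilon> n) \<in> sets (sites \<epsilon> n)"
    by (rule measurable_sets[OF zero_before_measurable[OF assms]]) simp
  then show ?thesis by (simp add: vimage_def Int_def conj_commute)
qed

lemma emeasure_contact:
  assumes "0 \<le> \<epsilon>" "1 \<le> i" "i \<le> n"
  shows "emeasure (pinning_measure V \<epsilon> (Suc n)) {\<phi> \<in> space (sites \<epsilon> n). zero_before \<phi> (int i) = 0} =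
    ennreal \<epsilon> * contact_split_weight \<epsilon> n (i - 1) / return_weight \<epsilon> n"
proof -
  have "(\<integral>\<^sup>+\<phi>. boltzmann_weight V (Suc n) \<phi> *
        indicator {\<phi> \<in> space (sites \<epsilon> n). zero_before \<phi> (int i) = 0} \<phi> \<partial>sites \<epsilon> n) =
      (\<integral>\<^sup>+\<phi>. indicator {0} (zero_before \<phi> (int i)) * path_weight n \<phi> *
        terminal_weight (zero_before \<phi> (int n - 1), zero_before \<phi> (int n)) \<partial>sites \<epsilon> n)"
    by (intro nn_integral_cong) (auto simp: boltzmann_weight_Suc indicator_def)
  also have "\<dots> = ennreal \<epsilon> * contact_split_weight \<epsilon> n (i - 1)"
    by (rule sites_integral_contact[OF assms])
  finally show ?thesis using assms by (subst emeasure_pinning_measure) (auto intro: zero_site_measurable)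
qed

lemma contact_number_measurable:
  "(\<lambda>\<phi>. real (contact_number (Suc n) \<phi>)) \<in> borel_measurable (sites \<epsilon> n)"
proof -
  have "real (contact_number (Suc n) \<phi>) =
      (\<Sum>i\<in>{1..int (Suc n)}. indicator {0} (zero_boundary (Suc n) \<phi> i))" for \<phi>
  proof -
    have "real (contact_number (Suc n) \<phi>) = (\<Sum>i | i \<in> {1..int (Suc n)} \<and> zero_boundary (Suc n) \<phi> i = 0. 1)"
      by (simp add: contact_number_def)
    also have "\<dots> = (\<Sum>i\<in>{1..int (Suc n)}. if zero_boundary (Suc n) \<phi> i = 0 then 1 else 0)"
      by (rule sum.inter_filter) simp
    finally show ?thesis by (simp add: indicator_def of_bool_def)
  qed
  moreover have "(\<lambda>\<phi>. zero_boundary (Suc n) \<phi> i) \<in> borel_measurable (sites \<epsilon> n)" for i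
  proof (cases "i \<in> {1..int n}")
    case True
    then have "(\<lambda>\<phi>. zero_boundary (Suc n) \<phi> i) = (\<lambda>\<phi>. zero_before \<phi> i)"
      by (auto simp: zero_boundary_def zero_before_def)
    then show ?thesis using True by (simp add: zero_before_measurable)
  qed (auto simp: zero_boundary_def)
  ultimately show ?thesis
    by (simp only:) (intro borel_measurable_sum measurable_compose[OF _ borel_measurable_indicator], auto)
qed

text \<open>
  With probability at least \<open>1 / 2\<close> the field at \<open>\<epsilon>'\<close> has at most \<open>\<delta> * N\<close> contacts. On this event the
  density with respect to the field at \<open>\<epsilon>\<close>, before normalization, is at most \<open>(\<epsilon>' / \<epsilon>) powr (\<delta> * N)\<close>.
\<close>

lemma return_weight_le_by_tilting:
  assumes \<epsilon>: "0 < \<epsilon>" "\<epsilon> \<le> \<epsilon>'" and \<delta>: "0 \<le> \<delta>"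
    and few: "\<P>(\<phi> in pinning_measure V \<epsilon>' (Suc n). real (contact_number (Suc n) \<phi>) / real (Suc n) > \<delta>) \<le> 1 / 2"
  shows "return_weight \<epsilon>' n \<le> 2 * (ennreal ((\<epsilon>' / \<epsilon>) powr (\<delta> * real (Suc n))) * return_weight \<epsilon> n)"
proof -
  have \<epsilon>': "0 \<le> \<epsilon>'" using \<epsilon> by simp
  define r where "r = \<epsilon>' / \<epsilon>"
  have r: "1 \<le> r" using \<epsilon> by (simp add: r_def)
  interpret prob_space "pinning_measure V \<epsilon>' (Suc n)" by (rule prob_space_pinning_measure[OF \<epsilon>'])
  let ?\<mu> = "pinning_measure V \<epsilon>' (Suc n)"
  define B where "B = {\<phi> \<in> space (sites \<epsilon>' n). \<not> real (contact_number (Suc n) \<phi>) / real (Suc n) > \<delta>}"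
  have quotient: "(\<lambda>\<phi>. real (contact_number (Suc n) \<phi>) / real (Suc n)) \<in> borel_measurable (sites \<epsilon> n)" for \<epsilon>
    by (intro borel_measurable_divide contact_number_measurable borel_measurable_const)
  have B: "B \<in> sets (sites \<epsilon>' n)"
    unfolding B_def not_less by (intro borel_measurable_le borel_measurable_const quotient)
  have "prob {\<phi> \<in> space ?\<mu>. \<not> real (contact_number (Suc n) \<phi>) / real (Suc n) > \<delta>} =
      1 - prob {\<phi> \<in> space ?\<mu>. real (contact_number (Suc n) \<phi>) / real (Suc n) > \<delta>}"
    unfolding pinning_measure_space
    by (rule prob_neg[unfolded pinning_measure_space pinning_measure_sets])
      (intro borel_measurable_less borel_measurable_const quotient)
  then have "1 / 2 \<le> prob B" using few by (simp add: B_def)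
  then have "ennreal (1 / 2) \<le> emeasure ?\<mu> B" unfolding emeasure_eq_measure by (rule ennreal_leI)
  also have "emeasure ?\<mu> B = (\<integral>\<^sup>+\<phi>. boltzmann_weight V (Suc n) \<phi> * indicator B \<phi> \<partial>sites \<epsilon>' n) / return_weight \<epsilon>' n"
    by (rule emeasure_pinning_measure[OF B])
  finally have half: "ennreal (1 / 2) \<le>
    (\<integral>\<^sup>+\<phi>. boltzmann_weight V (Suc n) \<phi> * indicator B \<phi> \<partial>sites \<epsilon>' n) / return_weight \<epsilon>' n" .
  have sets_eq: "sets (sites \<epsilon> n) = sets (sites \<epsilon>' n)"
    unfolding sites_def by (intro sets_PiM_cong) auto
  have meas: "(\<lambda>\<phi>. boltzmann_weight V (Suc n) \<phi> * indicator B \<phi>) \<in> borel_measurable (sites \<epsilon> n)"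
    using B sets_eq by (intro borel_measurable_times_ennreal boltzmann_weight_measurable borel_measurable_indicator) auto
  have "(\<integral>\<^sup>+\<phi>. boltzmann_weight V (Suc n) \<phi> * indicator B \<phi> \<partial>sites \<epsilon>' n) =
      (\<integral>\<^sup>+\<phi>. boltzmann_weight V (Suc n) \<phi> * indicator B \<phi> *
        (\<Prod>i\<in>{1..int n}. if \<phi> i = 0 then ennreal (\<epsilon>' / \<epsilon>) else 1) \<partial>sites \<epsilon> n)"
    using meas unfolding sites_def by (intro change_of_pinning[symmetric] \<epsilon> \<epsilon>') auto
  also have "\<dots> \<le> (\<integral>\<^sup>+\<phi>. ennreal (r powr (\<delta> * real (Suc n))) * boltzmann_weight V (Suc n) \<phi> \<partial>sites \<epsilon> n)"
  proof (intro nn_integral_mono)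
    fix \<phi> :: "int \<Rightarrow> real"
    show "boltzmann_weight V (Suc n) \<phi> * indicator B \<phi> * (\<Prod>i\<in>{1..int n}. if \<phi> i = 0 then ennreal (\<epsilon>' / \<epsilon>) else 1)
        \<le> ennreal (r powr (\<delta> * real (Suc n))) * boltzmann_weight V (Suc n) \<phi>"
    proof (cases "\<phi> \<in> B")
      case True
      let ?Z = "{i \<in> {1..int n}. \<phi> i = 0}"
      have "(\<Prod>i\<in>{1..int n}. if \<phi> i = 0 then ennreal r else 1) = (\<Prod>i\<in>?Z. ennreal r)"
        by (rule prod.inter_filter[symmetric]) simp
      also have "\<dots> = ennreal (r powr real (card ?Z))"
        using r by (simp add: ennreal_power powr_realpow)
      also have "\<dots> \<le> ennreal (r powr (\<delta> * real (Suc n)))"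
      proof (intro ennreal_leI powr_mono r)
        have "card ?Z \<le> contact_number (Suc n) \<phi>"
          unfolding contact_number_def
        proof (rule card_mono)
          show "?Z \<subseteq> {i \<in> {1..int (Suc n)}. zero_boundary (Suc n) \<phi> i = 0}"
            by (auto simp: zero_boundary_def)
        qed (rule finite_subset[of _ "{1..int (Suc n)}"], auto)
        moreover have "real (contact_number (Suc n) \<phi>) \<le> \<delta> * real (Suc n)"
          using True by (simp add: B_def not_less divide_le_eq mult.commute)
        ultimately show "real (card ?Z) \<le> \<delta> * real (Suc n)" by linarith
      qed
      finally have "(\<Prod>i\<in>{1..int n}. if \<phi> i = 0 then ennreal (\<epsilon>' / \<epsilon>) else 1) \<le> ennreal (r powr (\<delta> * real (Suc n)))"
        by (simp only: r_def)
      then have "boltzmann_weight V (Suc n) \<phi> * (\<Prod>i\<in>{1..int n}. if \<phi> i = 0 then ennreal (\<epsilon>' / \<epsilon>) else 1)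
          \<le> boltzmann_weight V (Suc n) \<phi> * ennreal (r powr (\<delta> * real (Suc n)))"
        by (rule mult_left_mono) simp
      then show ?thesis using True by (simp add: mult.commute)
    qed simp
  qed
  also have "\<dots> = ennreal (r powr (\<delta> * real (Suc n))) * return_weight \<epsilon> n"
    unfolding partition_function_Suc[symmetric] partition_function_def reference_measure_Suc
    by (rule nn_integral_cmult) (rule boltzmann_weight_measurable)
  finally have upper: "(\<integral>\<^sup>+\<phi>. boltzmann_weight V (Suc n) \<phi> * indicator B \<phi> \<partial>sites \<epsilon>' n) \<le>
      ennreal (r powr (\<delta> * real (Suc n))) * return_weight \<epsilon> n" .
  obtain z where z: "return_weight \<epsilon>' n = ennreal z" "0 < z"
    using return_weight_pos[OF \<epsilon>', of n] weight_to_end_finite[OF \<epsilon>', of n "(0, 0)"]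
    by (cases "return_weight \<epsilon>' n") auto
  have "2 * (ennreal (1 / 2) * ennreal z) \<le> 2 * (ennreal (r powr (\<delta> * real (Suc n))) * return_weight \<epsilon> n / ennreal z * ennreal z)"
    using half upper unfolding z(1)
    by (intro mult_left_mono mult_right_mono order_trans[OF half[unfolded z(1)]] divide_right_mono_ennreal) auto
  also have "\<dots> = 2 * (ennreal (r powr (\<delta> * real (Suc n))) * return_weight \<epsilon> n)"
  proof -
    have "inverse (ennreal z) * ennreal z = 1"
      using z(2) by (simp add: inverse_ennreal flip: ennreal_mult)
    then show ?thesis by (simp only: divide_ennreal_def mult.assoc mult_1_right)
  qed
  also have "2 * (ennreal (1 / 2) * ennreal z) = ennreal (2 * (1 / 2 * z))"
    using z(2) by (simp only: ennreal_mult flip: ennreal_numeral)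
  finally show ?thesis by (simp add: z(1) r_def)
qed

text \<open>
  Compare with a pinning strength for which the return weights are bounded, and choose the contact
  density \<open>\<delta>\<close> so small that the price of the change is at most \<open>\<rho>\<close> per site.
\<close>

lemma return_weight_growth:
  assumes crit: "critical_point V \<epsilon>\<^sub>c" and \<rho>: "1 < \<rho>"
  shows "\<exists>K\<ge>0. \<forall>k. return_weight \<epsilon>\<^sub>c k \<le> ennreal (K * \<rho> ^ k)"
proof -
  have \<epsilon>\<^sub>c: "0 < \<epsilon>\<^sub>c" using crit by (simp add: critical_point_def)
  obtain \<epsilon> B where \<epsilon>: "0 < \<epsilon>" "\<epsilon> \<le> \<epsilon>\<^sub>c" and B: "0 \<le> B" "\<And>k. return_weight \<epsilon> k \<le> ennreal B"
    using return_weight_bounded_weak_pinning[OF \<epsilon>\<^sub>c] by metis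
  define r where "r = \<epsilon>\<^sub>c / \<epsilon>"
  have r: "1 \<le> r" using \<epsilon> by (simp add: r_def)
  define \<delta> where "\<delta> = ln \<rho> / (ln r + 1)"
  have \<delta>: "0 < \<delta>" using \<rho> r by (simp add: \<delta>_def add_nonneg_pos)
  have "r powr \<delta> \<le> \<rho>"
  proof -
    have "\<delta> * ln r \<le> \<delta> * (ln r + 1)" using \<delta> by (intro mult_left_mono) auto
    also have "\<dots> = ln \<rho>"
    proof -
      have "0 < ln r + 1" using ln_ge_zero[OF r] by simp
      then show ?thesis by (simp add: \<delta>_def)
    qed
    finally have "exp (\<delta> * ln r) \<le> exp (ln \<rho>)" by simp
    then show ?thesis using r \<rho> by (simp add: powr_def)
  qed
  then have tilt: "r powr (\<delta> * real n) \<le> \<rho> ^ n" for n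
  proof -
    assume "r powr \<delta> \<le> \<rho>"
    then have "(r powr \<delta>) ^ n \<le> \<rho> ^ n" by (intro power_mono) auto
    also have "(r powr \<delta>) ^ n = r powr (\<delta> * real n)" using r by (simp add: powr_powr flip: powr_realpow)
    finally show ?thesis .
  qed
  obtain c where c: "0 < c" and ev: "\<forall>\<^sub>F N in sequentially.
      \<P>(\<phi> in pinning_measure V \<epsilon>\<^sub>c N. real (contact_number N \<phi>) / real N > \<delta>) \<le> exp (- c * real N)"
    using crit \<delta> \<epsilon>\<^sub>c unfolding critical_point_def by (meson less_imp_le order_refl)
  have "(\<lambda>N. exp (- c) ^ N) \<longlonglongrightarrow> 0" using c by (intro LIMSEQ_power_zero) simp
  then have "\<forall>\<^sub>F N in sequentially. exp (- c) ^ N < 1 / 2" by (rule order_tendstoD) simp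
  with ev have "\<forall>\<^sub>F N in sequentially.
      \<P>(\<phi> in pinning_measure V \<epsilon>\<^sub>c N. real (contact_number N \<phi>) / real N > \<delta>) \<le> 1 / 2"
  proof eventually_elim
    case (elim N)
    have "exp (- c * real N) = exp (- c) ^ N" by (simp add: exp_of_nat_mult[symmetric] mult.commute)
    then show ?case using elim by simp
  qed
  then obtain N0 where N0: "\<And>N. N0 \<le> N \<Longrightarrow>
      \<P>(\<phi> in pinning_measure V \<epsilon>\<^sub>c N. real (contact_number N \<phi>) / real N > \<delta>) \<le> 1 / 2"
    unfolding eventually_sequentially by blast
  define w where "w = (\<lambda>k. enn2real (return_weight \<epsilon>\<^sub>c k))"
  have w: "return_weight \<epsilon>\<^sub>c k = ennreal (w k)" "0 \<le> w k" for k
    using weight_to_end_finite[of \<epsilon>\<^sub>c] \<epsilon>\<^sub>c by (auto simp: w_def)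
  define K where "K = 2 * \<rho> * B + (\<Sum>k<N0. w k)"
  have sum_nn: "0 \<le> (\<Sum>k<N0. w k)" using w by (intro sum_nonneg) auto
  have K: "0 \<le> K" using \<rho> B sum_nn by (simp add: K_def)
  have "return_weight \<epsilon>\<^sub>c k \<le> ennreal (K * \<rho> ^ k)" for k
  proof (cases "k < N0")
    case True
    have "w k \<le> (\<Sum>k<N0. w k)" using w True by (intro member_le_sum) auto
    also have "\<dots> \<le> K" using \<rho> B by (simp add: K_def)
    also have "K \<le> K * \<rho> ^ k" using K \<rho> mult_left_mono[of 1 "\<rho> ^ k" K] by simp
    finally show ?thesis by (simp add: w ennreal_leI)
  next
    case False
    have "return_weight \<epsilon>\<^sub>c k \<le> 2 * (ennreal (r powr (\<delta> * real (Suc k))) * return_weight \<epsilon> k)"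
      unfolding r_def using False \<delta> by (intro return_weight_le_by_tilting \<epsilon> N0) auto
    also have "\<dots> \<le> 2 * (ennreal (\<rho> ^ Suc k) * ennreal B)"
      using tilt[of "Suc k"] B by (intro mult_left_mono mult_mono ennreal_leI) auto
    also have "\<dots> = ennreal (2 * \<rho> * B * \<rho> ^ k)"
      using \<rho> B by (simp add: mult_ac flip: ennreal_mult ennreal_numeral)
    also have "\<dots> \<le> ennreal (K * \<rho> ^ k)"
      using \<rho> sum_nn by (intro ennreal_leI mult_right_mono) (auto simp: K_def)
    finally show ?thesis .
  qed
  then show ?thesis using K by blast
qed

text \<open>
  Union bound over the sites, with \<open>sum_contact_split_weight_le\<close> for the weights of the contacts and
  the quadratic lower bound for the normalization.
\<close>

lemma no_interior_contact:
  assumes crit: "critical_point V \<epsilon>\<^sub>c" and \<epsilon>: "0 \<le> \<epsilon>" "\<epsilon> < \<epsilon>\<^sub>c" and \<eta>: "0 < \<eta>"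
  shows "\<exists>L0. \<forall>L\<ge>L0. \<forall>n. 1 - \<eta> \<le>
    \<P>(\<phi> in pinning_measure V \<epsilon> (Suc n). contact_set (Suc n) \<phi> \<inter> {int L..int (Suc n) - int L} = {})"
proof -
  have "(\<Sum>k. return_weight \<epsilon> k) < \<top>"
    by (rule suminf_return_weight_finite[OF \<epsilon> return_weight_growth[OF crit]])
  then have mass: "(\<Sum>n. contact_mass \<epsilon> n) < \<top>"
    by (rule suminf_contact_mass_finite[OF \<epsilon>(1)])
  obtain D where D: "0 \<le> D" "\<And>k. return_weight \<epsilon> k \<le> ennreal (D / (real k + 2)\<^sup>2)"
    using return_weight_bound[OF \<epsilon>(1) mass] by metis
  define b where "b = 1 + \<epsilon> * exp_neg (V 0)"
  have b: "1 \<le> b" using \<epsilon> g_0_pos by (simp add: b_def)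
  define C where "C = \<epsilon> * (8 * b * D) * (32 * increment_variance)"
  have C: "0 \<le> C" using \<epsilon> b D increment_variance_pos by (simp add: C_def)
  define h where "h = \<eta> / (C + 1)"
  have h: "0 < h" using C \<eta> by (simp add: h_def)
  have Ch: "C * h \<le> \<eta>" using C \<eta> by (simp add: h_def field_simps)
  obtain P where P: "1 \<le> P" "\<And>Q n. P \<le> Q \<Longrightarrow> (\<Sum>i\<in>{Q..<n}. contact_mass \<epsilon> i) \<le> ennreal h"
    using suminf_ennreal_tail[OF mass h] by metis
  have "1 - \<eta> \<le> \<P>(\<phi> in pinning_measure V \<epsilon> (Suc n). contact_set (Suc n) \<phi> \<inter> {int L..int (Suc n) - int L} = {})"
    if L: "Suc P \<le> L" for L n
  proof -
    interpret prob_space "pinning_measure V \<epsilon> (Suc n)" by (rule prob_space_pinning_measure[OF \<epsilon>(1)])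
    let ?\<mu> = "pinning_measure V \<epsilon> (Suc n)" and ?I = "{L..<Suc (Suc n) - L}"
    define A where "A = (\<lambda>i. {\<phi> \<in> space (sites \<epsilon> n). zero_before \<phi> (int i) = 0})"
    have A: "A i \<in> sets (sites \<epsilon> n)" if "i \<in> ?I" for i
      unfolding A_def using that L by (intro zero_site_measurable) auto
    have union: "(\<Union>i\<in>?I. A i) \<in> sets (sites \<epsilon> n)" using A by (intro sets.finite_UN) auto
    have event: "{\<phi> \<in> space ?\<mu>. contact_set (Suc n) \<phi> \<inter> {int L..int (Suc n) - int L} = {}} =
        space ?\<mu> - (\<Union>i\<in>?I. A i)"
    proof -
      have "contact_set (Suc n) \<phi> \<inter> {int L..int (Suc n) - int L} \<noteq> {} \<longleftrightarrow> (\<exists>i\<in>?I. zero_before \<phi> (int i) = 0)" for \<phi>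
      proof
        assume "contact_set (Suc n) \<phi> \<inter> {int L..int (Suc n) - int L} \<noteq> {}"
        then obtain s where s: "zero_boundary (Suc n) \<phi> s = 0" "int L \<le> s" "s \<le> int (Suc n) - int L"
          by (auto simp: contact_set_def)
        have "nat s \<in> ?I" "zero_before \<phi> (int (nat s)) = 0"
          using s L by (auto simp: zero_boundary_def zero_before_def)
        then show "\<exists>i\<in>?I. zero_before \<phi> (int i) = 0" by blast
      next
        assume "\<exists>i\<in>?I. zero_before \<phi> (int i) = 0"
        then obtain i where i: "i \<in> ?I" "zero_before \<phi> (int i) = 0" by blast
        then have "int i \<in> contact_set (Suc n) \<phi> \<inter> {int L..int (Suc n) - int L}"
          using L by (auto simp: contact_set_def zero_boundary_def zero_before_def)
        then show "contact_set (Suc n) \<phi> \<inter> {int L..int (Suc n) - int L} \<noteq> {}" by blast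
      qed
      then show ?thesis by (auto simp: A_def)
    qed
    obtain z where z: "return_weight \<epsilon> n = ennreal z" "0 < z"
      using return_weight_pos[OF \<epsilon>(1), of n] weight_to_end_finite[OF \<epsilon>(1), of n "(0, 0)"]
      by (cases "return_weight \<epsilon> n") auto
    have z_lower: "1 / (32 * increment_variance) / (real n + 2)\<^sup>2 \<le> z"
      using return_weight_lower[OF \<epsilon>(1), of n] z by simp
    have "emeasure ?\<mu> (\<Union>i\<in>?I. A i) \<le> (\<Sum>i\<in>?I. emeasure ?\<mu> (A i))"
      using A by (intro emeasure_subadditive_finite) auto
    also have "\<dots> = (\<Sum>i\<in>?I. ennreal \<epsilon> * contact_split_weight \<epsilon> n (i - 1) / return_weight \<epsilon> n)"
      unfolding A_def using L by (intro sum.cong emeasure_contact[OF \<epsilon>(1)]) auto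
    also have "\<dots> = ennreal \<epsilon> * (\<Sum>i\<in>?I. contact_split_weight \<epsilon> n (i - 1)) / return_weight \<epsilon> n"
      by (simp add: sum_distrib_left sum_distrib_right divide_ennreal_def)
    also have "(\<Sum>i\<in>?I. contact_split_weight \<epsilon> n (i - 1)) = (\<Sum>i\<in>{L - 1..<n - (L - 1)}. contact_split_weight \<epsilon> n i)"
      using L by (intro sum.reindex_bij_witness[of _ Suc "\<lambda>i. i - 1"]) auto
    also have "ennreal \<epsilon> * \<dots> / return_weight \<epsilon> n \<le> ennreal \<epsilon> * ennreal (8 * b * h * D / (real n + 2)\<^sup>2) / return_weight \<epsilon> n"
    proof (intro divide_right_mono_ennreal mult_left_mono)
      show "(\<Sum>i\<in>{L - 1..<n - (L - 1)}. contact_split_weight \<epsilon> n i) \<le> ennreal (8 * b * h * D / (real n + 2)\<^sup>2)"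
        unfolding b_def using D P h L by (intro sum_contact_split_weight_le[OF \<epsilon>(1)]) auto
    qed simp
    also have "\<dots> = ennreal (\<epsilon> * (8 * b * h * D / (real n + 2)\<^sup>2) / z)"
    proof -
      have nn: "0 \<le> 8 * b * h * D / (real n + 2)\<^sup>2" using b h D by simp
      then have "ennreal \<epsilon> * ennreal (8 * b * h * D / (real n + 2)\<^sup>2) = ennreal (\<epsilon> * (8 * b * h * D / (real n + 2)\<^sup>2))"
        using \<epsilon> by (intro ennreal_mult[symmetric]) auto
      then show ?thesis unfolding z(1) using nn \<epsilon> z(2)
        by (simp only:) (intro divide_ennreal mult_nonneg_nonneg)
    qed
    also have "\<dots> \<le> ennreal (C * h)"
    proof (rule ennreal_leI)
      have "\<epsilon> * (8 * b * h * D / (real n + 2)\<^sup>2) = (C * h) * (1 / (32 * increment_variance) / (real n + 2)\<^sup>2)"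
        using increment_variance_pos by (simp add: C_def)
      also have "\<dots> \<le> (C * h) * z" using C h by (intro mult_left_mono z_lower) auto
      finally show "\<epsilon> * (8 * b * h * D / (real n + 2)\<^sup>2) / z \<le> C * h" using z(2) by (simp only: pos_divide_le_eq)
    qed
    also have "\<dots> \<le> ennreal \<eta>" by (rule ennreal_leI[OF Ch])
    finally have "prob (\<Union>i\<in>?I. A i) \<le> \<eta>" using \<eta> by (simp add: emeasure_eq_measure)
    moreover have "prob (space ?\<mu> - (\<Union>i\<in>?I. A i)) = 1 - prob (\<Union>i\<in>?I. A i)"
      using union by (intro prob_compl) simp
    ultimately show ?thesis unfolding event by simp
  qed
  then show ?thesis by blast
qed

end

theorem theorem1p3:
  fixes V :: "real \<Rightarrow> ereal" and \<epsilon> \<epsilon>\<^sub>c :: real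
  assumes "admissible_potential V"
    and "critical_point V \<epsilon>\<^sub>c"
    and "0 \<le> \<epsilon>" and "\<epsilon> < \<epsilon>\<^sub>c"
  shows "(\<lambda>L::nat. liminf (\<lambda>N::nat.
            ereal (\<P>(\<phi> in pinning_measure V \<epsilon> N.
              contact_set N \<phi> \<inter> {int L..int N - int L} = {})))) \<longlonglongrightarrow> 1"
proof -
  interpret pinning_model V using assms(1) by unfold_locales
  let ?p = "\<lambda>L N. \<P>(\<phi> in pinning_measure V \<epsilon> N. contact_set N \<phi> \<inter> {int L..int N - int L} = {})"
  have le_1: "liminf (\<lambda>N. ereal (?p L N)) \<le> 1" for L
  proof -
    have "\<forall>\<^sub>F N in sequentially. ereal (?p L N) \<le> 1"
      using eventually_gt_at_top[of 0]
    proof eventually_elim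
      case (elim N)
      then obtain n where N: "N = Suc n" by (cases N) auto
      interpret prob_space "pinning_measure V \<epsilon> N" unfolding N by (rule prob_space_pinning_measure[OF assms(3)])
      show ?case by simp
    qed
    then have "liminf (\<lambda>N. ereal (?p L N)) \<le> liminf (\<lambda>N. 1)" by (rule Liminf_mono)
    then show ?thesis by (simp add: Liminf_const)
  qed
  show ?thesis
  proof (rule order_tendstoI)
    fix a :: ereal assume "a < 1"
    then obtain r where r: "a < ereal r" "ereal r < 1" using ereal_dense2 by blast
    then have "0 < 1 - r" by simp
    from no_interior_contact[OF assms(2-4) this] obtain L0 where
      L0: "\<And>L n. L0 \<le> L \<Longrightarrow> r \<le> ?p L (Suc n)" by auto
    have "a < liminf (\<lambda>N. ereal (?p L N))" if "L0 \<le> L" for L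
    proof -
      have "\<forall>\<^sub>F N in sequentially. ereal r \<le> ereal (?p L N)"
        using eventually_gt_at_top[of 0]
      proof eventually_elim
        case (elim N)
        then obtain n where "N = Suc n" by (cases N) auto
        then show ?case using L0[OF that, of n] by simp
      qed
      then have "ereal r \<le> liminf (\<lambda>N. ereal (?p L N))" by (rule Liminf_bounded)
      with r(1) show ?thesis by (rule less_le_trans)
    qed
    then show "\<forall>\<^sub>F L in sequentially. a < liminf (\<lambda>N. ereal (?p L N))"
      unfolding eventually_sequentially by blast
  next
    fix a :: ereal assume "1 < a"
    then show "\<forall>\<^sub>F L in sequentially. liminf (\<lambda>N. ereal (?p L N)) < a"
      using le_1 by (intro always_eventually allI) (rule le_less_trans)
  qed
qed

end
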